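(* Let $d\ge1$, let $f$ be an arbitrary probability density on $\mathbb{R}^d$, and let $(r_n)$ be positive reals with $r_n \to 0$ and $n r_n^d \to \infty$. Let $X_1,\ldots,X_n$ be i.i.d. with density $f$ and let $G_n$ be the graph on $[n]$ with edge $\{i,j\}$ ($i\neq j$) iff $\|X_i-X_j\|\le r_n$ (Euclidean norm). Let $D_1$ be the degree of vertex $1$ and $\delta_1$ the number of edges of $G_n$ between neighbors of vertex $1$, and set $W_4 = \delta_1/\binom{D_1}{2}$ when $D_1\ge 2$ and $W_4=0$ otherwise. Let $w_d = \mathbb{P}\{\|X-Y\|\le1\}$ for $X,Y$ independent uniform on the unit ball of $\mathbb{R}^d$. Then $W_4 \to w_d$ in probability as $n\to\infty$, and hence $\Delta_n = \mathrm{argmin}_{s\ge1}|W_4 - w_s| \to d$ in probability. *)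

theory Defs
  imports "HOL-Probability.Probability"
begin

definition Rd :: "nat \<Rightarrow> (nat \<Rightarrow> real) measure" where
  "Rd s = PiM {..<s} (\<lambda>_. lborel)"

definition edist :: "nat \<Rightarrow> (nat \<Rightarrow> real) \<Rightarrow> (nat \<Rightarrow> real) \<Rightarrow> real" where
  "edist s x y = sqrt (\<Sum>i<s. (x i - y i)^2)"

definition unit_ball :: "nat \<Rightarrow> (nat \<Rightarrow> real) set" where
  "unit_ball s = {x \<in> space (Rd s). edist s x (\<lambda>_. 0) \<le> 1}"

definition w :: "nat \<Rightarrow> real" where
  "w s = (let U = uniform_measure (Rd s) (unit_ball s) in
          measure (U \<Otimes>\<^sub>M U) {z \<in> space (U \<Otimes>\<^sub>M U). edist s (fst z) (snd z) \<le> 1})"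

definition gadj :: "nat \<Rightarrow> (nat \<Rightarrow> nat \<Rightarrow> real) \<Rightarrow> real \<Rightarrow> nat \<Rightarrow> nat \<Rightarrow> bool" where
  "gadj d p r i j = (i \<noteq> j \<and> edist d (p i) (p j) \<le> r)"

definition nbrs1 :: "nat \<Rightarrow> (nat \<Rightarrow> nat \<Rightarrow> real) \<Rightarrow> real \<Rightarrow> nat \<Rightarrow> nat set" where
  "nbrs1 d p r n = {j \<in> {1..n}. gadj d p r 1 j}"

definition deg1 :: "nat \<Rightarrow> (nat \<Rightarrow> nat \<Rightarrow> real) \<Rightarrow> real \<Rightarrow> nat \<Rightarrow> nat" where
  "deg1 d p r n = card (nbrs1 d p r n)"

definition tri1 :: "nat \<Rightarrow> (nat \<Rightarrow> nat \<Rightarrow> real) \<Rightarrow> real \<Rightarrow> nat \<Rightarrow> nat" where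
  "tri1 d p r n = card {{i, j} | i j. i \<in> nbrs1 d p r n \<and> j \<in> nbrs1 d p r n \<and> gadj d p r i j}"

definition W4 :: "nat \<Rightarrow> (nat \<Rightarrow> nat \<Rightarrow> real) \<Rightarrow> real \<Rightarrow> nat \<Rightarrow> real" where
  "W4 d p r n = (if deg1 d p r n \<ge> 2
                 then real (tri1 d p r n) / real (deg1 d p r n choose 2) else 0)"

definition argmin_dim :: "real \<Rightarrow> nat set" where
  "argmin_dim x = {s. 1 \<le> s \<and> (\<forall>t. 1 \<le> t \<longrightarrow> \<bar>x - w s\<bar> \<le> \<bar>x - w t\<bar>)}"

definition conv_in_prob :: "'a measure \<Rightarrow> (nat \<Rightarrow> 'a \<Rightarrow> real) \<Rightarrow> real \<Rightarrow> bool" where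
  "conv_in_prob M Y c =
     (\<forall>\<epsilon>>0. (\<lambda>n. measure M {\<omega> \<in> space M. \<bar>Y n \<omega> - c\<bar> > \<epsilon>}) \<longlonglongrightarrow> 0)"

end

theory Submission
  imports Defs
begin

text \<open>
  Fix \<open>X 1 = x\<close> with \<open>f x > 0\<close>. The kernel "\<open>y, z\<close> and \<open>x\<close> are pairwise within \<open>r\<close>", centred by \<open>c\<close>
  times "\<open>y\<close> and \<open>z\<close> are within \<open>r\<close> of \<open>x\<close>", has mean zero for \<open>c = q / p\<^sup>2\<close>, the conditional probability
  that two neighbours are adjacent. A second moment bound for the resulting U-statistic shows that
  \<open>W4\<close> is close to \<open>c\<close> as soon as the mean degree \<open>(n - 1) p\<close> is large.

  No density theorem is needed for \<open>c \<longlonglongrightarrow> w d\<close>: both \<open>p\<close> and \<open>q\<close> are controlled by the oscillation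
  \<open>\<integral> \<bar>f y - f x\<bar> dy\<close> over the ball \<open>B(x, r)\<close>, whose integral over \<open>x\<close> is \<open>o(r^d)\<close> by continuity of
  translations in \<open>L\<^sup>1\<close>. By Markov the oscillation is \<open>\<le> \<eta> f(x) vol B(x, r)\<close> outside a set of small
  probability.

  For the estimated dimension one needs that \<open>w\<close> is strictly decreasing. Cutting the lens
  \<open>B(0,1) \<inter> B(x,1)\<close> by the bisecting hyperplane and translating one half by \<open>-x\<close> yields
  \<open>w d = E (min 1 (2 \<bar>Y\<^sub>1\<bar>))^d\<close> for a uniform point \<open>Y\<close> of the unit ball, and both the integrand and
  \<open>\<bar>Y\<^sub>1\<bar>\<close> decrease with the dimension.
\<close>

section \<open>Lebesgue measure on coordinate space\<close>

text \<open>For mean degree \<mu> \<ge> 4 the second moment of the centred sum is at most of order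
  \<open>\<mu> ^ 3\<close>, because only overlapping index pairs are correlated, while the
  normalisation \<open>D * (D - 1)\<close> is of order \<open>\<mu>\<^sup>2\<close>; the squared
  error is then of order 1 / \<mu>. Two kinds of centre x are bad: those with large relative
  oscillation and those with small (n - 1) f(x) vol B(x, r). Both sets are weighed by f itself. In
  Markov's inequality this weight cancels the f(x) in the threshold, and the second set vanishes in
  measure because f > 0 almost surely under its own law. Strict monotonicity of w has to yield a
  positive gap around w d, because the minimum ranges over infinitely many dimensions. Points are
  functions on an index set and the measure is a product of lines, so the rotation invariance behind
  the one-variable form of the lens is built from shears, each of which is a translation in a single
  coordinate.\<close>

lemma nn_integral_PiM_lborel_affine:
  fixes c :: real and t :: "'i \<Rightarrow> real"
  assumes "finite I" "c \<noteq> 0" and "F \<in> borel_measurable (PiM I (\<lambda>_. lborel))"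
  shows "(\<integral>\<^sup>+x. F x \<partial>PiM I (\<lambda>_. lborel)) =
    ennreal (\<bar>c\<bar> ^ card I) * (\<integral>\<^sup>+x. F (\<lambda>i\<in>I. t i + c * x i) \<partial>PiM I (\<lambda>_. lborel))"
  using assms(1,3)
proof (induction I arbitrary: F)
  case empty
  show ?case by (simp add: PiM_empty nn_integral_count_space_finite restrict_def)
next
  case (insert j I)
  interpret product_sigma_finite "\<lambda>_. lborel :: real measure" by standard
  note [measurable] = insert.prems
  note [simp] = insert.hyps
  interpret I: sigma_finite_measure "PiM I (\<lambda>_. lborel :: real measure)" by (rule sigma_finite) simp
  have upd[measurable]: "(\<lambda>x. F (x(j := y))) \<in> borel_measurable (PiM I (\<lambda>_. lborel))" for y
    by measurable
  have split: "(\<lambda>i\<in>insert j I. t i + c * (x(j := y)) i) = (\<lambda>i\<in>I. t i + c * x i)(j := t j + c * y)" for x y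
    using insert.hyps by (auto simp: fun_eq_iff)
  have "(\<integral>\<^sup>+x. F x \<partial>PiM (insert j I) (\<lambda>_. lborel)) = (\<integral>\<^sup>+y. (\<integral>\<^sup>+x. F (x(j := y)) \<partial>PiM I (\<lambda>_. lborel)) \<partial>lborel)"
    by (rule product_nn_integral_insert_rev) auto
  also have "\<dots> = (\<integral>\<^sup>+y. ennreal (\<bar>c\<bar> ^ card I) *
      (\<integral>\<^sup>+x. F ((\<lambda>i\<in>I. t i + c * x i)(j := y)) \<partial>PiM I (\<lambda>_. lborel)) \<partial>lborel)"
    by (subst insert.IH[OF upd]) simp
  also have "\<dots> = ennreal \<bar>c\<bar> * (\<integral>\<^sup>+y. ennreal (\<bar>c\<bar> ^ card I) *
      (\<integral>\<^sup>+x. F ((\<lambda>i\<in>I. t i + c * x i)(j := t j + c * y)) \<partial>PiM I (\<lambda>_. lborel)) \<partial>lborel)"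
  proof -
    have "(\<lambda>y. ennreal (\<bar>c\<bar> ^ card I) *
      (\<integral>\<^sup>+x. F ((\<lambda>i\<in>I. t i + c * x i)(j := y)) \<partial>PiM I (\<lambda>_. lborel))) \<in> borel_measurable borel"
      by measurable
    from nn_integral_real_affine[OF this assms(2), of "t j"] show ?thesis by simp
  qed
  also have "\<dots> = ennreal (\<bar>c\<bar> ^ card (insert j I)) * (\<integral>\<^sup>+y.
      (\<integral>\<^sup>+x. F ((\<lambda>i\<in>I. t i + c * x i)(j := t j + c * y)) \<partial>PiM I (\<lambda>_. lborel)) \<partial>lborel)"
  proof -
    have [measurable]: "(\<lambda>y. \<integral>\<^sup>+x. F ((\<lambda>i\<in>I. t i + c * x i)(j := t j + c * y)) \<partial>PiM I (\<lambda>_. lborel)) \<in> borel_measurable lborel"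
      by measurable
    show ?thesis by (subst nn_integral_cmult, measurable) (simp add: ennreal_mult mult.assoc)
  qed
  also have "(\<integral>\<^sup>+y. (\<integral>\<^sup>+x. F ((\<lambda>i\<in>I. t i + c * x i)(j := t j + c * y)) \<partial>PiM I (\<lambda>_. lborel)) \<partial>lborel)
     = (\<integral>\<^sup>+x. F (\<lambda>i\<in>insert j I. t i + c * x i) \<partial>PiM (insert j I) (\<lambda>_. lborel))"
  proof -
    have "(\<lambda>x. F (\<lambda>i\<in>insert j I. t i + c * x i)) \<in> borel_measurable (PiM (insert j I) (\<lambda>_. lborel))"
      by measurable
    from product_nn_integral_insert_rev[OF insert.hyps this] show ?thesis unfolding split by (rule sym)
  qed
  finally show ?case .
qed

text \<open>With all other coordinates fixed the shear only translates coordinate \<open>i\<close>,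
  so integrating over that coordinate first removes it.\<close>

lemma nn_integral_PiM_lborel_shear:
  fixes a :: real
  assumes "finite I" "i \<in> I" "j \<in> I" "i \<noteq> j"
    and [measurable]: "F \<in> borel_measurable (PiM I (\<lambda>_. lborel))"
  shows "(\<integral>\<^sup>+x. F (x(i := x i + a * x j)) \<partial>PiM I (\<lambda>_. lborel)) = (\<integral>\<^sup>+x. F x \<partial>PiM I (\<lambda>_. lborel))"
proof -
  interpret product_sigma_finite "\<lambda>_. lborel :: real measure" by standard
  define K where "K = I - {i}"
  have K: "I = insert i K" "finite K" "i \<notin> K" "j \<in> K" using assms by (auto simp: K_def)
  have [measurable]: "F \<in> borel_measurable (PiM (insert i K) (\<lambda>_. lborel))" using assms(5) by (simp only: K(1))
  have [measurable]: "(\<lambda>x. F (x(i := x i + a * x j))) \<in> borel_measurable (PiM (insert i K) (\<lambda>_. lborel))"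
  proof -
    have "(\<lambda>x. x(i := x i + a * x j)) \<in> PiM (insert i K) (\<lambda>_. lborel) \<rightarrow>\<^sub>M PiM (insert i K) (\<lambda>_. lborel)"
      using K by (intro measurable_fun_upd[where J="insert i K"]) auto
    then show ?thesis by measurable
  qed
  have "(\<integral>\<^sup>+x. F (x(i := x i + a * x j)) \<partial>PiM I (\<lambda>_. lborel)) =
    (\<integral>\<^sup>+x. (\<integral>\<^sup>+y. F (x(i := y + a * x j)) \<partial>lborel) \<partial>PiM K (\<lambda>_. lborel))"
    unfolding K(1) using K assms(4) by (subst product_nn_integral_insert) auto
  also have "\<dots> = (\<integral>\<^sup>+x. (\<integral>\<^sup>+y. F (x(i := y)) \<partial>lborel) \<partial>PiM K (\<lambda>_. lborel))"
  proof (rule nn_integral_cong)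
    fix x assume x: "x \<in> space (PiM K (\<lambda>_. lborel :: real measure))"
    have "(\<lambda>y. F (x(i := y))) \<in> borel_measurable borel" using x K by measurable
    from nn_integral_real_affine[OF this, of 1 "a * x j"]
    show "(\<integral>\<^sup>+y. F (x(i := y + a * x j)) \<partial>lborel) = (\<integral>\<^sup>+y. F (x(i := y)) \<partial>lborel)"
      by (simp add: add.commute)
  qed
  also have "\<dots> = (\<integral>\<^sup>+x. F x \<partial>PiM I (\<lambda>_. lborel))"
    unfolding K(1) using K by (subst product_nn_integral_insert) auto
  finally show ?thesis .
qed

text \<open>The rotation of the (i, j) plane with cosine \<open>a\<close> and sine \<open>b\<close>.
  Two numbers in place of an angle let a rotation that annihilates a given coordinate be written
  down algebraically.\<close>

definition givens :: "'i \<Rightarrow> 'i \<Rightarrow> real \<Rightarrow> real \<Rightarrow> ('i \<Rightarrow> real) \<Rightarrow> 'i \<Rightarrow> real" where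
  "givens i j a b x = x(i := a * x i - b * x j, j := b * x i + a * x j)"

text \<open>A plane rotation by \<open>\<theta>\<close> is the product of the shears with factors
  \<open>- tan (\<theta>/2)\<close>, \<open>sin \<theta>\<close> and \<open>- tan (\<theta>/2)\<close>.\<close>
lemma nn_integral_PiM_lborel_givens:
  fixes a b :: real
  assumes I: "finite I" "i \<in> I" "j \<in> I" "i \<noteq> j" and ab: "a\<^sup>2 + b\<^sup>2 = 1" "a \<noteq> -1"
    and [measurable]: "F \<in> borel_measurable (PiM I (\<lambda>_. lborel))"
  shows "(\<integral>\<^sup>+x. F (givens i j a b x) \<partial>PiM I (\<lambda>_. lborel)) = (\<integral>\<^sup>+x. F x \<partial>PiM I (\<lambda>_. lborel))"
proof -
  \<comment> \<open>Half-angle formula for the tangent; the half turn \<open>a = -1\<close> is the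
    one rotation for which it breaks down. The three shears compose to the rotation by the
    identities \<open>T * (1 + a) = b\<close> and \<open>b * T = 1 - a\<close>.\<close>
  define T where "T = b / (1 + a)"
  define s where "s u k l x = x(k := x k + u * x l)" for u k l and x :: "'a \<Rightarrow> real"
  have T: "T * (1 + a) = b" using ab by (auto simp: T_def)
  have "(1 + a) * (b * T - (1 - a)) = 0"
  proof -
    have "(1 + a) * (b * T - (1 - a)) = b * (T * (1 + a)) + a\<^sup>2 - 1"
      by (simp add: algebra_simps power2_eq_square)
    then show ?thesis using ab(1) by (simp add: T power2_eq_square)
  qed
  then have T2: "b * T = 1 - a" using ab by (simp add: add_eq_0_iff)
  have "s (-T) i j (s b j i (s (-T) i j x)) = givens i j a b x" for x
  proof -
    define y z where "y = x i" and "z = x j"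
    have 1: "b * (y - T * z) + z = b * y + a * z" 
    proof -
      have "b * (y - T * z) + z = b * y + (1 - b * T) * z" by (simp add: algebra_simps)
      then show ?thesis by (simp add: T2)
    qed
    have 2: "y - T * z - T * (b * y + a * z) = a * y - b * z"
    proof -
      have "y - T * z - T * (b * y + a * z) = y - (b * T) * y - (T * (1 + a)) * z"
        by (simp add: algebra_simps)
      also have "\<dots> = a * y - b * z" unfolding T T2 by (simp add: algebra_simps)
      finally show ?thesis .
    qed
    have "s (-T) i j (s b j i (s (-T) i j x)) =
      x(i := y - T * z - T * (b * (y - T * z) + z), j := b * (y - T * z) + z)"
      using \<open>i \<noteq> j\<close> by (simp add: s_def y_def z_def fun_eq_iff algebra_simps)
    then show ?thesis unfolding 1 2 by (simp add: givens_def y_def z_def)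
  qed
  moreover have s[measurable]: "s u k l \<in> PiM I (\<lambda>_. lborel) \<rightarrow>\<^sub>M PiM I (\<lambda>_. lborel)" if "k \<in> I" "l \<in> I" for u k l
    unfolding s_def using that by (intro measurable_fun_upd[where J=I]) auto
  moreover have "(\<integral>\<^sup>+x. G (s u k l x) \<partial>PiM I (\<lambda>_. lborel)) = (\<integral>\<^sup>+x. G x \<partial>PiM I (\<lambda>_. lborel))"
    if "k \<in> I" "l \<in> I" "k \<noteq> l" "G \<in> borel_measurable (PiM I (\<lambda>_. lborel))" for u k l G
    unfolding s_def using that I by (intro nn_integral_PiM_lborel_shear) auto
  ultimately show ?thesis
  proof -
    assume e: "\<And>x. s (-T) i j (s b j i (s (-T) i j x)) = givens i j a b x"
      and n: "\<And>k l G u. k \<in> I \<Longrightarrow> l \<in> I \<Longrightarrow> k \<noteq> l \<Longrightarrow> G \<in> borel_measurable (PiM I (\<lambda>_. lborel)) \<Longrightarrow>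
        (\<integral>\<^sup>+x. G (s u k l x) \<partial>PiM I (\<lambda>_. lborel)) = (\<integral>\<^sup>+x. G x \<partial>PiM I (\<lambda>_. lborel))"
    have [measurable]: "s (-T) i j \<in> PiM I (\<lambda>_. lborel) \<rightarrow>\<^sub>M PiM I (\<lambda>_. lborel)"
       "s b j i \<in> PiM I (\<lambda>_. lborel) \<rightarrow>\<^sub>M PiM I (\<lambda>_. lborel)" using I by (auto intro: s)
    have "(\<integral>\<^sup>+x. F (givens i j a b x) \<partial>PiM I (\<lambda>_. lborel)) =
       (\<integral>\<^sup>+x. F (s (-T) i j (s b j i (s (-T) i j x))) \<partial>PiM I (\<lambda>_. lborel))" by (simp add: e)
    also have "\<dots> = (\<integral>\<^sup>+x. F (s (-T) i j (s b j i x)) \<partial>PiM I (\<lambda>_. lborel))"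
      using I by (intro n[where G="\<lambda>x. F (s (-T) i j (s b j i x))"]) auto
    also have "\<dots> = (\<integral>\<^sup>+x. F (s (-T) i j x) \<partial>PiM I (\<lambda>_. lborel))"
      using I by (intro n[where G="\<lambda>x. F (s (-T) i j x)"]) auto
    also have "\<dots> = (\<integral>\<^sup>+x. F x \<partial>PiM I (\<lambda>_. lborel))" using I by (intro n) auto
    finally show ?thesis .
  qed
qed

section \<open>Measurability of coordinates and of the Euclidean distance\<close>

lemma space_Rd: "space (Rd s) = PiE {..<s} (\<lambda>_. UNIV)"
  by (simp add: Rd_def space_PiM)

lemma sets_Rd_cong[measurable_cong]: "sets (Rd s) = sets (PiM {..<s} (\<lambda>_. borel))"
  unfolding Rd_def by (intro sets_PiM_cong) auto

lemma sigma_finite_Rd: "sigma_finite_measure (Rd s)"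
proof -
  interpret product_sigma_finite "\<lambda>_. lborel :: real measure" by standard
  show ?thesis unfolding Rd_def by (rule sigma_finite) simp
qed

lemma measurable_Rd_component:
  "f \<in> M \<rightarrow>\<^sub>M Rd s \<Longrightarrow> i < s \<Longrightarrow> (\<lambda>x. f x i) \<in> borel_measurable M"
  using measurable_compose[OF _ measurable_component_singleton[of i "{..<s}" "\<lambda>_. lborel :: real measure"], of f M]
  by (simp add: Rd_def)

lemma edist_measurable[measurable]:
  assumes [measurable]: "f \<in> M \<rightarrow>\<^sub>M Rd s" "g \<in> M \<rightarrow>\<^sub>M Rd s"
  shows "(\<lambda>x. edist s (f x) (g x)) \<in> borel_measurable M"
  unfolding edist_def using assms
  by (intro measurable_compose[OF _ borel_measurable_sqrt] borel_measurable_sum borel_measurable_power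
      borel_measurable_diff measurable_Rd_component) auto

lemma edist_0_measurable[measurable]:
  assumes [measurable]: "f \<in> M \<rightarrow>\<^sub>M Rd s"
  shows "(\<lambda>x. edist s (f x) (\<lambda>_. 0)) \<in> borel_measurable M"
  unfolding edist_def using assms
  by (intro measurable_compose[OF _ borel_measurable_sqrt] borel_measurable_sum borel_measurable_power
      borel_measurable_diff measurable_Rd_component) auto

lemma edist_nonneg[simp]: "edist s x y \<ge> 0"
  by (simp add: edist_def sum_nonneg)

lemma edist_commute: "edist s x y = edist s y x"
  by (simp add: edist_def power2_commute)

section \<open>Monotonicity of the sequence w\<close>

definition lens :: "nat \<Rightarrow> (nat \<Rightarrow> real) \<Rightarrow> ennreal" where
  "lens s x = emeasure (Rd s) {y \<in> space (Rd s). edist s y (\<lambda>_. 0) \<le> 1 \<and> edist s x y \<le> 1}"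

lemma lens_eq:
  assumes "x \<in> space (Rd s)"
  shows "lens s x = (\<integral>\<^sup>+y. indicator {y. edist s y (\<lambda>_. 0) \<le> 1 \<and> edist s x y \<le> 1} y \<partial>Rd s)"
proof -
  have [measurable]: "x \<in> space (Rd s)" by fact
  have "lens s x = (\<integral>\<^sup>+y. indicator {y \<in> space (Rd s). edist s y (\<lambda>_. 0) \<le> 1 \<and> edist s x y \<le> 1} y \<partial>Rd s)"
    unfolding lens_def by (subst nn_integral_indicator) measurable
  also have "\<dots> = (\<integral>\<^sup>+y. indicator {y. edist s y (\<lambda>_. 0) \<le> 1 \<and> edist s x y \<le> 1} y \<partial>Rd s)"
    by (intro nn_integral_cong) (auto simp: indicator_def)
  finally show ?thesis .
qed

lemma givens_measurable[measurable]:
  "i < s \<Longrightarrow> j < s \<Longrightarrow> givens i j a b \<in> Rd s \<rightarrow>\<^sub>M Rd s"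
  unfolding givens_def Rd_def
  by (intro measurable_fun_upd[where J="{..<s}"]) auto

lemma edist_givens:
  assumes "i < s" "j < s" "i \<noteq> j" "a\<^sup>2 + b\<^sup>2 = 1"
  shows "edist s (givens i j a b x) (givens i j a b y) = edist s x y"
proof -
  have split: "(\<Sum>l<s. g l) = g i + g j + (\<Sum>l\<in>{..<s} - {i} - {j}. g l)" for g :: "nat \<Rightarrow> real"
    using assms(1-3) by (simp add: sum.remove[of "{..<s}" i] sum.remove[of "{..<s} - {i}" j])
  define u v where "u = x i - y i" and "v = x j - y j"
  have "(a * x i - b * x j - (a * y i - b * y j))\<^sup>2 + (b * x i + a * x j - (b * y i + a * y j))\<^sup>2
      = (a * u - b * v)\<^sup>2 + (b * u + a * v)\<^sup>2"
    by (simp add: u_def v_def algebra_simps)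
  also have "\<dots> = (a\<^sup>2 + b\<^sup>2) * (u\<^sup>2 + v\<^sup>2)" by (simp add: power2_eq_square algebra_simps)
  also have "\<dots> = u\<^sup>2 + v\<^sup>2" using assms(4) by simp
  finally show ?thesis
    unfolding edist_def split using assms(3) by (simp add: givens_def u_def v_def)
qed

text \<open>The rotation fixes the origin and preserves distances and Lebesgue measure, so it
  carries the lens of x onto a lens of equal volume.\<close>

lemma lens_givens:
  assumes "i < s" "j < s" "i \<noteq> j" "a\<^sup>2 + b\<^sup>2 = 1" "a \<noteq> -1" "x \<in> space (Rd s)"
  shows "lens s (givens i j a b x) = lens s x"
proof -
  have [measurable]: "x \<in> space (Rd s)" by fact
  have 0: "givens i j a b (\<lambda>_. 0) = (\<lambda>_. 0 :: real)" by (auto simp: givens_def)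
  have g: "givens i j a b x \<in> space (Rd s)"
    using measurable_space[OF givens_measurable] assms by blast
  note [measurable] = g
  have "lens s (givens i j a b x) =
    (\<integral>\<^sup>+y. indicator {y. edist s y (\<lambda>_. 0) \<le> 1 \<and> edist s (givens i j a b x) y \<le> 1} y \<partial>Rd s)"
    by (rule lens_eq[OF g])
  also have "\<dots> = (\<integral>\<^sup>+y. indicator {y. edist s y (\<lambda>_. 0) \<le> 1 \<and> edist s (givens i j a b x) y \<le> 1}
      (givens i j a b y) \<partial>Rd s)"
    unfolding Rd_def using assms
    by (intro nn_integral_PiM_lborel_givens[symmetric]) (auto simp flip: Rd_def)
  also have "\<dots> = (\<integral>\<^sup>+y. indicator {y. edist s y (\<lambda>_. 0) \<le> 1 \<and> edist s x y \<le> 1} y \<partial>Rd s)"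
    using edist_givens[OF assms(1-4), of _ "\<lambda>_. 0"]
    by (simp add: indicator_def edist_givens assms 0)
  also have "\<dots> = lens s x" by (rule lens_eq[symmetric]) fact
  finally show ?thesis .
qed

text \<open>Rotations in the planes (J, k) for J = 0, ..., k - 1 move the length of coordinate J
  into coordinate k, one coordinate at a time, and keep the zeros already made. The axis is
  coordinate k because this is the one that \<open>Rd (Suc k)\<close> splits off.\<close>

lemma lens_rotate_to_axis:
  assumes "x \<in> space (Rd (Suc k))"
  obtains x' where "x' \<in> space (Rd (Suc k))" "lens (Suc k) x' = lens (Suc k) x"
    "edist (Suc k) x' (\<lambda>_. 0) = edist (Suc k) x (\<lambda>_. 0)" "\<And>j. j < k \<Longrightarrow> x' j = 0"
proof -
  have "J \<le> k \<Longrightarrow> \<exists>x'\<in>space (Rd (Suc k)). lens (Suc k) x' = lens (Suc k) x \<and>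
    edist (Suc k) x' (\<lambda>_. 0) = edist (Suc k) x (\<lambda>_. 0) \<and> (\<forall>j<J. x' j = 0)" for J
  proof (induction J)
    case 0
    then show ?case using assms by auto
  next
    case (Suc J)
    then obtain y where y: "y \<in> space (Rd (Suc k))" "lens (Suc k) y = lens (Suc k) x"
      "edist (Suc k) y (\<lambda>_. 0) = edist (Suc k) x (\<lambda>_. 0)" "\<forall>j<J. y j = 0"
      by auto
    define t where "t = sqrt ((y J)\<^sup>2 + (y k)\<^sup>2)"
    show ?case
    proof (cases "t = 0")
      case True
      then have "y J = 0" by (simp add: t_def sum_power2_eq_zero_iff)
      then show ?thesis using y by (intro bexI[of _ y]) (auto simp: less_Suc_eq)
    next
      case False
      then have t: "t > 0" by (simp add: t_def order_less_le)
      have t2: "t\<^sup>2 = (y J)\<^sup>2 + (y k)\<^sup>2" by (simp add: t_def)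
      \<comment> \<open>The sign makes the cosine \<open>a = \<bar>y k\<bar> / t\<close>
        nonnegative, which keeps the rotation away from the excluded half turn.\<close>
      define s where "s = (if y k \<ge> 0 then 1 else -1 :: real)"
      have s: "s * y k \<ge> 0" "s\<^sup>2 = 1" by (auto simp: s_def)
      define a b where "a = s * y k / t" and "b = s * y J / t"
      have a0: "a \<ge> 0" using s t by (simp add: a_def)
      have "a\<^sup>2 + b\<^sup>2 = s\<^sup>2 * ((y J)\<^sup>2 + (y k)\<^sup>2) / t\<^sup>2"
        by (simp add: a_def b_def power_divide power_mult_distrib algebra_simps add_divide_distrib)
      then have ab: "a\<^sup>2 + b\<^sup>2 = 1" using t s by (simp flip: t2)
      define y' where "y' = givens J k a b y"
      have Jk: "J < Suc k" "k < Suc k" "J \<noteq> k" using Suc.prems by auto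
      have 0: "givens J k a b (\<lambda>_. 0) = (\<lambda>_. 0 :: real)" by (auto simp: givens_def)
      have "y' \<in> space (Rd (Suc k))" unfolding y'_def using Jk y
        by (intro measurable_space[OF givens_measurable]) auto
      moreover have "lens (Suc k) y' = lens (Suc k) x"
        unfolding y'_def using Jk ab a0 y by (subst lens_givens) auto
      moreover have "edist (Suc k) y' (\<lambda>_. 0) = edist (Suc k) x (\<lambda>_. 0)"
        using edist_givens[OF Jk ab, of y "\<lambda>_. 0"] y by (simp add: 0 y'_def)
      moreover have "y' j = 0" if "j < Suc J" for j
        using that y(4) Jk by (auto simp: y'_def givens_def a_def b_def less_Suc_eq mult_ac)
      ultimately show ?thesis by auto
    qed
  qed
  from this[of k] show ?thesis using that by blast
qed

section \<open>Slices of the unit ball and the volume of the lens\<close>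

text \<open>Up to the factor \<open>unit_ball_vol k\<close>, the volume of the slice at height u of
  the unit ball in dimension k + 1.\<close>

definition slice :: "nat \<Rightarrow> real \<Rightarrow> real" where
  "slice k u = (if \<bar>u\<bar> \<le> 1 then sqrt (1 - u\<^sup>2) ^ k else 0)"

lemma slice_measurable[measurable]: "slice k \<in> borel_measurable borel"
  unfolding slice_def by measurable

lemma slice_nonneg: "slice k u \<ge> 0"
  by (auto simp: slice_def abs_square_le_1)

lemma slice_minus[simp]: "slice k (- u) = slice k u" and slice_abs[simp]: "slice k \<bar>u\<bar> = slice k u"
  by (auto simp: slice_def)

lemma emeasure_Rd_ball:
  assumes "t > 0"
  shows "emeasure (Rd s) {x \<in> space (Rd s). edist s x (\<lambda>_. 0) \<le> t} = ennreal (unit_ball_vol s * t ^ s)"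
  using emeasure_cball_aux[of "{..<s}" t] assms by (simp add: Rd_def edist_def Int_def conj_commute)

text \<open>At height \<bar>m\<bar> = 1 the slice degenerates to a ball of radius 0, outside the
  reach of the volume formula for positive radii; such heights form a null set in the integrals that
  follow.\<close>

lemma emeasure_slice:
  assumes "\<bar>m\<bar> \<noteq> 1"
  shows "(\<integral>\<^sup>+z. indicator {z. (edist k z (\<lambda>_. 0))\<^sup>2 + m\<^sup>2 \<le> 1} z \<partial>Rd k) = ennreal (unit_ball_vol k) * slice k m"
proof (cases "\<bar>m\<bar> < 1")
  case True
  then have m: "m\<^sup>2 < 1" by (simp add: abs_square_less_1)
  have "(\<integral>\<^sup>+z. indicator {z. (edist k z (\<lambda>_. 0))\<^sup>2 + m\<^sup>2 \<le> 1} z \<partial>Rd k) =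
    (\<integral>\<^sup>+z. indicator {z \<in> space (Rd k). edist k z (\<lambda>_. 0) \<le> sqrt (1 - m\<^sup>2)} z \<partial>Rd k)"
  proof (rule nn_integral_cong)
    fix z assume "z \<in> space (Rd k)"
    moreover have "edist k z (\<lambda>_. 0) \<le> sqrt (1 - m\<^sup>2) \<longleftrightarrow> (edist k z (\<lambda>_. 0))\<^sup>2 \<le> 1 - m\<^sup>2"
      using m by (metis edist_nonneg real_le_rsqrt real_sqrt_le_iff real_sqrt_unique)
    ultimately show "(indicator {z. (edist k z (\<lambda>_. 0))\<^sup>2 + m\<^sup>2 \<le> 1} z :: ennreal) =
      indicator {z \<in> space (Rd k). edist k z (\<lambda>_. 0) \<le> sqrt (1 - m\<^sup>2)} z"
      by (auto simp: indicator_def)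
  qed
  also have "\<dots> = ennreal (unit_ball_vol k * sqrt (1 - m\<^sup>2) ^ k)"
    using m by (subst nn_integral_indicator) (measurable, simp add: emeasure_Rd_ball)
  finally show ?thesis using True by (simp add: slice_def ennreal_mult')
next
  case False
  then have "m\<^sup>2 > 1" using assms by (meson abs_square_less_1 abs_square_eq_1 not_less_iff_gr_or_eq)
  then have "\<not> (edist k z (\<lambda>_. 0))\<^sup>2 + m\<^sup>2 \<le> 1" for z
    by (smt (verit) zero_le_power2)
  then show ?thesis using False assms by (simp add: slice_def)
qed

lemma edist_Suc: "(edist (Suc k) x y)\<^sup>2 = (edist k x y)\<^sup>2 + (x k - y k)\<^sup>2"
  by (simp add: edist_def sum_nonneg)

lemma edist_le_1_iff: "edist s x y \<le> 1 \<longleftrightarrow> (edist s x y)\<^sup>2 \<le> 1"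
  by (simp add: power_le_one_iff abs_square_le_1)

text \<open>Since x lies on the axis, both balls meet the hyperplane at height u in concentric balls
  of dimension k. Their intersection is the smaller one, and it belongs to the ball whose centre is
  farther away in height, hence the maximum.\<close>

lemma lens_axis:
  assumes "x \<in> space (Rd (Suc k))" and x0: "\<And>j. j < k \<Longrightarrow> x j = 0"
  shows "lens (Suc k) x = unit_ball_vol k * (\<integral>\<^sup>+u. slice k (max \<bar>u\<bar> \<bar>u - x k\<bar>) \<partial>lborel)"
proof -
  interpret product_sigma_finite "\<lambda>_. lborel :: real measure" by standard
  let ?A = "{y. edist (Suc k) y (\<lambda>_. 0) \<le> 1 \<and> edist (Suc k) x y \<le> 1}"
  have Rd: "Rd (Suc k) = PiM (insert k {..<k}) (\<lambda>_. lborel)"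
    by (simp add: Rd_def lessThan_Suc)
  have [measurable]: "x \<in> space (Rd (Suc k))" by fact
  have m: "(indicator ?A :: _ \<Rightarrow> ennreal) \<in> borel_measurable (Rd (Suc k))"
    by measurable
  have *: "z(k := u) \<in> ?A \<longleftrightarrow> (edist k z (\<lambda>_. 0))\<^sup>2 + (max \<bar>u\<bar> \<bar>u - x k\<bar>)\<^sup>2 \<le> 1" for z u
  proof -
    have 1: "edist k (z(k := u)) (\<lambda>_. 0) = edist k z (\<lambda>_. 0)" "edist k x (z(k := u)) = edist k z (\<lambda>_. 0)"
      by (auto simp: edist_def x0)
    have "(max \<bar>u\<bar> \<bar>u - x k\<bar>)\<^sup>2 = max (u\<^sup>2) ((x k - u)\<^sup>2)"
      by (auto simp: max_def power2_commute abs_le_square_iff)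
    then show ?thesis
      by (auto simp: edist_le_1_iff edist_Suc 1)
  qed
  have "lens (Suc k) x = (\<integral>\<^sup>+u. \<integral>\<^sup>+z. indicator ?A (z(k := u)) \<partial>Rd k \<partial>lborel)"
    unfolding lens_eq[OF assms(1)] Rd unfolding Rd_def
    using m unfolding Rd by (intro product_nn_integral_insert_rev) auto
  also have "\<dots> = (\<integral>\<^sup>+u. unit_ball_vol k * ennreal (slice k (max \<bar>u\<bar> \<bar>u - x k\<bar>)) \<partial>lborel)"
  proof (rule nn_integral_cong_AE)
    \<comment> \<open>These are the heights at which one of the two slices has radius 0.\<close>
    have "AE u in lborel. u \<notin> {1, -1, x k + 1, x k - 1}"
      by (intro AE_not_in countable_imp_null_set_lborel) auto
    then show "AE u in lborel. (\<integral>\<^sup>+z. indicator ?A (z(k := u)) \<partial>Rd k) =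
      unit_ball_vol k * ennreal (slice k (max \<bar>u\<bar> \<bar>u - x k\<bar>))"
    proof eventually_elim
      case (elim u)
      then have "\<bar>max \<bar>u\<bar> \<bar>u - x k\<bar>\<bar> \<noteq> 1" by (auto simp: max_def abs_if split: if_splits)
      from emeasure_slice[OF this, of k] show ?case
        by (simp add: indicator_def *[simplified mem_Collect_eq])
    qed
  qed
  also have "\<dots> = unit_ball_vol k * (\<integral>\<^sup>+u. slice k (max \<bar>u\<bar> \<bar>u - x k\<bar>) \<partial>lborel)"
    by (rule nn_integral_cmult) measurable
  finally show ?thesis .
qed

text \<open>For \<tau> \<ge> 0 the maximum is \<bar>u\<bar> above the midpoint \<tau>/2 and \<bar>u
  - \<tau>\<bar> below it. Shifting the lower part by -\<tau> puts it at u < -\<tau>/2, so both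
  parts together form the unit ball without a central slab of width \<tau>. Negative \<tau> follow
  by reflection.\<close>

lemma nn_integral_slice_max:
  "(\<integral>\<^sup>+u. slice k (max \<bar>u\<bar> \<bar>u - \<tau>\<bar>) \<partial>lborel) = (\<integral>\<^sup>+u. slice k u * indicator {u. \<bar>u\<bar> \<ge> \<bar>\<tau>\<bar> / 2} u \<partial>lborel)"
proof -
  have pos: "(\<integral>\<^sup>+u. slice k (max \<bar>u\<bar> \<bar>u - \<tau>\<bar>) \<partial>lborel) = (\<integral>\<^sup>+u. slice k u * indicator {u. \<bar>u\<bar> \<ge> \<tau> / 2} u \<partial>lborel)"
    if "\<tau> \<ge> 0" for \<tau> :: real
  proof -
    have "(\<integral>\<^sup>+u. slice k (max \<bar>u\<bar> \<bar>u - \<tau>\<bar>) \<partial>lborel) =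
      (\<integral>\<^sup>+u. ennreal (slice k u) * indicator {\<tau>/2..} u + ennreal (slice k (u - \<tau>)) * indicator {..<\<tau>/2} u \<partial>lborel)"
    proof (rule nn_integral_cong)
      fix u :: real
      show "ennreal (slice k (max \<bar>u\<bar> \<bar>u - \<tau>\<bar>)) =
        ennreal (slice k u) * indicator {\<tau>/2..} u + ennreal (slice k (u - \<tau>)) * indicator {..<\<tau>/2} u"
      proof (cases "u \<ge> \<tau>/2")
        case True
        then have "max \<bar>u\<bar> \<bar>u - \<tau>\<bar> = \<bar>u\<bar>" using that by (auto simp: max_def)
        then show ?thesis using True by simp
      next
        case False
        then have "max \<bar>u\<bar> \<bar>u - \<tau>\<bar> = \<bar>u - \<tau>\<bar>" using that by (auto simp: max_def)
        then show ?thesis using False slice_minus[of k "u - \<tau>"] by simp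
      qed
    qed
    also have "\<dots> = (\<integral>\<^sup>+u. ennreal (slice k u) * indicator {\<tau>/2..} u \<partial>lborel) +
        (\<integral>\<^sup>+u. ennreal (slice k (u - \<tau>)) * indicator {..<\<tau>/2} u \<partial>lborel)"
      by (rule nn_integral_add) measurable
    also have "(\<integral>\<^sup>+u. ennreal (slice k (u - \<tau>)) * indicator {..<\<tau>/2} u \<partial>lborel) =
        (\<integral>\<^sup>+u. ennreal (slice k u) * indicator {..<-\<tau>/2} u \<partial>lborel)"
      by (subst nn_integral_real_affine[where c=1 and t=\<tau>])
        (auto simp: indicator_def field_simps intro!: nn_integral_cong)
    also have "(\<integral>\<^sup>+u. ennreal (slice k u) * indicator {\<tau>/2..} u \<partial>lborel) + \<dots> =
       (\<integral>\<^sup>+u. ennreal (slice k u) * indicator {\<tau>/2..} u + ennreal (slice k u) * indicator {..<-\<tau>/2} u \<partial>lborel)"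
      by (rule nn_integral_add[symmetric]) measurable
    also have "\<dots> = (\<integral>\<^sup>+u. slice k u * indicator {u. \<bar>u\<bar> \<ge> \<tau> / 2} u \<partial>lborel)"
    proof (rule nn_integral_cong_AE)
      have "AE u in lborel. u \<notin> {-\<tau>/2}"
        by (intro AE_not_in countable_imp_null_set_lborel) auto
      then show "AE u in lborel. ennreal (slice k u) * indicator {\<tau>/2..} u + ennreal (slice k u) * indicator {..<-\<tau>/2} u =
        ennreal (slice k u * indicator {u. \<bar>u\<bar> \<ge> \<tau> / 2} u)"
        by eventually_elim (use that in \<open>auto simp: indicator_def abs_if\<close>)
    qed
    finally show ?thesis .
  qed
  show ?thesis
  proof (cases "\<tau> \<ge> 0")
    case True
    then show ?thesis using pos by simp
  next
    case False
    have "(\<integral>\<^sup>+u. slice k (max \<bar>u\<bar> \<bar>u - \<tau>\<bar>) \<partial>lborel) = (\<integral>\<^sup>+u. slice k (max \<bar>u\<bar> \<bar>u - (-\<tau>)\<bar>) \<partial>lborel)"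
      by (subst nn_integral_real_affine[where c="-1" and t=0])
        (auto simp: abs_minus_commute add.commute intro!: nn_integral_cong arg_cong[where f="slice k"] arg_cong2[where f=max])
    then show ?thesis using pos[of "-\<tau>"] False by simp
  qed
qed

lemma lens_Suc:
  assumes "x \<in> space (Rd (Suc k))"
  shows "lens (Suc k) x = unit_ball_vol k *
    (\<integral>\<^sup>+u. slice k u * indicator {u. \<bar>u\<bar> \<ge> edist (Suc k) x (\<lambda>_. 0) / 2} u \<partial>lborel)"
proof -
  from lens_rotate_to_axis[OF assms] obtain y where
    y: "y \<in> space (Rd (Suc k))" "lens (Suc k) y = lens (Suc k) x"
    "edist (Suc k) y (\<lambda>_. 0) = edist (Suc k) x (\<lambda>_. 0)" "\<And>j. j < k \<Longrightarrow> y j = 0"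
    by metis
  have "edist (Suc k) y (\<lambda>_. 0) = \<bar>y k\<bar>" using y(4) by (simp add: edist_def)
  then show ?thesis using lens_axis[OF y(1,4)] y by (simp add: nn_integral_slice_max)
qed

section \<open>The integral formula for w\<close>

text \<open>For a slice at height u, the radius of the ball of those x in the unit ball whose norm
  is at most 2 \<bar>u\<bar>, that is, whose lens still contains this slice after the slab is
  removed.\<close>

definition thin :: "real \<Rightarrow> real" where "thin u = min 1 (2 * \<bar>u\<bar>)"

lemma unit_ball_vol_neq_0: "unit_ball_vol (real k) \<noteq> 0"
  by (metis less_irrefl of_nat_0_le_iff unit_ball_vol_pos)

lemma unit_ball_measurable[measurable]: "unit_ball s \<in> sets (Rd s)"
  unfolding unit_ball_def by measurable

lemma emeasure_unit_ball: "emeasure (Rd s) (unit_ball s) = unit_ball_vol s"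
  unfolding unit_ball_def by (simp add: emeasure_Rd_ball)

text \<open>At the origin the lens is the whole ball and the slab is empty, so the lens formula
  becomes the slicing recursion for volumes of balls.\<close>

lemma emeasure_unit_ball_slices:
  "ennreal (unit_ball_vol (Suc k)) = unit_ball_vol k * (\<integral>\<^sup>+u. slice k u \<partial>lborel)"
proof -
  let ?z = "(\<lambda>i\<in>{..<Suc k}. 0) :: nat \<Rightarrow> real"
  have z: "?z \<in> space (Rd (Suc k))" by (simp add: space_Rd)
  have e: "edist (Suc k) ?z y = edist (Suc k) y (\<lambda>_. 0)" for y
    by (simp add: edist_def)
  have "ennreal (unit_ball_vol (Suc k)) = lens (Suc k) ?z"
    unfolding lens_def e using emeasure_unit_ball[of "Suc k"] by (simp add: unit_ball_def)
  also have "\<dots> = unit_ball_vol k * (\<integral>\<^sup>+u. slice k u \<partial>lborel)"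
    using lens_Suc[OF z] by (simp add: e) (simp add: edist_def)
  finally show ?thesis .
qed

text \<open>Exchanging the integrals over x and u turns the condition on u for given x into one on x
  for given u, and the latter describes a ball of radius \<open>thin u\<close>.\<close>

lemma nn_integral_lens:
  "(\<integral>\<^sup>+x. lens (Suc k) x * indicator (unit_ball (Suc k)) x \<partial>Rd (Suc k)) =
    unit_ball_vol k * (unit_ball_vol (Suc k) * (\<integral>\<^sup>+u. slice k u * thin u ^ Suc k \<partial>lborel))"
proof -
  let ?d = "Suc k" let ?N = "\<lambda>x. edist (Suc k) x (\<lambda>_. 0)"
  interpret R: sigma_finite_measure "Rd ?d" by (rule sigma_finite_Rd)
  interpret P: pair_sigma_finite lborel "Rd ?d" by unfold_locales
  have "(\<integral>\<^sup>+x. lens ?d x * indicator (unit_ball ?d) x \<partial>Rd ?d) =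
     (\<integral>\<^sup>+x. unit_ball_vol k * (\<integral>\<^sup>+u. slice k u * indicator {(u, x). ?N x \<le> 1 \<and> \<bar>u\<bar> \<ge> ?N x / 2} (u, x) \<partial>lborel) \<partial>Rd ?d)"
  proof (rule nn_integral_cong)
    fix x assume x: "x \<in> space (Rd ?d)"
    show "lens ?d x * indicator (unit_ball ?d) x =
      unit_ball_vol k * (\<integral>\<^sup>+u. slice k u * indicator {(u, x). ?N x \<le> 1 \<and> \<bar>u\<bar> \<ge> ?N x / 2} (u, x) \<partial>lborel)"
      unfolding lens_Suc[OF x] using x by (auto simp: indicator_def unit_ball_def)
  qed
  also have "\<dots> = unit_ball_vol k * (\<integral>\<^sup>+x. (\<integral>\<^sup>+u. slice k u * indicator {(u, x). ?N x \<le> 1 \<and> \<bar>u\<bar> \<ge> ?N x / 2} (u, x) \<partial>lborel) \<partial>Rd ?d)"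
    by (rule nn_integral_cmult) measurable
  also have "(\<integral>\<^sup>+x. (\<integral>\<^sup>+u. slice k u * indicator {(u, x). ?N x \<le> 1 \<and> \<bar>u\<bar> \<ge> ?N x / 2} (u, x) \<partial>lborel) \<partial>Rd ?d)
     = (\<integral>\<^sup>+u. (\<integral>\<^sup>+x. slice k u * indicator {(u, x). ?N x \<le> 1 \<and> \<bar>u\<bar> \<ge> ?N x / 2} (u, x) \<partial>Rd ?d) \<partial>lborel)"
    by (rule P.Fubini') measurable
  also have "\<dots> = (\<integral>\<^sup>+u. unit_ball_vol ?d * ennreal (slice k u * thin u ^ ?d) \<partial>lborel)"
  proof (rule nn_integral_cong_AE)
    have "AE u in lborel. u \<notin> {0 :: real}"
      by (intro AE_not_in countable_imp_null_set_lborel) auto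
    then show "AE u in lborel. (\<integral>\<^sup>+x. slice k u * indicator {(u, x). ?N x \<le> 1 \<and> \<bar>u\<bar> \<ge> ?N x / 2} (u, x) \<partial>Rd ?d) =
        unit_ball_vol ?d * ennreal (slice k u * thin u ^ ?d)"
    proof eventually_elim
      case (elim u)
      then have t: "thin u > 0" by (auto simp: thin_def)
      have "(\<integral>\<^sup>+x. slice k u * indicator {(u, x). ?N x \<le> 1 \<and> \<bar>u\<bar> \<ge> ?N x / 2} (u, x) \<partial>Rd ?d) =
        (\<integral>\<^sup>+x. ennreal (slice k u) * indicator {x \<in> space (Rd ?d). ?N x \<le> thin u} x \<partial>Rd ?d)"
        by (intro nn_integral_cong) (auto simp: indicator_def thin_def)
      also have "\<dots> = ennreal (slice k u) * ennreal (unit_ball_vol ?d * thin u ^ ?d)"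
        by (subst nn_integral_cmult, measurable, subst nn_integral_indicator, measurable)
          (simp add: emeasure_Rd_ball t)
      also have "\<dots> = unit_ball_vol ?d * ennreal (slice k u * thin u ^ ?d)"
        using t unit_ball_vol_pos[of ?d] slice_nonneg[of k u]
        by (simp add: mult_ac flip: ennreal_mult)
      finally show ?case .
    qed
  qed
  also have "\<dots> = unit_ball_vol ?d * (\<integral>\<^sup>+u. slice k u * thin u ^ ?d \<partial>lborel)"
    by (rule nn_integral_cmult) (unfold thin_def, measurable)
  finally show ?thesis .
qed

text \<open>Trades the two uniform laws in w for Lebesgue measure at the price of the squared
  volume. Both the integral formula for w and the mass of near triples at scale r start from this
  form.\<close>

lemma emeasure_close_pairs_unit_ball:
  "emeasure (Rd s \<Otimes>\<^sub>M Rd s) {z \<in> space (Rd s \<Otimes>\<^sub>M Rd s). edist s (fst z) (\<lambda>_. 0) \<le> 1 \<and>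
      edist s (snd z) (\<lambda>_. 0) \<le> 1 \<and> edist s (fst z) (snd z) \<le> 1} =
    ennreal (w s * (unit_ball_vol s)\<^sup>2)"
proof -
  interpret R: sigma_finite_measure "Rd s" by (rule sigma_finite_Rd)
  define V where "V = unit_ball_vol s"
  have V: "V > 0" by (simp add: V_def unit_ball_vol_pos)
  define U where "U = uniform_measure (Rd s) (unit_ball s)"
  have pU: "prob_space U" unfolding U_def
    using unit_ball_vol_neq_0[of s] by (intro prob_space_uniform_measure) (auto simp: emeasure_unit_ball)
  interpret U: prob_space U by fact
  interpret UU: pair_prob_space U U ..
  have [measurable_cong]: "sets U = sets (Rd s)" by (simp add: U_def)
  have su: "sets U = sets (Rd s)" by (simp add: U_def)
  have sp: "space U = space (Rd s)" by (simp add: U_def)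
  let ?E = "{z \<in> space (U \<Otimes>\<^sub>M U). edist s (fst z) (snd z) \<le> 1}"
  let ?F = "{z \<in> space (Rd s \<Otimes>\<^sub>M Rd s). edist s (fst z) (\<lambda>_. 0) \<le> 1 \<and>
      edist s (snd z) (\<lambda>_. 0) \<le> 1 \<and> edist s (fst z) (snd z) \<le> 1}"
  have E: "?E \<in> sets (U \<Otimes>\<^sub>M U)" by measurable
  have F: "?F \<in> sets (Rd s \<Otimes>\<^sub>M Rd s)" by measurable
  have "ennreal (w s) = emeasure (U \<Otimes>\<^sub>M U) ?E"
    unfolding w_def Let_def U_def[symmetric] by (rule UU.emeasure_eq_measure[symmetric])
  also have "\<dots> = (\<integral>\<^sup>+x. emeasure U (Pair x -` ?E) \<partial>U)"
    by (rule U.emeasure_pair_measure_alt[OF E])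
  also have "\<dots> = (\<integral>\<^sup>+x. emeasure U (Pair x -` ?E) * indicator (unit_ball s) x \<partial>Rd s) / V"
  proof -
    have "(\<integral>\<^sup>+x. g x \<partial>U) = (\<integral>\<^sup>+x. g x * indicator (unit_ball s) x \<partial>Rd s) / V" if "g \<in> borel_measurable U" for g
      unfolding U_def V_def emeasure_unit_ball[symmetric] using that
      by (intro nn_integral_uniform_measure) (auto simp: U_def)
    then show ?thesis using U.measurable_emeasure_Pair[OF E] by blast
  qed
  also have "(\<integral>\<^sup>+x. emeasure U (Pair x -` ?E) * indicator (unit_ball s) x \<partial>Rd s) =
    (\<integral>\<^sup>+x. emeasure (Rd s) (Pair x -` ?F) / V \<partial>Rd s)"
  proof (rule nn_integral_cong)
    fix x assume x: "x \<in> space (Rd s)"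
    have "emeasure U A = emeasure (Rd s) (unit_ball s \<inter> A) / V" if "A \<in> sets (Rd s)" for A
      unfolding U_def emeasure_unit_ball[symmetric] V_def
      using that by (intro emeasure_uniform_measure) auto
    from this[OF sets_Pair1[OF E, of x, unfolded su]]
    have "emeasure U (Pair x -` ?E) = emeasure (Rd s) (unit_ball s \<inter> Pair x -` ?E) / V" .
    moreover have "unit_ball s \<inter> Pair x -` ?E = Pair x -` ?F" if "x \<in> unit_ball s"
      using that x by (auto simp: unit_ball_def space_pair_measure sp)
    moreover have "Pair x -` ?F = {}" if "x \<notin> unit_ball s"
      using that x by (auto simp: unit_ball_def space_pair_measure)
    ultimately show "emeasure U (Pair x -` ?E) * indicator (unit_ball s) x = emeasure (Rd s) (Pair x -` ?F) / V"
      by (cases "x \<in> unit_ball s") (simp_all del: vimage_Collect_eq)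
  qed
  also have "\<dots> = (\<integral>\<^sup>+x. emeasure (Rd s) (Pair x -` ?F) \<partial>Rd s) / V"
    by (rule nn_integral_divide) (rule R.measurable_emeasure_Pair[OF F])
  also have "(\<integral>\<^sup>+x. emeasure (Rd s) (Pair x -` ?F) \<partial>Rd s) = emeasure (Rd s \<Otimes>\<^sub>M Rd s) ?F"
    by (rule R.emeasure_pair_measure_alt[OF F, symmetric])
  finally have "ennreal (w s) * ennreal (V\<^sup>2) = emeasure (Rd s \<Otimes>\<^sub>M Rd s) ?F / V / V * (ennreal V * ennreal V)"
    using V by (simp add: power2_eq_square ennreal_mult)
  also have "\<dots> = emeasure (Rd s \<Otimes>\<^sub>M Rd s) ?F * ((ennreal V / V) * (ennreal V / V))"
    by (simp add: divide_ennreal_def mult_ac)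
  also have "ennreal V / V = 1" using V by (simp add: ennreal_divide_self)
  finally show ?thesis by (simp add: V_def ennreal_mult'')
qed

lemma w_nonneg: "w s \<ge> 0"
  by (simp add: w_def Let_def)

text \<open>On [-1, 1] the integrands are continuous, and real integrals of continuous functions
  allow the subtraction and strict positivity that the comparison of consecutive dimensions rests
  on.\<close>

lemma nn_integral_slice:
  assumes "continuous_on {-1..1} h" and "\<And>u :: real. h u \<ge> 0"
  shows "(\<integral>\<^sup>+u. slice k u * h u \<partial>lborel) = ennreal (integral {-1..1} (\<lambda>u. sqrt (1 - u\<^sup>2) ^ k * h u))"
proof -
  have "((\<lambda>u. sqrt (1 - u\<^sup>2) ^ k * h u) has_integral integral {-1..1} (\<lambda>u. sqrt (1 - u\<^sup>2) ^ k * h u)) {-1..1}"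
    by (intro integrable_integral integrable_continuous_interval continuous_intros assms)
  from nn_integral_has_integral_lebesgue[OF _ this]
  have "(\<integral>\<^sup>+u. ennreal (indicator {-1..1} u * (sqrt (1 - u\<^sup>2) ^ k * h u)) \<partial>lborel) =
    ennreal (integral {-1..1} (\<lambda>u. sqrt (1 - u\<^sup>2) ^ k * h u))"
    using assms by (auto simp: abs_square_le_1 abs_le_iff)
  also have "(\<integral>\<^sup>+u. ennreal (indicator {-1..1} u * (sqrt (1 - u\<^sup>2) ^ k * h u)) \<partial>lborel) =
     (\<integral>\<^sup>+u. slice k u * h u \<partial>lborel)"
    by (intro nn_integral_cong) (auto simp: slice_def indicator_def)
  finally show ?thesis by simp
qed

text \<open>For independent uniform points \<open>X, Y\<close> of the unit ball this says
  \<open>w d = P(\<bar>X\<bar> \<le> 2 \<bar>Y\<^sub>1\<bar>) = E (min 1 (2 \<bar>Y\<^sub>1\<bar>))^d\<close>.\<close>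
lemma w_Suc:
  "w (Suc k) * integral {-1..1} (\<lambda>u. sqrt (1 - u\<^sup>2) ^ k) =
    integral {-1..1} (\<lambda>u. sqrt (1 - u\<^sup>2) ^ k * thin u ^ Suc k)"
proof -
  let ?d = "Suc k" let ?V = "unit_ball_vol ?d" let ?v = "unit_ball_vol k"
  let ?D = "integral {-1..1} (\<lambda>u. sqrt (1 - u\<^sup>2) ^ k)"
  let ?N = "integral {-1..1} (\<lambda>u. sqrt (1 - u\<^sup>2) ^ k * thin u ^ ?d)"
  interpret R: sigma_finite_measure "Rd ?d" by (rule sigma_finite_Rd)
  let ?F = "{z \<in> space (Rd ?d \<Otimes>\<^sub>M Rd ?d). edist ?d (fst z) (\<lambda>_. 0) \<le> 1 \<and>
      edist ?d (snd z) (\<lambda>_. 0) \<le> 1 \<and> edist ?d (fst z) (snd z) \<le> 1}"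
  have F: "?F \<in> sets (Rd ?d \<Otimes>\<^sub>M Rd ?d)" by measurable
  have D: "ennreal ?V = ?v * ennreal ?D"
    using emeasure_unit_ball_slices[of k] nn_integral_slice[of "\<lambda>_. 1" k] by simp
  have N: "(\<integral>\<^sup>+u. slice k u * thin u ^ ?d \<partial>lborel) = ennreal ?N"
    by (rule nn_integral_slice) (auto simp: thin_def intro!: continuous_intros)
  have D0: "?D \<ge> 0" and N0: "?N \<ge> 0"
    by (auto intro!: integral_nonneg integrable_continuous_interval continuous_intros mult_nonneg_nonneg
        simp: abs_square_le_1 abs_le_iff thin_def simp del: power_Suc)
  have "ennreal (w ?d * ?V\<^sup>2) = emeasure (Rd ?d \<Otimes>\<^sub>M Rd ?d) ?F"
    by (rule emeasure_close_pairs_unit_ball[symmetric])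
  also have "\<dots> = (\<integral>\<^sup>+x. emeasure (Rd ?d) (Pair x -` ?F) \<partial>Rd ?d)"
    by (rule R.emeasure_pair_measure_alt[OF F])
  also have "\<dots> = (\<integral>\<^sup>+x. lens ?d x * indicator (unit_ball ?d) x \<partial>Rd ?d)"
    by (intro nn_integral_cong)
      (auto simp: lens_def indicator_def unit_ball_def space_pair_measure intro!: arg_cong2[where f=emeasure])
  also have "\<dots> = ?v * (?V * ennreal ?N)" by (simp only: nn_integral_lens N)
  finally have 1: "w ?d * ?V\<^sup>2 = ?v * ?V * ?N"
    using N0 by (simp add: w_nonneg less_imp_le mult_ac flip: ennreal_mult)
  have 2: "?V = ?v * ?D"
    using D D0 by (simp add: less_imp_le flip: ennreal_mult)
  have nz: "?v * ?V \<noteq> 0" using unit_ball_vol_neq_0[of k] unit_ball_vol_neq_0[of ?d] by simp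
  have "?v * ?V * (w ?d * ?D) = w ?d * (?V * (?v * ?D))" by (simp only: mult_ac)
  also have "\<dots> = ?v * ?V * ?N" unfolding 2[symmetric] using 1 by (simp only: power2_eq_square)
  finally show ?thesis using nz by (rule mult_left_cancel[THEN iffD1, rotated])
qed

section \<open>Strict decrease of w\<close>

lemma integral_pos_continuous:
  fixes g :: "real \<Rightarrow> real"
  assumes "continuous_on {a..b} g" "\<And>u. u \<in> {a..b} \<Longrightarrow> g u \<ge> 0" "c \<in> {a..b}" "g c > 0" "a < b"
  shows "integral {a..b} g > 0"
proof -
  have "integral {a..b} g \<ge> 0" using assms by (intro integral_nonneg integrable_continuous_interval) auto
  moreover have "integral {a..b} g \<noteq> 0"
    using assms by (subst integral_eq_0_iff) force+
  ultimately show ?thesis by simp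
qed

text \<open>Raising the dimension multiplies the density of \<open>Y\<^sub>1\<close> by \<open>\<rho> = sqrt (1 - u\<^sup>2)\<close>, which is
  ordered oppositely to \<open>h = thin ^ Suc k\<close>; comparing with the point \<open>u\<^sub>0\<close> where \<open>\<rho>\<close> takes its
  mean value \<open>c\<close> gives Chebyshev's inequality \<open>(h u - h u\<^sub>0) (\<rho> u - c) \<le> 0\<close>.\<close>
lemma w_Suc_Suc_less: "w (Suc (Suc k)) < w (Suc k)"
proof -
  define \<rho> where "\<rho> u = sqrt (1 - u\<^sup>2)" for u :: real
  let ?I = "integral {-1..1::real}"
  define D D' where "D = ?I (\<lambda>u. \<rho> u ^ k)" and "D' = ?I (\<lambda>u. \<rho> u ^ Suc k)"
  define h where "h u = thin u ^ Suc k" for u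
  have cont: "continuous_on {-1..1} \<rho>" "continuous_on {-1..1} thin" "continuous_on {-1..1} h"
    unfolding \<rho>_def thin_def h_def by (intro continuous_intros)+
  have int: "g integrable_on {-1..1}" if "continuous_on {-1..1} g" for g :: "real \<Rightarrow> real"
    using that by (rule integrable_continuous_interval)
  have \<rho>0: "\<rho> u \<ge> 0" if "u \<in> {-1..1}" for u using that by (auto simp: \<rho>_def abs_square_le_1 abs_le_iff)
  have \<rho>1: "\<rho> u \<le> 1" for u by (simp add: \<rho>_def)
  have th: "0 \<le> thin u" "thin u \<le> 1" for u by (auto simp: thin_def)
  have Dp: "D > 0" unfolding D_def
    by (rule integral_pos_continuous[where c=0]) (auto intro!: continuous_intros cont \<rho>0 zero_le_power simp: \<rho>_def[of 0])
  have D'p: "D' > 0" unfolding D'_def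
    by (rule integral_pos_continuous[where c=0])
      (auto intro!: continuous_intros cont \<rho>0 mult_nonneg_nonneg zero_le_power simp: \<rho>_def[of 0])
  have D'D: "D' \<le> D" unfolding D'_def D_def
  proof (rule integral_le)
    show "\<rho> u ^ Suc k \<le> \<rho> u ^ k" if "u \<in> {-1..1}" for u
      using \<rho>0[OF that] \<rho>1[of u] by (intro power_decreasing) auto
  qed (auto intro!: int continuous_intros cont)
  define c where "c = D' / D"
  have c: "0 \<le> c" "c \<le> 1" "D' = c * D" using Dp D'p D'D by (auto simp: c_def)
  \<comment> \<open>The map \<rho> is its own inverse on [0, 1], so this is the point with
    \<open>\<rho> u0 = c\<close>.\<close>
  define u0 where "u0 = sqrt (1 - c\<^sup>2)"
  have u0: "0 \<le> u0" "\<rho> u0 = c" using c by (auto simp: u0_def \<rho>_def power_le_one)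
  have key: "(h u - h u0) * (\<rho> u - c) \<le> 0" if u: "u \<in> {-1..1}" for u
  proof (cases "\<bar>u\<bar> \<ge> u0")
    case True
    then have "h u0 \<le> h u" using u0 by (auto simp: h_def thin_def simp del: power_Suc intro!: power_mono)
    moreover have "\<rho> u \<le> \<rho> u0"
      unfolding \<rho>_def using True u0(1) abs_le_square_iff[of u0 u] by simp
    ultimately show ?thesis using u0 by (simp add: mult_nonneg_nonpos)
  next
    case False
    then have "h u \<le> h u0" using u0 by (auto simp: h_def thin_def simp del: power_Suc intro!: power_mono)
    moreover have "\<rho> u0 \<le> \<rho> u"
      unfolding \<rho>_def using False u0(1) abs_le_square_iff[of u u0] by simp
    ultimately show ?thesis using u0 by (simp add: mult_nonpos_nonneg)
  qed
  have "?I (\<lambda>u. \<rho> u ^ k * ((h u - h u0) * (\<rho> u - c))) \<le> ?I (\<lambda>_. 0)"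
    by (rule integral_le) (auto intro!: int continuous_intros cont mult_nonneg_nonpos key \<rho>0 zero_le_power)
  also have "(\<lambda>u. \<rho> u ^ k * ((h u - h u0) * (\<rho> u - c))) =
     (\<lambda>u. (\<rho> u ^ Suc k * h u - c * (\<rho> u ^ k * h u)) - h u0 * (\<rho> u ^ Suc k - c * \<rho> u ^ k))"
    by (auto simp: fun_eq_iff algebra_simps)
  also have "?I \<dots> = (?I (\<lambda>u. \<rho> u ^ Suc k * h u) - c * ?I (\<lambda>u. \<rho> u ^ k * h u)) - h u0 * (D' - c * D)"
    unfolding D_def D'_def
    by (simp only: integral_diff integral_mult_right int continuous_intros cont)
  finally have A: "?I (\<lambda>u. \<rho> u ^ Suc k * h u) \<le> c * ?I (\<lambda>u. \<rho> u ^ k * h u)" using c by simp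
  \<comment> \<open>Chebyshev's inequality is only weak. Strictness comes from the additional factor
    \<open>thin u\<close> in the higher dimension, which equals 1/2 at u = 1/4.\<close>
  have "?I (\<lambda>u. \<rho> u ^ Suc k * h u - \<rho> u ^ Suc k * thin u ^ Suc (Suc k)) > 0"
  proof (rule integral_pos_continuous[where c="1/4"])
    show "0 < \<rho> (1/4) ^ Suc k * h (1/4) - \<rho> (1/4) ^ Suc k * thin (1/4) ^ Suc (Suc k)"
      by (simp add: h_def thin_def \<rho>_def power2_eq_square)
    show "0 \<le> \<rho> u ^ Suc k * h u - \<rho> u ^ Suc k * thin u ^ Suc (Suc k)" if "u \<in> {-1..1}" for u
      using \<rho>0[OF that] th[of u] unfolding h_def
      by (auto simp del: power_Suc intro!: mult_left_mono power_decreasing)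
  qed (auto intro!: continuous_intros cont)
  then have B: "?I (\<lambda>u. \<rho> u ^ Suc k * thin u ^ Suc (Suc k)) < ?I (\<lambda>u. \<rho> u ^ Suc k * h u)"
    by (subst (asm) integral_diff) (auto intro!: int continuous_intros cont simp del: power_Suc)
  have "w (Suc (Suc k)) * D' < c * (w (Suc k) * D)"
    using A B w_Suc[of k] w_Suc[of "Suc k"] unfolding D_def D'_def h_def \<rho>_def by simp
  also have "\<dots> = w (Suc k) * D'" using c by simp
  finally show ?thesis using D'p by simp
qed

text \<open>By monotonicity every other value lies at least as far from w d as that of a
  neighbouring dimension, so a single positive distance works for all t at once.\<close>

lemma w_gap:
  assumes "d \<ge> 1"
  obtains \<delta> where "\<delta> > 0" "\<And>t. t \<ge> 1 \<Longrightarrow> t \<noteq> d \<Longrightarrow> \<bar>w t - w d\<bar> \<ge> \<delta>"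
proof -
  have dec: "w (i + n) \<le> w i" if "i \<ge> 1" for i n
  proof (induction n)
    case (Suc n)
    from w_Suc_Suc_less[of "i + n - 1"] that Suc show ?case by simp
  qed simp
  have mono: "w j \<le> w i" if "1 \<le> i" "i \<le> j" for i j
    using dec[OF that(1), of "j - i"] that by simp
  have less: "w (Suc i) < w i" if "i \<ge> 1" for i
    using w_Suc_Suc_less[of "i - 1"] that by simp
  \<comment> \<open>For d = 1 there is no smaller dimension to compare with, and 1 is an arbitrary
    positive placeholder.\<close>
  define \<delta> where "\<delta> = min (w d - w (Suc d)) (if d = 1 then 1 else w (d - 1) - w d)"
  have "\<delta> > 0" using less[of d] less[of "d - 1"] assms by (auto simp: \<delta>_def)
  moreover have "\<bar>w t - w d\<bar> \<ge> \<delta>" if t: "t \<ge> 1" "t \<noteq> d" for t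
  proof (cases "t < d")
    case True
    then have "w (d - 1) \<le> w t" using t by (intro mono) auto
    then show ?thesis using True t by (auto simp: \<delta>_def)
  next
    case False
    then have "w t \<le> w (Suc d)" using t assms by (intro mono) auto
    then show ?thesis by (auto simp: \<delta>_def)
  qed
  ultimately show ?thesis using that by blast
qed

section \<open>Continuity of translations in the mean\<close>

text \<open>For a fixed sequence of measure preserving maps this class of functions is closed under
  linear combinations and dominated limits, as measure-theoretic induction demands. Integrability is
  included because the integral of a non-integrable function is 0 by convention.\<close>

definition asymp_L1_invariant :: "'a measure \<Rightarrow> (nat \<Rightarrow> 'a \<Rightarrow> 'a) \<Rightarrow> ('a \<Rightarrow> real) \<Rightarrow> bool" where
  "asymp_L1_invariant N T g \<longleftrightarrow> integrable N g \<and> (\<lambda>n. \<integral>x. \<bar>g (T n x) - g x\<bar> \<partial>N) \<longlonglongrightarrow> 0"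

lemma integrable_measure_preserving:
  assumes "T \<in> N \<rightarrow>\<^sub>M N" "distr N N T = N" "integrable N (g :: _ \<Rightarrow> real)"
  shows "integrable N (\<lambda>x. g (T x))" "(\<integral>x. g (T x) \<partial>N) = (\<integral>x. g x \<partial>N)"
  using integrable_distr_eq[OF assms(1), of g] integral_distr[OF assms(1), of g] borel_measurable_integrable[OF assms(3)] assms(3)
  unfolding assms(2) by simp_all

lemma asymp_L1_invariant_add:
  assumes T: "\<And>n. T n \<in> N \<rightarrow>\<^sub>M N" "\<And>n. distr N N (T n) = N"
    and g: "asymp_L1_invariant N T g" and h: "asymp_L1_invariant N T h"
  shows "asymp_L1_invariant N T (\<lambda>x. a * g x + b * h x)"
proof -
  note int = integrable_measure_preserving(1)[OF T]
  have gh[simp]: "integrable N g" "integrable N h" using g h by (auto simp: asymp_L1_invariant_def)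
  have [simp]: "integrable N (\<lambda>x. g (T n x))" "integrable N (\<lambda>x. h (T n x))" for n
    by (rule int[OF gh(1)], rule int[OF gh(2)])
  have le: "(\<integral>x. \<bar>a * g (T n x) + b * h (T n x) - (a * g x + b * h x)\<bar> \<partial>N) \<le>
    \<bar>a\<bar> * (\<integral>x. \<bar>g (T n x) - g x\<bar> \<partial>N) + \<bar>b\<bar> * (\<integral>x. \<bar>h (T n x) - h x\<bar> \<partial>N)" (is "?L \<le> ?R") for n
  proof -
    have "?L \<le> (\<integral>x. \<bar>a\<bar> * \<bar>g (T n x) - g x\<bar> + \<bar>b\<bar> * \<bar>h (T n x) - h x\<bar> \<partial>N)"
    proof (rule integral_mono)
      fix x
      have "\<bar>a * g (T n x) + b * h (T n x) - (a * g x + b * h x)\<bar> = \<bar>a * (g (T n x) - g x) + b * (h (T n x) - h x)\<bar>"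
        by (simp add: algebra_simps)
      also have "\<dots> \<le> \<bar>a\<bar> * \<bar>g (T n x) - g x\<bar> + \<bar>b\<bar> * \<bar>h (T n x) - h x\<bar>"
        by (rule order_trans[OF abs_triangle_ineq]) (simp add: abs_mult)
      finally show "\<bar>a * g (T n x) + b * h (T n x) - (a * g x + b * h x)\<bar> \<le> \<dots>" .
    qed auto
    then show ?thesis by simp
  qed
  have "(\<lambda>n. \<bar>a\<bar> * (\<integral>x. \<bar>g (T n x) - g x\<bar> \<partial>N) + \<bar>b\<bar> * (\<integral>x. \<bar>h (T n x) - h x\<bar> \<partial>N)) \<longlonglongrightarrow> \<bar>a\<bar> * 0 + \<bar>b\<bar> * 0"
    using g h unfolding asymp_L1_invariant_def by (intro tendsto_add tendsto_mult_left) simp_all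
  then have lim: "(\<lambda>n. \<bar>a\<bar> * (\<integral>x. \<bar>g (T n x) - g x\<bar> \<partial>N) + \<bar>b\<bar> * (\<integral>x. \<bar>h (T n x) - h x\<bar> \<partial>N)) \<longlonglongrightarrow> 0"
    by simp
  have "(\<lambda>n. \<integral>x. \<bar>a * g (T n x) + b * h (T n x) - (a * g x + b * h x)\<bar> \<partial>N) \<longlonglongrightarrow> 0"
    by (rule Lim_null_comparison[OF always_eventually lim]) (use le in simp)
  then show ?thesis by (simp add: asymp_L1_invariant_def)
qed

text \<open>Insert \<open>s k\<close> and its shift between g and the shift of g. Since T preserves
  the measure, the two approximation errors have the same integral, which is small for large k
  uniformly in n; only after k is fixed is n chosen.\<close>

lemma asymp_L1_invariant_dominated:
  assumes T: "\<And>n. T n \<in> N \<rightarrow>\<^sub>M N" "\<And>n. distr N N (T n) = N"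
    and s: "\<And>k. asymp_L1_invariant N T (s k)"
    and [measurable]: "g \<in> borel_measurable N" and h: "integrable N h"
    and lim: "\<And>x. x \<in> space N \<Longrightarrow> (\<lambda>k. s k x) \<longlonglongrightarrow> g x"
    and bound: "\<And>k x. x \<in> space N \<Longrightarrow> \<bar>s k x\<bar> \<le> h x"
  shows "asymp_L1_invariant N T g"
proof -
  note int = integrable_measure_preserving[OF T]
  have si[simp]: "integrable N (s k)" for k using s by (simp add: asymp_L1_invariant_def)
  have [measurable]: "s k \<in> borel_measurable N" for k by (rule borel_measurable_integrable) simp
  have gi[simp]: "integrable N g"
    by (rule integrable_dominated_convergence[where s=s and w=h]) (auto simp: lim bound h)
  have "(\<lambda>k. \<integral>x. \<bar>s k x - g x\<bar> \<partial>N) \<longlonglongrightarrow> (\<integral>x. 0 \<partial>N)"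
  proof (rule integral_dominated_convergence[where w="\<lambda>x. 2 * h x"])
    show "AE x in N. (\<lambda>k. \<bar>s k x - g x\<bar>) \<longlonglongrightarrow> 0"
      using lim by (auto intro!: tendsto_rabs_zero simp: LIM_zero)
    have "\<bar>g x\<bar> \<le> h x" if "x \<in> space N" for x
      by (rule LIMSEQ_le_const2[OF tendsto_rabs[OF lim[OF that]]]) (use bound[OF that] in blast)
    then show "AE x in N. norm \<bar>s k x - g x\<bar> \<le> 2 * h x" for k
      using bound by (intro AE_I2) (smt (verit) real_norm_def)
  qed (use h in auto)
  then have sg: "(\<lambda>k. \<integral>x. \<bar>s k x - g x\<bar> \<partial>N) \<longlonglongrightarrow> 0" by simp
  have "(\<lambda>n. \<integral>x. \<bar>g (T n x) - g x\<bar> \<partial>N) \<longlonglongrightarrow> 0"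
  proof (rule LIMSEQ_I)
    fix e :: real assume e: "e > 0"
    then obtain k where k: "(\<integral>x. \<bar>s k x - g x\<bar> \<partial>N) < e / 4"
    proof -
      from LIMSEQ_D[OF sg, of "e/4"] e obtain k where "norm ((\<integral>x. \<bar>s k x - g x\<bar> \<partial>N) - 0) < e / 4" by auto
      then show ?thesis by (intro that[of k]) simp
    qed
    have "(\<lambda>n. \<integral>x. \<bar>s k (T n x) - s k x\<bar> \<partial>N) \<longlonglongrightarrow> 0" using s by (simp add: asymp_L1_invariant_def)
    from LIMSEQ_D[OF this, of "e/4"] e obtain n0 where
      n0: "\<And>n. n \<ge> n0 \<Longrightarrow> (\<integral>x. \<bar>s k (T n x) - s k x\<bar> \<partial>N) < e/4" by auto
    have "norm ((\<integral>x. \<bar>g (T n x) - g x\<bar> \<partial>N) - 0) < e" if "n \<ge> n0" for n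
    proof -
      have i: "integrable N (\<lambda>x. g (T n x))" "integrable N (\<lambda>x. s k (T n x))"
        by (rule int(1)[OF gi], rule int(1)[OF si])
      have "(\<integral>x. \<bar>g (T n x) - g x\<bar> \<partial>N) \<le>
        (\<integral>x. \<bar>s k (T n x) - g (T n x)\<bar> + \<bar>s k (T n x) - s k x\<bar> + \<bar>s k x - g x\<bar> \<partial>N)"
        using i by (intro integral_mono) auto
      also have "\<dots> = (\<integral>x. \<bar>s k (T n x) - g (T n x)\<bar> \<partial>N) + (\<integral>x. \<bar>s k (T n x) - s k x\<bar> \<partial>N) + (\<integral>x. \<bar>s k x - g x\<bar> \<partial>N)"
        using i by simp
      also have "(\<integral>x. \<bar>s k (T n x) - g (T n x)\<bar> \<partial>N) = (\<integral>x. \<bar>s k x - g x\<bar> \<partial>N)"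
        by (rule int(2)[where g="\<lambda>x. \<bar>s k x - g x\<bar>"]) simp
      finally show ?thesis using k n0[OF that] e by simp
    qed
    then show "\<exists>no. \<forall>n\<ge>no. norm ((\<integral>x. \<bar>g (T n x) - g x\<bar> \<partial>N) - 0) < e" by blast
  qed
  then show ?thesis by (simp add: asymp_L1_invariant_def)
qed

text \<open>The exhaustion \<open>Q\<close> allows generators of infinite measure.\<close>
lemma asymp_L1_invariant_induct:
  assumes T: "\<And>n. T n \<in> N \<rightarrow>\<^sub>M N" "\<And>n. distr N N (T n) = N"
    and G: "Int_stable G" "G \<subseteq> Pow (space N)" "sets N = sigma_sets (space N) G"
    and Q: "\<And>k. Q k \<in> sets N" "\<And>k. emeasure N (Q k) < \<infinity>" "incseq Q" "(\<Union>k. Q k) = space N"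
    and base: "\<And>A k. A \<in> G \<Longrightarrow> asymp_L1_invariant N T (indicator (A \<inter> Q k))"
      "\<And>k. asymp_L1_invariant N T (indicator (Q k))"
    and "integrable N g"
  shows "asymp_L1_invariant N T g"
proof -
  note add = asymp_L1_invariant_add[OF T] and dom = asymp_L1_invariant_dominated[OF T]
  have QI: "integrable N (indicator (Q k) :: _ \<Rightarrow> real)" for k
    using Q(1)[of k] Q(2)[of k] by (auto intro!: integrable_real_indicator)
  have ind: "asymp_L1_invariant N T (indicator (A \<inter> Q k))" if "A \<in> sets N" for A k
  proof -
    from that have "A \<in> sigma_sets (space N) G" using G by simp
    with G(1,2) show ?thesis
    proof (induction rule: sigma_sets_induct_disjoint)
      case (basic A) then show ?case by (rule base)
    next
      case empty show ?case using add[OF base(2) base(2), of 0 k 0 k]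
        by simp
    next
      case (compl A)
      have "(\<lambda>x. 1 * indicator (Q k) x + (-1) * indicator (A \<inter> Q k) x :: real) = indicator ((space N - A) \<inter> Q k)"
        using sets.sets_into_space[OF Q(1)[of k]] by (auto simp: fun_eq_iff indicator_def)
      with add[OF base(2)[of k] compl(2), of 1 "-1"] show ?case by simp
    next
      case (union A)
      have A[measurable]: "A i \<in> sets N" for i using union(2) G by auto
      note [measurable] = Q(1)
      have fin: "asymp_L1_invariant N T (\<lambda>x. \<Sum>i<m. indicator (A i \<inter> Q k) x)" for m
      proof (induction m)
        case 0 show ?case using add[OF base(2) base(2), of 0 k 0 k] by simp
      next
        case (Suc m) from add[OF Suc union(3), of 1 1] show ?case by simp
      qed
      \<comment> \<open>The partial sums are indicators of disjoint unions cut off by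
        \<open>Q k\<close>, so the integrable indicator of \<open>Q k\<close> dominates them
        all.\<close>
      show ?case
      proof (rule dom[OF fin _ QI[of k]])
        have eq: "(\<Sum>i<m. indicator (A i \<inter> Q k) x :: real) = indicator ((\<Union>i<m. A i) \<inter> Q k) x" for m x
        proof -
          have "disjoint_family_on A {..<m}" using union(1) by (auto simp: disjoint_family_on_def)
          then have "(indicator (\<Union>i<m. A i) x :: real) = (\<Sum>i<m. indicator (A i) x)"
            by (intro indicator_UN_disjoint) auto
          then show ?thesis by (auto simp: indicator_inter_arith sum_distrib_right)
        qed
        show "(\<lambda>m. \<Sum>i<m. indicator (A i \<inter> Q k) x) \<longlonglongrightarrow> (indicator ((\<Union>i. A i) \<inter> Q k) x :: real)" for x
          unfolding eq unfolding indicator_inter_arith by (intro tendsto_mult tendsto_const LIMSEQ_indicator_UN)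
        show "\<bar>\<Sum>i<m. indicator (A i \<inter> Q k) x\<bar> \<le> (indicator (Q k) x :: real)" for m x
          unfolding eq by (auto simp: indicator_def)
      qed measurable
    qed
  qed
  show ?thesis using \<open>integrable N g\<close>
  proof (induction rule: integrable_induct)
    case (base A c)
    note [measurable] = base(1) Q(1)
    \<comment> \<open>The cutoff is removed by letting k grow; A has finite measure here, so its own
      indicator is the integrable bound.\<close>
    have A: "asymp_L1_invariant N T (indicator A)"
    proof (rule dom[OF ind[OF base(1)]])
      show "integrable N (indicator A :: _ \<Rightarrow> real)" using base by (auto intro!: integrable_real_indicator)
      show "(\<lambda>k. indicator (A \<inter> Q k) x) \<longlonglongrightarrow> (indicator A x :: real)" if "x \<in> space N" for x
      proof -
        have "(\<lambda>k. indicator A x * indicator (Q k) x) \<longlonglongrightarrow> (indicator A x * indicator (\<Union>k. Q k) x :: real)"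
          by (intro tendsto_mult tendsto_const LIMSEQ_indicator_incseq Q)
        then show ?thesis using that by (simp add: Q(4) indicator_inter_arith)
      qed
    qed (auto simp: indicator_def)
    from add[OF A A, of c 0] show ?case by (simp add: mult.commute)
  next
    case (add f g)
    from asymp_L1_invariant_add[OF T add(3,4), of 1 1] show ?case by simp
  next
    case (lim f s)
    show ?case
    proof (rule dom[OF lim(5)])
      show "integrable N (\<lambda>x. 2 * \<bar>f x\<bar>)" using lim by simp
    qed (use lim in auto)
  qed
qed

section \<open>Translations, boxes and orthants\<close>

definition translate :: "nat \<Rightarrow> (nat \<Rightarrow> real) \<Rightarrow> (nat \<Rightarrow> real) \<Rightarrow> (nat \<Rightarrow> real)" where
  "translate s z x = (\<lambda>i\<in>{..<s}. z i + x i)"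

lemma translate_measurable[measurable]:
  assumes [measurable]: "f \<in> M \<rightarrow>\<^sub>M Rd s" "g \<in> M \<rightarrow>\<^sub>M Rd s"
  shows "(\<lambda>x. translate s (f x) (g x)) \<in> M \<rightarrow>\<^sub>M Rd s"
proof -
  have "(\<lambda>x. f x i + g x i) \<in> M \<rightarrow>\<^sub>M lborel" if "i < s" for i
    using measurable_Rd_component[OF assms(1) that] measurable_Rd_component[OF assms(2) that] by measurable
  then show ?thesis unfolding Rd_def translate_def by (intro measurable_restrict) auto
qed

lemma translate_measurable_const[measurable]:
  "translate s z \<in> Rd s \<rightarrow>\<^sub>M Rd s"
  unfolding Rd_def translate_def[abs_def] by (intro measurable_restrict) measurable

lemma nn_integral_translate:
  "F \<in> borel_measurable (Rd s) \<Longrightarrow> (\<integral>\<^sup>+x. F (translate s z x) \<partial>Rd s) = (\<integral>\<^sup>+x. F x \<partial>Rd s)"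
  using nn_integral_PiM_lborel_affine[of "{..<s}" 1 F z] by (simp add: Rd_def translate_def)

lemma distr_translate: "distr (Rd s) (Rd s) (translate s z) = Rd s"
proof (rule measure_eqI)
  fix A assume A: "A \<in> sets (distr (Rd s) (Rd s) (translate s z))"
  then have [measurable]: "A \<in> sets (Rd s)" by simp
  have "emeasure (distr (Rd s) (Rd s) (translate s z)) A = (\<integral>\<^sup>+x. indicator A x \<partial>distr (Rd s) (Rd s) (translate s z))"
    by simp
  also have "\<dots> = (\<integral>\<^sup>+x. indicator A (translate s z x) \<partial>Rd s)"
    by (rule nn_integral_distr) measurable
  also have "\<dots> = emeasure (Rd s) A" by (subst nn_integral_translate) auto
  finally show "emeasure (distr (Rd s) (Rd s) (translate s z)) A = emeasure (Rd s) A" .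
qed simp

text \<open>Meant for the hyperplanes that carry the faces of a box, where its indicator
  jumps.\<close>

lemma AE_Rd_component_neq:
  assumes "i < s"
  shows "AE x in Rd s. x i \<noteq> c"
proof -
  interpret product_sigma_finite "\<lambda>_. lborel :: real measure" by standard
  let ?A = "PiE {..<s} (\<lambda>j. if j = i then {c} else UNIV)"
  have "emeasure (Rd s) ?A = (\<Prod>j<s. emeasure lborel (if j = i then {c} else UNIV))"
    unfolding Rd_def by (rule emeasure_PiM) auto
  also have "\<dots> = 0" using assms by (intro prod_zero) auto
  finally have "emeasure (Rd s) ?A = 0" .
  moreover have "?A \<in> sets (Rd s)" unfolding Rd_def by (intro sets_PiM_I_finite) auto
  ultimately have "?A \<in> null_sets (Rd s)" by blast
  then show ?thesis
    by (rule AE_I') (auto simp: space_Rd PiE_iff, metis extensional_arb lessThan_iff)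
qed

text \<open>Closed orthants are stable under intersection and meet a cube in a box, so with cubes as
  the exhaustion the induction only has to be started at boxes.\<close>

lemma sets_Rd_orthants:
  "sets (Rd s) = sigma_sets (space (Rd s)) {{x \<in> space (Rd s). \<forall>i<s. x i \<le> a i} | a :: nat \<Rightarrow> real. True}"
proof -
  let ?E = "range (\<lambda>a :: real. {..a})"
  have "sets (Rd s) = sets (PiM {..<s} (\<lambda>_. sigma UNIV ?E))"
    unfolding Rd_def by (intro sets_PiM_cong) (auto simp flip: borel_eq_atMost)
  also have "\<dots> = sets (sigma (\<Pi>\<^sub>E i\<in>{..<s}. UNIV)
      {{f\<in>(\<Pi>\<^sub>E i\<in>{..<s}. UNIV). \<forall>i\<in>j. f i \<in> A i} | A j. j \<in> {{..<s}} \<and> A \<in> Pi j (\<lambda>_. ?E)})"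
  proof (rule sets_PiM_sigma)
    show "\<exists>S\<subseteq>?E. countable S \<and> UNIV = \<Union>S"
    proof (intro exI conjI)
      show "range (\<lambda>n. {..real n}) \<subseteq> ?E" by auto
      show "UNIV = \<Union>(range (\<lambda>n. {..real n}))" by (auto intro: real_arch_simple)
    qed auto
  qed auto
  also have "{{f\<in>(\<Pi>\<^sub>E i\<in>{..<s}. UNIV). \<forall>i\<in>j. f i \<in> A i} | A j. j \<in> {{..<s}} \<and> A \<in> Pi j (\<lambda>_. ?E)}
    = {{x \<in> space (Rd s). \<forall>i<s. x i \<le> a i} | a :: nat \<Rightarrow> real. True}" (is "?L = ?R")
  proof
    show "?L \<subseteq> ?R"
    proof
      fix B assume "B \<in> ?L"
      then obtain A where A: "A \<in> Pi {..<s} (\<lambda>_. ?E)" "B = {f\<in>(\<Pi>\<^sub>E i\<in>{..<s}. UNIV). \<forall>i<s. f i \<in> A i}" by auto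
      then have "\<forall>i\<in>{..<s}. \<exists>a. A i = {..a}" by (auto simp: Pi_iff)
      then obtain a where "\<forall>i<s. A i = {..a i}" by (metis lessThan_iff)
      then have "B = {x \<in> space (Rd s). \<forall>i<s. x i \<le> a i}" by (auto simp: A space_Rd)
      then show "B \<in> ?R" by blast
    qed
    show "?R \<subseteq> ?L"
    proof
      fix B assume "B \<in> ?R"
      then obtain a where a: "B = {x \<in> space (Rd s). \<forall>i<s. x i \<le> a i}" by auto
      then show "B \<in> ?L" by (auto simp: space_Rd intro!: exI[of _ "\<lambda>i. {..a i}"])
    qed
  qed
  also have "sets (sigma (\<Pi>\<^sub>E i\<in>{..<s}. UNIV) {{x \<in> space (Rd s). \<forall>i<s. x i \<le> a i} | a :: nat \<Rightarrow> real. True}) =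
    sigma_sets (space (Rd s)) {{x \<in> space (Rd s). \<forall>i<s. x i \<le> a i} | a :: nat \<Rightarrow> real. True}"
    by (subst sets_measure_of) (auto simp: space_Rd)
  finally show ?thesis .
qed

lemma box_eq_PiE:
  "{x \<in> space (Rd s). \<forall>i<s. a i \<le> x i \<and> x i \<le> b i} = PiE {..<s} (\<lambda>i. {a i..b i :: real})"
  by (intro set_eqI iffI) (simp_all add: space_Rd PiE_def Pi_def)

text \<open>A point off the faces of the box is not moved across a face by sufficiently small
  shifts, so the integrand is eventually 0 almost everywhere and dominated convergence
  applies.\<close>

lemma asymp_L1_invariant_box:
  assumes z: "\<And>i. i < s \<Longrightarrow> (\<lambda>n. z n i) \<longlonglongrightarrow> 0"
  shows "asymp_L1_invariant (Rd s) (\<lambda>n. translate s (z n))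
    (indicator {x \<in> space (Rd s). \<forall>i<s. a i \<le> x i \<and> x i \<le> b i})"
proof -
  interpret product_sigma_finite "\<lambda>_. lborel :: real measure" by standard
  define box where "box a b = {x \<in> space (Rd s). \<forall>i<s. a i \<le> x i \<and> x i \<le> b i}" for a b :: "nat \<Rightarrow> real"
  have box_eq: "box a b = PiE {..<s} (\<lambda>i. {a i..b i})" for a b
    unfolding box_def by (rule box_eq_PiE)
  have box[measurable]: "box a b \<in> sets (Rd s)" for a b
    unfolding box_eq unfolding Rd_def by (intro sets_PiM_I_finite) auto
  have "emeasure (Rd s) (box a b) < \<infinity>" for a b
  proof -
    have "emeasure (Rd s) (box a b) = (\<Prod>i<s. emeasure lborel {a i..b i})"
      unfolding box_eq unfolding Rd_def by (rule emeasure_PiM) auto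
    also have "\<dots> \<noteq> \<top>"
      by (subst ennreal_prod_eq_top) (metis emeasure_compact_finite compact_Icc less_irrefl infinity_ennreal_def)
    finally show ?thesis by (simp add: top.not_eq_extremum)
  qed
  then have int: "integrable (Rd s) (indicator (box a b) :: _ \<Rightarrow> real)" for a b
    by (auto intro!: integrable_real_indicator)
  \<comment> \<open>Null sequences are bounded. The box enlarged by these bounds contains every
    point that some shift moves into the box, which gives an integrable majorant.\<close>
  have "\<forall>i\<in>{..<s}. \<exists>B. \<forall>n. \<bar>z n i\<bar> \<le> B"
  proof
    fix i assume "i \<in> {..<s}"
    then have "Bseq (\<lambda>n. z n i)" using z by (intro convergent_imp_Bseq convergentI) auto
    then show "\<exists>B. \<forall>n. \<bar>z n i\<bar> \<le> B" by (auto simp: Bseq_def)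
  qed
  then obtain B where B: "\<And>i n. i < s \<Longrightarrow> \<bar>z n i\<bar> \<le> B i" by (metis lessThan_iff)
  let ?a' = "\<lambda>i. a i - B i" and ?b' = "\<lambda>i. b i + B i"
  let ?T = "\<lambda>n. translate s (z n)"
  have "(\<lambda>n. \<integral>x. \<bar>indicator (box a b) (?T n x) - indicator (box a b) x\<bar> \<partial>Rd s) \<longlonglongrightarrow> (\<integral>x. 0 \<partial>Rd s :: real)"
  proof (rule integral_dominated_convergence[where w="\<lambda>x. indicator (box ?a' ?b') x + indicator (box a b) x"])
    show "integrable (Rd s) (\<lambda>x. indicator (box ?a' ?b') x + indicator (box a b) x :: real)"
      by (intro Bochner_Integration.integrable_add int)
    have in_box: "x \<in> box ?a' ?b'" if "?T n x \<in> box a b" "x \<in> space (Rd s)" for n x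
    proof -
      have "a i - B i \<le> x i \<and> x i \<le> b i + B i" if i: "i < s" for i
        using \<open>?T n x \<in> box a b\<close> B[OF i, of n] i by (force simp: box_def translate_def)
      then show ?thesis using that by (simp add: box_def)
    qed
    show "AE x in Rd s. norm \<bar>indicator (box a b) (?T n x) - indicator (box a b) x :: real\<bar> \<le>
        (indicator (box ?a' ?b') x + indicator (box a b) x :: real)" for n
      by (rule AE_I2) (auto simp: indicator_def dest: in_box)
    have "AE x in Rd s. \<forall>i\<in>{..<s}. x i \<noteq> a i \<and> x i \<noteq> b i"
      by (intro AE_finite_allI AE_conjI AE_Rd_component_neq) auto
    then show "AE x in Rd s. (\<lambda>n. \<bar>indicator (box a b) (?T n x) - indicator (box a b) x\<bar>) \<longlonglongrightarrow> (0 :: real)"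
    proof (rule AE_mp, intro AE_I2 impI)
      fix x assume x: "x \<in> space (Rd s)" "\<forall>i\<in>{..<s}. x i \<noteq> a i \<and> x i \<noteq> b i"
      have "\<forall>\<^sub>F n in sequentially. \<forall>i\<in>{..<s}. (a i \<le> z n i + x i \<and> z n i + x i \<le> b i) = (a i \<le> x i \<and> x i \<le> b i)"
      proof (intro eventually_ball_finite ballI)
        fix i assume i: "i \<in> {..<s}"
        have l: "(\<lambda>n. z n i + x i) \<longlonglongrightarrow> x i" using tendsto_add[OF z tendsto_const[of "x i"], of i] i by simp
        have "\<forall>\<^sub>F n in sequentially. (a i \<le> z n i + x i) = (a i \<le> x i)"
        proof (cases "a i < x i")
          case True
          from order_tendstoD(1)[OF l this] show ?thesis by eventually_elim (use True in auto)
        next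
          case False
          then have "x i < a i" using x i by force
          from order_tendstoD(2)[OF l this] show ?thesis by eventually_elim (use False \<open>x i < a i\<close> in auto)
        qed
        moreover have "\<forall>\<^sub>F n in sequentially. (z n i + x i \<le> b i) = (x i \<le> b i)"
        proof (cases "x i < b i")
          case True
          from order_tendstoD(2)[OF l this] show ?thesis by eventually_elim (use True in auto)
        next
          case False
          then have "b i < x i" using x i by force
          from order_tendstoD(1)[OF l this] show ?thesis by eventually_elim (use False \<open>b i < x i\<close> in auto)
        qed
        ultimately show "\<forall>\<^sub>F n in sequentially. (a i \<le> z n i + x i \<and> z n i + x i \<le> b i) = (a i \<le> x i \<and> x i \<le> b i)"
          by eventually_elim auto
      qed simp
      then have "\<forall>\<^sub>F n in sequentially. \<bar>indicator (box a b) (?T n x) - indicator (box a b) x\<bar> = (0 :: real)"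
        by eventually_elim (use x in \<open>auto simp: box_def indicator_def space_Rd translate_def\<close>)
      then show "(\<lambda>n. \<bar>indicator (box a b) (?T n x) - indicator (box a b) x\<bar>) \<longlonglongrightarrow> (0 :: real)"
        by (rule tendsto_eventually)
    qed
  qed measurable
  then show ?thesis using int[of a b] by (simp add: asymp_L1_invariant_def box_def)
qed

lemma L1_translation_continuous:
  assumes g: "integrable (Rd s) (g :: _ \<Rightarrow> real)" and e: "\<epsilon> > 0"
  obtains \<delta> where "\<delta> > 0"
    "\<And>z. (\<And>i. i < s \<Longrightarrow> \<bar>z i\<bar> \<le> \<delta>) \<Longrightarrow> (\<integral>x. \<bar>g (translate s z x) - g x\<bar> \<partial>Rd s) \<le> \<epsilon>"
proof -
  have "\<exists>\<delta>>0. \<forall>z. (\<forall>i<s. \<bar>z i\<bar> \<le> \<delta>) \<longrightarrow> (\<integral>x. \<bar>g (translate s z x) - g x\<bar> \<partial>Rd s) \<le> \<epsilon>"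
  proof (rule ccontr)
    assume "\<not> ?thesis"
    then have "\<forall>n. \<exists>z. (\<forall>i<s. \<bar>z i\<bar> \<le> 1 / real (Suc n)) \<and> (\<integral>x. \<bar>g (translate s z x) - g x\<bar> \<partial>Rd s) > \<epsilon>"
      by (auto simp: not_le)
    then obtain z where z: "\<And>n i. i < s \<Longrightarrow> \<bar>z n i\<bar> \<le> 1 / real (Suc n)"
      "\<And>n. (\<integral>x. \<bar>g (translate s (z n) x) - g x\<bar> \<partial>Rd s) > \<epsilon>" by metis
    have z0: "(\<lambda>n. z n i) \<longlonglongrightarrow> 0" if "i < s" for i
      by (rule tendsto_rabs_zero_cancel, rule tendsto_sandwich[OF _ _ tendsto_const LIMSEQ_inverse_real_of_nat])
        (use z(1)[OF that] in \<open>auto simp: inverse_eq_divide intro!: always_eventually\<close>)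
    define Q where "Q k = {x \<in> space (Rd s). \<forall>i<s. - real k \<le> x i \<and> x i \<le> real k}" for k
    let ?G = "{{x \<in> space (Rd s). \<forall>i<s. x i \<le> a i} | a :: nat \<Rightarrow> real. True}"
    have "asymp_L1_invariant (Rd s) (\<lambda>n. translate s (z n)) g"
    proof (rule asymp_L1_invariant_induct[where G="?G" and Q=Q])
      show "Int_stable ?G"
      proof (rule Int_stableI)
        fix A B assume "A \<in> ?G" "B \<in> ?G"
        then obtain a b where "A = {x \<in> space (Rd s). \<forall>i<s. x i \<le> a i}" "B = {x \<in> space (Rd s). \<forall>i<s. x i \<le> b i}"
          by auto
        then have "A \<inter> B = {x \<in> space (Rd s). \<forall>i<s. x i \<le> min (a i) (b i)}" by auto
        then show "A \<inter> B \<in> ?G" by (intro CollectI exI[of _ "\<lambda>i. min (a i) (b i)"]) auto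
      qed
      have box: "asymp_L1_invariant (Rd s) (\<lambda>n. translate s (z n)) (indicator (Q k))" for k
        unfolding Q_def by (rule asymp_L1_invariant_box) (rule z0)
      then show "asymp_L1_invariant (Rd s) (\<lambda>n. translate s (z n)) (indicator (Q k))" for k .
      show Qs: "Q k \<in> sets (Rd s)" for k
      proof -
        have "Q k = PiE {..<s} (\<lambda>_. {-real k..real k})" unfolding Q_def by (rule box_eq_PiE)
        then show ?thesis unfolding Rd_def by (auto intro!: sets_PiM_I_finite)
      qed
      show "emeasure (Rd s) (Q k) < \<infinity>" for k
        using box[of k] Qs[of k] by (auto simp: asymp_L1_invariant_def integrable_indicator_iff)
      show "incseq Q" by (rule monoI) (fastforce simp: Q_def)
      show "(\<Union>k. Q k) = space (Rd s)"
      proof -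
        have "\<exists>k. x \<in> Q k" if "x \<in> space (Rd s)" for x
        proof -
          obtain k :: nat where k: "(\<Sum>i<s. \<bar>x i\<bar>) \<le> real k" using real_arch_simple by blast
          have "\<bar>x i\<bar> \<le> real k" if "i < s" for i
          proof -
            have "\<bar>x i\<bar> \<le> (\<Sum>i<s. \<bar>x i\<bar>)" using that by (intro member_le_sum) auto
            then show ?thesis using k by simp
          qed
          then show ?thesis using that by (auto simp: Q_def abs_le_iff intro!: exI[of _ k]) (smt (verit))
        qed
        then show ?thesis by (auto simp: Q_def)
      qed
      show "asymp_L1_invariant (Rd s) (\<lambda>n. translate s (z n)) (indicator (A \<inter> Q k))" if A: "A \<in> ?G" for A k
      proof -
        from A obtain a where "A = {x \<in> space (Rd s). \<forall>i<s. x i \<le> a i}" by auto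
        then have "A \<inter> Q k = {x \<in> space (Rd s). \<forall>i<s. - real k \<le> x i \<and> x i \<le> min (a i) (real k)}"
          by (auto simp: Q_def)
        then show ?thesis
          using asymp_L1_invariant_box[of s z "\<lambda>_. - real k" "\<lambda>i. min (a i) (real k)"] z0 by simp
      qed
    qed (blast | rule sets_Rd_orthants distr_translate g translate_measurable_const)+
    then have "(\<lambda>n. \<integral>x. \<bar>g (translate s (z n) x) - g x\<bar> \<partial>Rd s) \<longlonglongrightarrow> 0" by (simp add: asymp_L1_invariant_def)
    from LIMSEQ_D[OF this e] obtain n where "\<bar>\<integral>x. \<bar>g (translate s (z n) x) - g x\<bar> \<partial>Rd s\<bar> < \<epsilon>" by auto
    with z(2)[of n] show False by simp
  qed
  then show ?thesis using that by blast
qed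

section \<open>Second moments of degenerate U-statistics\<close>

text \<open>In the application h is the indicator of the ball around a fixed centre x, and k
  indicates that x, y, z are pairwise near. Values 0 and 1 make h idempotent, so that a repeated
  index in a product counts once; \<open>k_le\<close> passes bounds for h on to k.\<close>

locale iid_pairs = prob_space +
  fixes X :: "nat \<Rightarrow> 'a \<Rightarrow> 'b" and N \<nu> :: "'b measure" and J :: "nat set"
    and h :: "'b \<Rightarrow> real" and k :: "'b \<times> 'b \<Rightarrow> real"
  assumes J: "finite J"
    and ind: "indep_vars (\<lambda>_. N) X J"
    and law: "\<And>i. i \<in> J \<Longrightarrow> distr M N (X i) = \<nu>"
    and h_meas[measurable]: "h \<in> borel_measurable N" and h01: "\<And>y. h y = 0 \<or> h y = 1"
    and k_meas[measurable]: "k \<in> borel_measurable (N \<Otimes>\<^sub>M N)"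
    and k_nonneg: "\<And>y z. 0 \<le> k (y, z)" and k_le: "\<And>y z. k (y, z) \<le> h y * h z"
    and p_pos: "integral\<^sup>L \<nu> h > 0"
begin

definition p where "p = integral\<^sup>L \<nu> h"
definition q where "q = integral\<^sup>L (\<nu> \<Otimes>\<^sub>M \<nu>) k"
definition c where "c = q / p\<^sup>2"
text \<open>The pairs are ordered, so each edge is counted twice; this matches the normalisation
  \<open>D * (D - 1)\<close>, which is twice the binomial coefficient.\<close>

definition pairs where "pairs = {(i, j). i \<in> J \<and> j \<in> J \<and> i \<noteq> j}"
definition D where "D \<omega> = (\<Sum>i\<in>J. h (X i \<omega>))"
definition g where "g a \<omega> = k (X (fst a) \<omega>, X (snd a) \<omega>) - c * (h (X (fst a) \<omega>) * h (X (snd a) \<omega>))"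
definition T where "T \<omega> = (\<Sum>a\<in>pairs. g a \<omega>)"

lemma finite_pairs: "finite pairs"
  by (rule finite_subset[of _ "J \<times> J"]) (auto simp: pairs_def J)

lemma X_meas: "i \<in> J \<Longrightarrow> X i \<in> M \<rightarrow>\<^sub>M N"
  using ind by (auto simp: indep_vars_def)

lemma hX_meas: "i \<in> J \<Longrightarrow> (\<lambda>\<omega>. h (X i \<omega>)) \<in> borel_measurable M"
  using X_meas by measurable

lemma kX_meas: "i \<in> J \<Longrightarrow> j \<in> J \<Longrightarrow> (\<lambda>\<omega>. k (X i \<omega>, X j \<omega>)) \<in> borel_measurable M"
  using X_meas by measurable

lemma h_range: "0 \<le> h y" "h y \<le> 1"
  using h01[of y] by auto

lemma hX_int: "i \<in> J \<Longrightarrow> integrable M (\<lambda>\<omega>. h (X i \<omega>))"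
  by (rule integrable_const_bound[where B=1]) (auto simp: h_range hX_meas)

lemma p_less: "p > 0" "p \<le> 1" if "J \<noteq> {}"
proof -
  from that obtain i where i: "i \<in> J" by auto
  interpret nu: prob_space \<nu>
    using prob_space_distr[OF X_meas[OF i]] law[OF i] by simp
  have "sets \<nu> = sets N" using law[OF i] by (metis sets_distr)
  then have [measurable]: "h \<in> borel_measurable \<nu>" by simp
  have "integral\<^sup>L \<nu> h \<le> (\<integral>x. 1 \<partial>\<nu>)"
    by (intro integral_mono nu.integrable_const_bound[where B=1]) (auto simp: h_range)
  then show "p \<le> 1" by (simp add: p_def nu.prob_space)
  show "p > 0" using p_pos by (simp add: p_def)
qed

lemma expectation_prod_h:
  assumes "A \<subseteq> J"
  shows "integrable M (\<lambda>\<omega>. \<Prod>i\<in>A. h (X i \<omega>))" "expectation (\<lambda>\<omega>. \<Prod>i\<in>A. h (X i \<omega>)) = p ^ card A"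
proof -
  have fin: "finite A" using assms J finite_subset by auto
  have i: "indep_vars (\<lambda>_. borel) (\<lambda>i \<omega>. h (X i \<omega>)) A"
    by (rule indep_vars_compose2[OF indep_vars_subset[OF ind assms]]) simp
  have I: "integrable M (\<lambda>\<omega>. h (X i \<omega>))" if "i \<in> A" for i
    using that assms by (intro hX_int) auto
  show "integrable M (\<lambda>\<omega>. \<Prod>i\<in>A. h (X i \<omega>))"
    by (rule indep_vars_integrable[OF fin i I])
  have "expectation (\<lambda>\<omega>. \<Prod>i\<in>A. h (X i \<omega>)) = (\<Prod>i\<in>A. expectation (\<lambda>\<omega>. h (X i \<omega>)))"
    by (rule indep_vars_lebesgue_integral[OF fin i I])
  also have "\<dots> = (\<Prod>i\<in>A. p)"
  proof (rule prod.cong)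
    fix i assume "i \<in> A"
    then have iJ: "i \<in> J" using assms by auto
    have "expectation (\<lambda>\<omega>. h (X i \<omega>)) = integral\<^sup>L (distr M N (X i)) h"
      by (rule integral_distr[OF X_meas[OF iJ], symmetric]) simp
    then show "expectation (\<lambda>\<omega>. h (X i \<omega>)) = p" by (simp add: p_def law[OF iJ])
  qed simp
  finally show "expectation (\<lambda>\<omega>. \<Prod>i\<in>A. h (X i \<omega>)) = p ^ card A" by simp
qed

lemma expectation_pair:
  assumes ij: "i \<in> J" "j \<in> J" "i \<noteq> j" and F[measurable]: "F \<in> borel_measurable (N \<Otimes>\<^sub>M N)"
  shows "expectation (\<lambda>\<omega>. F (X i \<omega>, X j \<omega>)) = (integral\<^sup>L (\<nu> \<Otimes>\<^sub>M \<nu>) F :: real)"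
proof -
  have "indep_var N ((\<lambda>x. x i) \<circ> (\<lambda>\<omega>. restrict (\<lambda>v. X v \<omega>) {i})) N ((\<lambda>x. x j) \<circ> (\<lambda>\<omega>. restrict (\<lambda>v. X v \<omega>) {j}))"
    using ij by (intro indep_var_compose[OF indep_var_restrict[OF ind]]) auto
  then have "indep_var N (X i) N (X j)" by (simp add: comp_def)
  then have "distr M N (X i) \<Otimes>\<^sub>M distr M N (X j) = distr M (N \<Otimes>\<^sub>M N) (\<lambda>\<omega>. (X i \<omega>, X j \<omega>))"
    by (simp add: indep_var_distribution_eq)
  then have "integral\<^sup>L (\<nu> \<Otimes>\<^sub>M \<nu>) F = integral\<^sup>L (distr M (N \<Otimes>\<^sub>M N) (\<lambda>\<omega>. (X i \<omega>, X j \<omega>))) F"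
    using law ij by simp
  also have "\<dots> = expectation (\<lambda>\<omega>. F (X i \<omega>, X j \<omega>))"
  proof (rule integral_distr)
    note [measurable] = X_meas[OF ij(1)] X_meas[OF ij(2)]
    show "(\<lambda>\<omega>. (X i \<omega>, X j \<omega>)) \<in> M \<rightarrow>\<^sub>M N \<Otimes>\<^sub>M N" by measurable
  qed (rule F)
  finally show ?thesis by simp
qed

lemma q_range: "0 \<le> q" "q \<le> p\<^sup>2" if "i \<in> J" "j \<in> J" "i \<noteq> j"
proof -
  have q: "q = expectation (\<lambda>\<omega>. k (X i \<omega>, X j \<omega>))"
    unfolding q_def by (rule expectation_pair[OF that, symmetric]) simp
  show "0 \<le> q" unfolding q by (intro integral_nonneg_AE) (auto simp: k_nonneg)
  have e: "h (X i \<omega>) * h (X j \<omega>) = (\<Prod>v\<in>{i, j}. h (X v \<omega>))" for \<omega> using that by simp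
  have "q \<le> expectation (\<lambda>\<omega>. \<Prod>v\<in>{i, j}. h (X v \<omega>))"
    unfolding q
  proof (rule integral_mono_AE')
    show "integrable M (\<lambda>\<omega>. \<Prod>v\<in>{i, j}. h (X v \<omega>))" using that by (intro expectation_prod_h) auto
    show "AE \<omega> in M. k (X i \<omega>, X j \<omega>) \<le> (\<Prod>v\<in>{i, j}. h (X v \<omega>))"
      using k_le unfolding e[symmetric] by simp
    show "AE \<omega> in M. 0 \<le> (\<Prod>v\<in>{i, j}. h (X v \<omega>))"
      by (auto intro!: prod_nonneg simp: h_range)
  qed
  also have "\<dots> = p\<^sup>2" using that by (subst expectation_prod_h) (auto simp: power2_eq_square)
  finally show "q \<le> p\<^sup>2" .
qed

lemma c_range: "0 \<le> c" "c \<le> 1" if "a \<in> pairs"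
proof -
  from that obtain i j where ij: "i \<in> J" "j \<in> J" "i \<noteq> j" by (auto simp: pairs_def)
  then have "p > 0" by (intro p_less) auto
  then show "0 \<le> c" "c \<le> 1" using q_range[OF ij] by (auto simp: c_def)
qed

lemma g_abs_le: "\<bar>g a \<omega>\<bar> \<le> h (X (fst a) \<omega>) * h (X (snd a) \<omega>)" if "a \<in> pairs"
proof -
  define u where "u = h (X (fst a) \<omega>) * h (X (snd a) \<omega>)"
  have "0 \<le> u" by (simp add: u_def h_range)
  then have "0 \<le> c * u" "c * u \<le> u" using c_range[OF that] by (auto intro: mult_left_le_one_le)
  then show ?thesis using k_nonneg k_le[of "X (fst a) \<omega>" "X (snd a) \<omega>"] unfolding g_def u_def[symmetric]
    by (smt (verit))
qed

lemma g_meas: "a \<in> pairs \<Longrightarrow> g a \<in> borel_measurable M"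
  unfolding g_def[abs_def] by (auto simp: pairs_def intro!: borel_measurable_diff borel_measurable_times hX_meas kX_meas)

lemma g_abs_le_1: "\<bar>g a \<omega>\<bar> \<le> 1" if "a \<in> pairs"
  using g_abs_le[OF that, of \<omega>] h01[of "X (fst a) \<omega>"] h01[of "X (snd a) \<omega>"] by auto

lemma g_int: "a \<in> pairs \<Longrightarrow> integrable M (g a)"
  by (rule integrable_const_bound[where B=1]) (auto simp: g_abs_le_1 g_meas)

lemma gg_int: "a \<in> pairs \<Longrightarrow> b \<in> pairs \<Longrightarrow> integrable M (\<lambda>\<omega>. g a \<omega> * g b \<omega>)"
  by (rule integrable_const_bound[where B=1])
    (auto simp: abs_mult g_abs_le_1 g_meas intro!: mult_le_one borel_measurable_times)

lemma expectation_g: "expectation (g a) = 0" if apairs: "a \<in> pairs"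
proof -
  obtain i j where a: "a = (i, j)" and ij: "i \<in> J" "j \<in> J" "i \<noteq> j" using apairs by (cases a) (auto simp: pairs_def)
  have p: "p > 0" using ij by (intro p_less) auto
  have "h (X i \<omega>) * h (X j \<omega>) = (\<Prod>v\<in>{i, j}. h (X v \<omega>))" for \<omega> using ij by simp
  then have hh: "expectation (\<lambda>\<omega>. h (X i \<omega>) * h (X j \<omega>)) = p\<^sup>2" "integrable M (\<lambda>\<omega>. h (X i \<omega>) * h (X j \<omega>))"
    using expectation_prod_h[of "{i, j}"] ij by (auto simp: power2_eq_square)
  have "integrable M (\<lambda>\<omega>. k (X i \<omega>, X j \<omega>))"
  proof (rule integrable_const_bound[where B=1])
    have "k (y, z) \<le> 1" for y z using k_le[of y z] h01[of y] h01[of z] by auto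
    then show "AE \<omega> in M. norm (k (X i \<omega>, X j \<omega>)) \<le> 1" using k_nonneg by auto
  qed (intro kX_meas ij)
  then have "expectation (g a) = q - c * p\<^sup>2"
    using hh unfolding g_def[abs_def] a by (simp add: q_def expectation_pair[OF ij])
  then show ?thesis using p by (simp add: c_def)
qed

text \<open>If the pairs overlap, both factors are dominated by products of h, and by idempotence
  the exponent is the number of distinct indices. If they are disjoint, the factors depend on
  independent blocks of variables and both are centred.\<close>

lemma expectation_gg_le:
  assumes a: "(i, j) \<in> pairs" and b: "(l, m) \<in> pairs"
  shows "expectation (\<lambda>\<omega>. g (i, j) \<omega> * g (l, m) \<omega>) \<le>
    (if l \<in> {i, j} \<or> m \<in> {i, j} then p ^ card {i, j, l, m} else 0)"
proof (cases "l \<in> {i, j} \<or> m \<in> {i, j}")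
  case True
  have sub: "{i, j, l, m} \<subseteq> J" using a b by (auto simp: pairs_def)
  have "expectation (\<lambda>\<omega>. g (i, j) \<omega> * g (l, m) \<omega>) \<le> expectation (\<lambda>\<omega>. \<Prod>v\<in>{i, j, l, m}. h (X v \<omega>))"
  proof (rule integral_mono)
    fix \<omega>
    let ?h = "\<lambda>v. h (X v \<omega>)"
    have "g (i, j) \<omega> * g (l, m) \<omega> \<le> \<bar>g (i, j) \<omega>\<bar> * \<bar>g (l, m) \<omega>\<bar>"
      by (metis abs_ge_self abs_mult)
    also have "\<dots> \<le> (?h i * ?h j) * (?h l * ?h m)"
      using g_abs_le[OF a, of \<omega>] g_abs_le[OF b, of \<omega>] by (intro mult_mono) (auto simp: h_range)
    also have "\<dots> \<le> (\<Prod>v\<in>{i, j, l, m}. ?h v)"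
    proof (cases "\<forall>v\<in>{i, j, l, m}. ?h v = 1")
      case True
      then have "(\<Prod>v\<in>{i, j, l, m}. ?h v) = 1" by (intro prod.neutral) auto
      moreover have "(?h i * ?h j) * (?h l * ?h m) = 1" using True by simp
      ultimately show ?thesis by (simp only: order_refl)
    next
      case False
      then have "?h i = 0 \<or> ?h j = 0 \<or> ?h l = 0 \<or> ?h m = 0" using h01 by auto
      then have "(?h i * ?h j) * (?h l * ?h m) = 0" by auto
      then show ?thesis by (simp only:) (intro prod_nonneg, simp add: h_range)
    qed
    finally show "g (i, j) \<omega> * g (l, m) \<omega> \<le> (\<Prod>v\<in>{i, j, l, m}. ?h v)" .
  qed (intro gg_int a b, rule expectation_prod_h[OF sub])
  then show ?thesis using True expectation_prod_h(2)[OF sub] by simp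
next
  case False
  let ?A = "{i, j}" and ?B = "{l, m}"
  let ?G = "\<lambda>s t x. k (x s, x t) - c * (h (x s) * h (x t)) :: real"
  have AB: "?A \<inter> ?B = {}" "?A \<subseteq> J" "?B \<subseteq> J" using False a b by (auto simp: pairs_def)
  have iv: "indep_var borel (?G i j \<circ> (\<lambda>\<omega>. restrict (\<lambda>v. X v \<omega>) ?A)) borel (?G l m \<circ> (\<lambda>\<omega>. restrict (\<lambda>v. X v \<omega>) ?B))"
    by (rule indep_var_compose[OF indep_var_restrict[OF ind AB]]) measurable
  have e: "?G i j \<circ> (\<lambda>\<omega>. restrict (\<lambda>v. X v \<omega>) ?A) = g (i, j)" "?G l m \<circ> (\<lambda>\<omega>. restrict (\<lambda>v. X v \<omega>) ?B) = g (l, m)"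
    by (auto simp: fun_eq_iff g_def)
  have "expectation (\<lambda>\<omega>. g (i, j) \<omega> * g (l, m) \<omega>) = expectation (g (i, j)) * expectation (g (l, m))"
    by (rule indep_var_lebesgue_integral[OF iv[unfolded e] g_int[OF a] g_int[OF b]])
  then show ?thesis using False by (simp add: expectation_g a b)
qed

text \<open>The diagonal of the square of D is a sum of squares of values 0 or 1, hence D again,
  which leaves \<open>D \<omega> * (D \<omega> - 1)\<close> off the diagonal.\<close>

lemma T_eq: "T \<omega> = (\<Sum>(i, j)\<in>pairs. k (X i \<omega>, X j \<omega>)) - c * (D \<omega> * (D \<omega> - 1))"
proof -
  let ?h = "\<lambda>i. h (X i \<omega>)"
  have "D \<omega> * D \<omega> = (\<Sum>(i, j)\<in>J \<times> J. ?h i * ?h j)"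
    by (simp add: D_def sum_product sum.cartesian_product)
  also have "J \<times> J = pairs \<union> (\<lambda>i. (i, i)) ` J" by (auto simp: pairs_def)
  also have "(\<Sum>(i, j)\<in>pairs \<union> (\<lambda>i. (i, i)) ` J. ?h i * ?h j) =
    (\<Sum>(i, j)\<in>pairs. ?h i * ?h j) + (\<Sum>(i, j)\<in>(\<lambda>i. (i, i)) ` J. ?h i * ?h j)"
    by (rule sum.union_disjoint[OF finite_pairs]) (auto simp: J pairs_def)
  also have "(\<Sum>(i, j)\<in>(\<lambda>i. (i, i)) ` J. ?h i * ?h j) = (\<Sum>i\<in>J. ?h i * ?h i)"
    by (subst sum.reindex) (auto simp: inj_on_def)
  also have "\<dots> = D \<omega>" unfolding D_def by (intro sum.cong) (use h01 in \<open>force\<close>)+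
  finally have "(\<Sum>(i, j)\<in>pairs. ?h i * ?h j) = D \<omega> * (D \<omega> - 1)" by (simp add: algebra_simps)
  moreover have "T \<omega> = (\<Sum>(i, j)\<in>pairs. k (X i \<omega>, X j \<omega>)) - c * (\<Sum>(i, j)\<in>pairs. ?h i * ?h j)"
    by (simp add: T_def g_def sum_subtractf sum_distrib_left case_prod_beta)
  ultimately show ?thesis by simp
qed

lemma expectation_D: "expectation D = card J * p" "integrable M D"
proof -
  have "expectation D = (\<Sum>i\<in>J. expectation (\<lambda>\<omega>. h (X i \<omega>)))"
    unfolding D_def by (rule Bochner_Integration.integral_sum) (rule hX_int)
  also have "\<dots> = (\<Sum>i\<in>J. p)"
    using expectation_prod_h(2)[of "{_}"] by (intro sum.cong) auto
  finally show "expectation D = card J * p" by simp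
  show "integrable M D" unfolding D_def by (intro Bochner_Integration.integrable_sum hX_int)
qed

text \<open>As for a binomial count, the off-diagonal terms are covered by the squared mean and the
  diagonal adds one mean.\<close>

lemma D_square: "integrable M (\<lambda>\<omega>. (D \<omega>)\<^sup>2)" "variance D \<le> card J * p"
proof -
  have hh: "h (X i \<omega>) * h (X j \<omega>) = (\<Prod>v\<in>{i, j}. h (X v \<omega>))" for i j \<omega>
    using h01[of "X i \<omega>"] by (cases "i = j") auto
  have D2: "(D \<omega>)\<^sup>2 = (\<Sum>i\<in>J. \<Sum>j\<in>J. \<Prod>v\<in>{i, j}. h (X v \<omega>))" for \<omega>
    unfolding hh[symmetric] by (simp add: D_def power2_eq_square sum_product)
  show int: "integrable M (\<lambda>\<omega>. (D \<omega>)\<^sup>2)"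
    unfolding D2 by (intro Bochner_Integration.integrable_sum expectation_prod_h) auto
  have "expectation (\<lambda>\<omega>. (D \<omega>)\<^sup>2) = (\<Sum>i\<in>J. \<Sum>j\<in>J. expectation (\<lambda>\<omega>. \<Prod>v\<in>{i, j}. h (X v \<omega>)))"
    unfolding D2 by (subst Bochner_Integration.integral_sum, (intro Bochner_Integration.integrable_sum expectation_prod_h; auto))
      (intro sum.cong refl Bochner_Integration.integral_sum expectation_prod_h; auto)
  also have "\<dots> = (\<Sum>i\<in>J. \<Sum>j\<in>J. p ^ card {i, j})"
    by (intro sum.cong refl expectation_prod_h) auto
  also have "\<dots> \<le> (\<Sum>i\<in>J. \<Sum>j\<in>J. p\<^sup>2 + (if i = j then p else 0))"
    using p_less by (intro sum_mono) (auto simp: card_insert_if power2_eq_square)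
  also have "\<dots> = (card J * p)\<^sup>2 + card J * p"
    by (simp add: sum.distrib J power2_eq_square algebra_simps)
  finally show "variance D \<le> card J * p"
    by (subst variance_eq) (simp_all add: expectation_D int)
qed

text \<open>Pairs of index pairs without a common index are uncorrelated and contribute nothing, which
  saves one factor \<open>card J * p\<close> over the trivial bound.\<close>
lemma T_square: "integrable M (\<lambda>\<omega>. (T \<omega>)\<^sup>2)"
    "expectation (\<lambda>\<omega>. (T \<omega>)\<^sup>2) \<le> 4 * (card J)\<^sup>2 * (2 * p\<^sup>2 + card J * p ^ 3)"
proof -
  have T2: "(T \<omega>)\<^sup>2 = (\<Sum>a\<in>pairs. \<Sum>b\<in>pairs. g a \<omega> * g b \<omega>)" for \<omega>
    by (simp add: T_def power2_eq_square sum_product)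
  show "integrable M (\<lambda>\<omega>. (T \<omega>)\<^sup>2)"
    unfolding T2 by (intro Bochner_Integration.integrable_sum gg_int)
  \<comment> \<open>The factor 4 counts the ways to overlap: the first or the second entry of b
    equals i or j. The other entry of b then contributes the sum of \<phi>.\<close>
  have row: "(\<Sum>b\<in>pairs. expectation (\<lambda>\<omega>. g a \<omega> * g b \<omega>)) \<le> 4 * (2 * p\<^sup>2 + card J * p ^ 3)"
    if a: "a \<in> pairs" for a
  proof -
    obtain i j where aij: "a = (i, j)" and ij: "i \<in> J" "j \<in> J" "i \<noteq> j" using a by (cases a) (auto simp: pairs_def)
    have p: "0 < p" "p \<le> 1" using p_less ij by auto
    \<comment> \<open>Once one entry of b lies in {i, j}, let v be the other one: the union of both
      pairs has two elements if v lies in {i, j} as well and three otherwise, and this number is the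
      exponent of p.\<close>
    define \<phi> where "\<phi> v = (if v \<in> {i, j} then p\<^sup>2 else p ^ 3)" for v
    have \<phi>0: "\<phi> v \<ge> 0" for v using p by (simp add: \<phi>_def)
    have \<phi>: "(\<Sum>v\<in>J. \<phi> v) \<le> 2 * p\<^sup>2 + card J * p ^ 3"
    proof -
      have "(\<Sum>v\<in>J. \<phi> v) \<le> (\<Sum>v\<in>J. (if v = i then p\<^sup>2 else 0) + (if v = j then p\<^sup>2 else 0) + p ^ 3)"
        using p by (intro sum_mono) (auto simp: \<phi>_def)
      also have "\<dots> = 2 * p\<^sup>2 + card J * p ^ 3" using ij J by (simp add: sum.distrib)
      finally show ?thesis .
    qed
    have "(\<Sum>b\<in>pairs. expectation (\<lambda>\<omega>. g a \<omega> * g b \<omega>)) \<le>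
      (\<Sum>(l, m)\<in>pairs. (if l \<in> {i, j} then \<phi> m else 0) + (if m \<in> {i, j} then \<phi> l else 0))"
    proof (rule sum_mono, clarify)
      fix l m assume b: "(l, m) \<in> pairs"
      have lm: "l \<noteq> m" using b by (auto simp: pairs_def)
      have "expectation (\<lambda>\<omega>. g a \<omega> * g (l, m) \<omega>) \<le> (if l \<in> {i, j} \<or> m \<in> {i, j} then p ^ card {i, j, l, m} else 0)"
        using expectation_gg_le[OF a[unfolded aij] b] by (simp only: aij)
      also have "\<dots> \<le> (if l \<in> {i, j} then \<phi> m else 0) + (if m \<in> {i, j} then \<phi> l else 0)"
        using ij(3) lm p by (auto simp: \<phi>_def card_insert_if power2_eq_square power3_eq_cube)
      finally show "expectation (\<lambda>\<omega>. g a \<omega> * g (l, m) \<omega>) \<le> \<dots>" .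
    qed
    also have "\<dots> \<le> (\<Sum>(l, m)\<in>J \<times> J. (if l \<in> {i, j} then \<phi> m else 0) + (if m \<in> {i, j} then \<phi> l else 0))"
      by (rule sum_mono2) (auto simp: J pairs_def \<phi>0)
    also have "\<dots> = (\<Sum>l\<in>J. \<Sum>m\<in>J. (if l \<in> {i, j} then \<phi> m else 0)) + (\<Sum>l\<in>J. \<Sum>m\<in>J. (if m \<in> {i, j} then \<phi> l else 0))"
      by (simp only: sum.cartesian_product[symmetric] sum.distrib)
    also have "(\<Sum>l\<in>J. \<Sum>m\<in>J. (if m \<in> {i, j} then \<phi> l else 0)) = (\<Sum>l\<in>J. \<Sum>m\<in>J. (if l \<in> {i, j} then \<phi> m else 0))"
      by (rule sum.swap)
    also have "(\<Sum>l\<in>J. \<Sum>m\<in>J. (if l \<in> {i, j} then \<phi> m else 0)) = (\<Sum>l\<in>J. if l \<in> {i, j} then (\<Sum>m\<in>J. \<phi> m) else 0)"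
      by (intro sum.cong) auto
    also have "\<dots> = (\<Sum>l\<in>{i, j}. (\<Sum>m\<in>J. \<phi> m))"
      using ij J by (intro sum.mono_neutral_cong_right) auto
    also have "\<dots> = 2 * (\<Sum>m\<in>J. \<phi> m)" using ij by simp
    finally show ?thesis using \<phi> by simp
  qed
  have "expectation (\<lambda>\<omega>. (T \<omega>)\<^sup>2) = (\<Sum>a\<in>pairs. \<Sum>b\<in>pairs. expectation (\<lambda>\<omega>. g a \<omega> * g b \<omega>))"
    unfolding T2 by (subst Bochner_Integration.integral_sum, (intro Bochner_Integration.integrable_sum gg_int; assumption))
      (intro sum.cong refl Bochner_Integration.integral_sum gg_int; assumption)
  also have "\<dots> \<le> (\<Sum>a\<in>pairs. 4 * (2 * p\<^sup>2 + card J * p ^ 3))" by (rule sum_mono[OF row])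
  also have "\<dots> = card pairs * (4 * (2 * p\<^sup>2 + card J * p ^ 3))" by simp
  also have "\<dots> \<le> (card J)\<^sup>2 * (4 * (2 * p\<^sup>2 + card J * p ^ 3))"
  proof (rule mult_right_mono)
    have "card pairs \<le> card (J \<times> J)" by (rule card_mono) (auto simp: J pairs_def)
    then show "real (card pairs) \<le> real ((card J)\<^sup>2)"
      by (simp only: card_cartesian_product power2_eq_square of_nat_le_iff)
    show "0 \<le> 4 * (2 * p\<^sup>2 + card J * p ^ 3)" using p_pos by (simp add: p_def)
  qed
  finally show "expectation (\<lambda>\<omega>. (T \<omega>)\<^sup>2) \<le> 4 * (card J)\<^sup>2 * (2 * p\<^sup>2 + card J * p ^ 3)"
    by (simp add: algebra_simps)
qed

lemma D_meas: "D \<in> borel_measurable M"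
  using expectation_D(2) by (rule borel_measurable_integrable)

lemma T_meas: "T \<in> borel_measurable M"
  unfolding T_def[abs_def] by (intro borel_measurable_sum g_meas)

text \<open>Two applications of Chebyshev's inequality with \<mu> = \<open>card J * p\<close>.
  Outside probability 4 / \<mu> one has \<open>D \<omega> \<ge> \<mu> / 2\<close>, hence
  \<open>D \<omega> * (D \<omega> - 1) \<ge> \<mu>\<^sup>2 / 8\<close>, because \<mu> \<ge> 4 gives
  \<mu>/2 - 1 \<ge> \<mu>/4. The second moment of T is at most \<open>8 * \<mu> ^ 3\<close>, and 8
  times the square of 8 is 512.\<close>

lemma pair_ratio_concentration:
  assumes \<mu>: "card J * p \<ge> 4" and \<epsilon>: "\<epsilon> > 0"
  shows "prob {\<omega> \<in> space M. \<not> (2 \<le> D \<omega> \<and>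
    \<bar>(\<Sum>(i, j)\<in>pairs. k (X i \<omega>, X j \<omega>)) / (D \<omega> * (D \<omega> - 1)) - c\<bar> \<le> \<epsilon>)} \<le> (4 + 512 / \<epsilon>\<^sup>2) / (card J * p)"
proof -
  define \<mu> where "\<mu> = card J * p"
  have \<mu>4: "\<mu> \<ge> 4" using \<mu> by (simp add: \<mu>_def)
  note [measurable] = D_meas T_meas
  let ?A = "{\<omega> \<in> space M. \<mu> / 2 \<le> \<bar>D \<omega> - expectation D\<bar>}"
  let ?B = "{\<omega> \<in> space M. \<epsilon> * \<mu>\<^sup>2 / 8 \<le> \<bar>T \<omega> - expectation T\<bar>}"
  have T0: "expectation T = 0"
  proof -
    have "expectation T = (\<Sum>a\<in>pairs. expectation (g a))"
      unfolding T_def[abs_def] by (rule Bochner_Integration.integral_sum) (rule g_int)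
    then show ?thesis by (simp add: expectation_g)
  qed
  have A: "prob ?A \<le> 4 / \<mu>"
  proof -
    have "prob ?A \<le> variance D / (\<mu> / 2)\<^sup>2"
      using \<mu>4 D_square by (intro Chebyshev_inequality) auto
    also have "\<dots> \<le> \<mu> / (\<mu> / 2)\<^sup>2" using D_square \<mu>4 by (intro divide_right_mono) (auto simp: \<mu>_def)
    also have "\<dots> = 4 / \<mu>" using \<mu>4 by (simp add: power2_eq_square)
    finally show ?thesis .
  qed
  have B: "prob ?B \<le> 512 / \<epsilon>\<^sup>2 / \<mu>"
  proof -
    have "prob ?B \<le> variance T / (\<epsilon> * \<mu>\<^sup>2 / 8)\<^sup>2"
      using \<mu>4 \<epsilon> T_square by (intro Chebyshev_inequality) auto
    also have "variance T = expectation (\<lambda>\<omega>. (T \<omega>)\<^sup>2)" by (simp add: T0)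
    also have "\<dots> \<le> 4 * (card J)\<^sup>2 * (2 * p\<^sup>2 + card J * p ^ 3)" by (rule T_square)
    also have "\<dots> = 8 * \<mu>\<^sup>2 + 4 * \<mu> ^ 3" by (simp add: \<mu>_def power2_eq_square power3_eq_cube algebra_simps)
    also have "\<dots> \<le> 8 * \<mu> ^ 3"
    proof -
      have "2 * \<mu>\<^sup>2 \<le> \<mu> * \<mu>\<^sup>2" using \<mu>4 by (intro mult_right_mono) auto
      then show ?thesis by (simp add: power2_eq_square power3_eq_cube)
    qed
    finally have "prob ?B \<le> 8 * \<mu> ^ 3 / (\<epsilon> * \<mu>\<^sup>2 / 8)\<^sup>2" by (simp add: divide_right_mono)
    also have "\<dots> = 512 / \<epsilon>\<^sup>2 / \<mu>" using \<mu>4 \<epsilon> by (simp add: field_simps power2_eq_square power3_eq_cube)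
    finally show ?thesis .
  qed
  have "prob {\<omega> \<in> space M. \<not> (2 \<le> D \<omega> \<and>
    \<bar>(\<Sum>(i, j)\<in>pairs. k (X i \<omega>, X j \<omega>)) / (D \<omega> * (D \<omega> - 1)) - c\<bar> \<le> \<epsilon>)} \<le> prob (?A \<union> ?B)"
  proof (rule finite_measure_mono, rule subsetI)
    fix \<omega> assume bad: "\<omega> \<in> {\<omega> \<in> space M. \<not> (2 \<le> D \<omega> \<and>
      \<bar>(\<Sum>(i, j)\<in>pairs. k (X i \<omega>, X j \<omega>)) / (D \<omega> * (D \<omega> - 1)) - c\<bar> \<le> \<epsilon>)}"
    show "\<omega> \<in> ?A \<union> ?B"
    proof (rule ccontr)
      assume "\<omega> \<notin> ?A \<union> ?B"
      with bad have \<omega>: "\<omega> \<in> space M" "\<omega> \<notin> ?B" and n: "\<not> (2 \<le> D \<omega> \<and>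
        \<bar>(\<Sum>(i, j)\<in>pairs. k (X i \<omega>, X j \<omega>)) / (D \<omega> * (D \<omega> - 1)) - c\<bar> \<le> \<epsilon>)"
        and "\<not> \<mu> / 2 \<le> \<bar>D \<omega> - expectation D\<bar>" by blast+
      from this(4) have D: "D \<omega> \<ge> \<mu> / 2" by (auto simp: expectation_D(1) \<mu>_def[symmetric] abs_if split: if_splits)
      have "(\<mu> / 2) * (\<mu> / 4) \<le> D \<omega> * (D \<omega> - 1)" using D \<mu>4 by (intro mult_mono) auto
      then have DD: "\<mu>\<^sup>2 / 8 \<le> D \<omega> * (D \<omega> - 1)" by (simp add: power2_eq_square)
      have pos: "D \<omega> * (D \<omega> - 1) > 0" using D \<mu>4 by simp
      have "\<bar>T \<omega>\<bar> \<le> \<epsilon> * (\<mu>\<^sup>2 / 8)" using \<omega> by (simp add: T0)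
      also have "\<dots> \<le> \<epsilon> * (D \<omega> * (D \<omega> - 1))" using DD \<epsilon> by (intro mult_left_mono) auto
      finally have "\<bar>T \<omega>\<bar> \<le> \<epsilon> * (D \<omega> * (D \<omega> - 1))" .
      moreover have "(\<Sum>(i, j)\<in>pairs. k (X i \<omega>, X j \<omega>)) / (D \<omega> * (D \<omega> - 1)) - c = T \<omega> / (D \<omega> * (D \<omega> - 1))"
        using less_imp_neq[OF pos] by (simp only: T_eq diff_divide_distrib nonzero_mult_div_cancel_right not_sym)
      ultimately have "\<bar>(\<Sum>(i, j)\<in>pairs. k (X i \<omega>, X j \<omega>)) / (D \<omega> * (D \<omega> - 1)) - c\<bar> \<le> \<epsilon>"
        using pos by (simp only: abs_divide abs_of_pos[OF pos] pos_divide_le_eq)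
      moreover have "2 \<le> D \<omega>" using D \<mu>4 by simp
      ultimately show False using n by blast
    qed
  qed measurable
  also have "\<dots> \<le> prob ?A + prob ?B" by (rule measure_Un_le) measurable
  also have "\<dots> \<le> 4 / \<mu> + 512 / \<epsilon>\<^sup>2 / \<mu>" using A B by simp
  finally show ?thesis by (simp add: \<mu>_def add_divide_distrib)
qed

end

section \<open>Local clustering around a fixed vertex\<close>

text \<open>The linear order selects one representative with i < j of each unordered pair; the
  ordered pairs are these representatives and, disjoint from them, their swaps.\<close>

lemma card_unordered_pairs:
  fixes A :: "'i::linorder set"
  assumes A: "finite A" and R: "\<And>i j. R i j \<Longrightarrow> R j i" "\<And>i. \<not> R i i"
  shows "2 * card {{i, j} | i j. i \<in> A \<and> j \<in> A \<and> R i j} = card {(i, j). i \<in> A \<and> j \<in> A \<and> R i j}"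
proof -
  let ?P = "{(i, j). i \<in> A \<and> j \<in> A \<and> R i j}"
  let ?U = "{(i, j). i \<in> A \<and> j \<in> A \<and> R i j \<and> i < j}"
  have fin: "finite ?U" using A by (intro finite_subset[of ?U "A \<times> A"]) auto
  have P: "?P = ?U \<union> prod.swap ` ?U"
  proof
    show "?P \<subseteq> ?U \<union> prod.swap ` ?U"
    proof
      fix x assume "x \<in> ?P"
      then obtain i j where x: "x = (i, j)" "i \<in> A" "j \<in> A" "R i j" by auto
      then have "i \<noteq> j" using R(2) by auto
      then show "x \<in> ?U \<union> prod.swap ` ?U"
      proof (cases "i < j")
        case False
        then have "(j, i) \<in> ?U" using x R(1) \<open>i \<noteq> j\<close> by auto
        then have "prod.swap (j, i) \<in> prod.swap ` ?U" by blast
        then show ?thesis using x by simp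
      qed (use x in auto)
    qed
    show "?U \<union> prod.swap ` ?U \<subseteq> ?P" using R(1) by auto
  qed
  have "card ?P = card ?U + card (prod.swap ` ?U)"
    unfolding P using fin by (intro card_Un_disjoint) auto
  also have "card (prod.swap ` ?U) = card ?U" by (intro card_image) (auto simp: inj_on_def)
  also have "card ?U = card ((\<lambda>(i, j). {i, j}) ` ?U)"
    by (intro card_image[symmetric]) (auto simp: inj_on_def doubleton_eq_iff)
  also have "(\<lambda>(i, j). {i, j}) ` ?U = {{i, j} | i j. i \<in> A \<and> j \<in> A \<and> R i j}"
  proof (intro equalityI subsetI)
    fix S assume "S \<in> {{i, j} | i j. i \<in> A \<and> j \<in> A \<and> R i j}"
    then obtain i j where S: "S = {i, j}" "i \<in> A" "j \<in> A" "R i j" by auto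
    then have "i \<noteq> j" using R(2) by auto
    show "S \<in> (\<lambda>(i, j). {i, j}) ` ?U"
    proof (cases "i < j")
      case True then show ?thesis using S by (intro image_eqI[of _ _ "(i, j)"]) auto
    next
      case False
      then show ?thesis using S R(1) \<open>i \<noteq> j\<close> by (intro image_eqI[of _ _ "(j, i)"]) (auto simp: insert_commute)
    qed
  qed auto
  finally show ?thesis by simp
qed

definition near :: "nat \<Rightarrow> real \<Rightarrow> (nat \<Rightarrow> real) \<Rightarrow> (nat \<Rightarrow> real) \<Rightarrow> real" where
  "near d r x y = of_bool (edist d x y \<le> r)"

lemma near_measurable[measurable]:
  assumes "f \<in> M \<rightarrow>\<^sub>M Rd d" "g \<in> M \<rightarrow>\<^sub>M Rd d"
  shows "(\<lambda>x. near d r (f x) (g x)) \<in> borel_measurable M"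
  unfolding near_def using assms by measurable

text \<open>Vertex 1 is never its own neighbour, so indices start at 2. For a random sample these
  belong to the points independent of the first one.\<close>

lemma nbrs1_eq: "nbrs1 d p r n = {j \<in> {2..n}. edist d (p 1) (p j) \<le> r}"
  by (auto simp: nbrs1_def gadj_def)

lemma deg1_eq: "real (deg1 d p r n) = (\<Sum>j\<in>{2..n}. near d r (p 1) (p j))"
  by (simp add: deg1_def nbrs1_eq near_def sum_of_bool_eq Int_def)

lemma tri1_eq:
  "2 * real (tri1 d p r n) = (\<Sum>(i, j) | i \<in> {2..n} \<and> j \<in> {2..n} \<and> i \<noteq> j.
     near d r (p 1) (p i) * near d r (p 1) (p j) * near d r (p i) (p j))"
proof -
  define P where "P = {(i, j). i \<in> {2..n} \<and> j \<in> {2..n} \<and> i \<noteq> j}"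
  define B where "B = {(i, j). edist d (p 1) (p i) \<le> r \<and> edist d (p 1) (p j) \<le> r \<and> edist d (p i) (p j) \<le> r}"
  have fin: "finite P" by (rule finite_subset[of _ "{2..n} \<times> {2..n}"]) (auto simp: P_def)
  have "2 * tri1 d p r n = card {(i, j). i \<in> nbrs1 d p r n \<and> j \<in> nbrs1 d p r n \<and> gadj d p r i j}"
    unfolding tri1_def by (rule card_unordered_pairs) (auto simp: nbrs1_def gadj_def edist_commute)
  also have "{(i, j). i \<in> nbrs1 d p r n \<and> j \<in> nbrs1 d p r n \<and> gadj d p r i j} = P \<inter> B"
    by (auto simp: nbrs1_eq gadj_def P_def B_def)
  finally have "2 * real (tri1 d p r n) = real (card (P \<inter> B))" by (metis of_nat_mult of_nat_numeral)
  also have "\<dots> = (\<Sum>a\<in>P \<inter> B. 1)" by simp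
  also have "\<dots> = (\<Sum>a\<in>P. if a \<in> B then 1 else 0)" by (rule sum.inter_restrict[OF fin])
  also have "\<dots> = (\<Sum>(i, j)\<in>P. near d r (p 1) (p i) * near d r (p 1) (p j) * near d r (p i) (p j))"
    by (intro sum.cong) (auto simp: near_def B_def)
  finally show ?thesis by (simp only: P_def)
qed

lemma W4_eq: "W4 d p r n = (if deg1 d p r n \<ge> 2
    then 2 * real (tri1 d p r n) / (real (deg1 d p r n) * (real (deg1 d p r n) - 1)) else 0)"
proof -
  have "t / real (D choose 2) = 2 * t / (real D * (real D - 1))" if "D \<ge> 2" for D :: nat and t :: real
  proof -
    have "real (D choose 2) = real D * (real D - 1) / 2"
      using that by (simp add: choose_two real_of_nat_div of_nat_diff)
    then show ?thesis by (simp only: divide_divide_eq_right mult.commute[of t 2])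
  qed
  then show ?thesis by (auto simp: W4_def)
qed

lemma W4_measurable:
  assumes "\<And>i. i \<in> {1..n} \<Longrightarrow> (\<lambda>\<omega>. p \<omega> i) \<in> M \<rightarrow>\<^sub>M Rd d"
  shows "(\<lambda>\<omega>. W4 d (p \<omega>) r n) \<in> borel_measurable M"
proof (cases "n \<ge> 1")
  case True
  have n: "(\<lambda>\<omega>. near d r (p \<omega> i) (p \<omega> j)) \<in> borel_measurable M" if "i \<in> {1..n}" "j \<in> {1..n}" for i j
    using that by (intro near_measurable assms)
  have [measurable]: "(\<lambda>\<omega>. real (deg1 d (p \<omega>) r n)) \<in> borel_measurable M"
    unfolding deg1_eq using True by (intro borel_measurable_sum n) auto
  have [measurable]: "(\<lambda>\<omega>. 2 * real (tri1 d (p \<omega>) r n)) \<in> borel_measurable M"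
    unfolding tri1_eq using True
    by (intro borel_measurable_sum) (auto intro!: borel_measurable_times n)
  have eq: "W4 d (p \<omega>) r n = (if 2 \<le> real (deg1 d (p \<omega>) r n)
    then 2 * real (tri1 d (p \<omega>) r n) / (real (deg1 d (p \<omega>) r n) * (real (deg1 d (p \<omega>) r n) - 1)) else 0)" for \<omega>
    unfolding W4_eq by auto
  show ?thesis unfolding eq by measurable
next
  case False
  then have "deg1 d (p \<omega>) r n = 0" for \<omega> by (simp add: deg1_def nbrs1_def)
  then show ?thesis by (simp add: W4_def)
qed

text \<open>Allows the sample to be replaced by its restriction to finitely many indices, which
  takes a default value elsewhere.\<close>

lemma W4_cong:
  assumes "\<And>i. i \<in> {1..n} \<Longrightarrow> p i = p' i"
  shows "W4 d p r n = W4 d p' r n"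
proof (cases "n \<ge> 1")
  case True
  have "real (deg1 d p r n) = real (deg1 d p' r n)"
    unfolding deg1_eq using True by (intro sum.cong) (auto simp: assms)
  moreover have "2 * real (tri1 d p r n) = 2 * real (tri1 d p' r n)"
    unfolding tri1_eq using True by (intro sum.cong) (auto simp: assms)
  ultimately show ?thesis unfolding W4_eq by simp
next
  case False
  then show ?thesis by (simp add: W4_def deg1_def nbrs1_def)
qed

section \<open>Masses of balls and near triples at scale r\<close>

lemma edist_translate_scale:
  assumes "r > 0"
  shows "edist s x (\<lambda>i\<in>{..<s}. x i + r * u i) = r * edist s u (\<lambda>_. 0)"
    "edist s (\<lambda>i\<in>{..<s}. x i + r * u i) (\<lambda>i\<in>{..<s}. x i + r * v i) = r * edist s u v"
proof -
  have *: "sqrt (\<Sum>i<s. (r * a i)\<^sup>2) = r * sqrt (\<Sum>i<s. (a i)\<^sup>2)" for a :: "nat \<Rightarrow> real"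
    using assms by (simp add: power_mult_distrib real_sqrt_mult flip: sum_distrib_left)
  show "edist s x (\<lambda>i\<in>{..<s}. x i + r * u i) = r * edist s u (\<lambda>_. 0)"
    using *[of u] by (simp add: edist_def)
  show "edist s (\<lambda>i\<in>{..<s}. x i + r * u i) (\<lambda>i\<in>{..<s}. x i + r * v i) = r * edist s u v"
    using *[of "\<lambda>i. u i - v i"] by (simp add: edist_def right_diff_distrib)
qed

lemma nn_integral_Rd_affine:
  assumes "r > 0" "F \<in> borel_measurable (Rd s)"
  shows "(\<integral>\<^sup>+y. F y \<partial>Rd s) = ennreal (r ^ s) * (\<integral>\<^sup>+u. F (\<lambda>i\<in>{..<s}. x i + r * u i) \<partial>Rd s)"
  using nn_integral_PiM_lborel_affine[of "{..<s}" r F x] assms by (simp add: Rd_def)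

lemma nn_integral_near:
  assumes "r > 0" "x \<in> space (Rd s)"
  shows "(\<integral>\<^sup>+y. near s r x y \<partial>Rd s) = ennreal (unit_ball_vol s * r ^ s)"
proof -
  note [measurable] = assms(2)
  have "(\<integral>\<^sup>+y. near s r x y \<partial>Rd s) = ennreal (r ^ s) * (\<integral>\<^sup>+u. near s r x (\<lambda>i\<in>{..<s}. x i + r * u i) \<partial>Rd s)"
    using assms by (intro nn_integral_Rd_affine) auto
  also have "(\<integral>\<^sup>+u. near s r x (\<lambda>i\<in>{..<s}. x i + r * u i) \<partial>Rd s) = (\<integral>\<^sup>+u. indicator (unit_ball s) u \<partial>Rd s)"
    using assms by (intro nn_integral_cong) (auto simp: near_def edist_translate_scale unit_ball_def)
  finally show ?thesis using assms by (simp add: emeasure_unit_ball ennreal_mult mult.commute)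
qed

text \<open>The substitution y = x + r u, z = x + r v leaves the close pairs in the unit ball and
  one Jacobian \<open>r ^ s\<close> for each variable.\<close>

lemma nn_integral_near_near_near:
  assumes r: "r > 0" and x: "x \<in> space (Rd s)"
  shows "(\<integral>\<^sup>+y. (\<integral>\<^sup>+z. near s r x y * near s r x z * near s r y z \<partial>Rd s) \<partial>Rd s)
     = ennreal (w s * (unit_ball_vol s * r ^ s)\<^sup>2)"
proof -
  interpret R: sigma_finite_measure "Rd s" by (rule sigma_finite_Rd)
  note [measurable] = x
  let ?a = "\<lambda>u. \<lambda>i\<in>{..<s}. x i + r * u i"
  have a[measurable]: "?a \<in> Rd s \<rightarrow>\<^sub>M Rd s"
    unfolding Rd_def by (intro measurable_restrict) measurable
  let ?F = "\<lambda>y z. ennreal (near s r x y * near s r x z * near s r y z)"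
  let ?E = "{z \<in> space (Rd s \<Otimes>\<^sub>M Rd s). edist s (fst z) (\<lambda>_. 0) \<le> 1 \<and>
      edist s (snd z) (\<lambda>_. 0) \<le> 1 \<and> edist s (fst z) (snd z) \<le> 1}"
  have E: "?E \<in> sets (Rd s \<Otimes>\<^sub>M Rd s)" by measurable
  have "(\<integral>\<^sup>+y. (\<integral>\<^sup>+z. ?F y z \<partial>Rd s) \<partial>Rd s) = ennreal (r ^ s) * (\<integral>\<^sup>+u. (\<integral>\<^sup>+z. ?F (?a u) z \<partial>Rd s) \<partial>Rd s)"
    using r by (intro nn_integral_Rd_affine[where F="\<lambda>y. \<integral>\<^sup>+z. ?F y z \<partial>Rd s"]) measurable
  also have "(\<integral>\<^sup>+u. (\<integral>\<^sup>+z. ?F (?a u) z \<partial>Rd s) \<partial>Rd s) = (\<integral>\<^sup>+u. ennreal (r ^ s) * (\<integral>\<^sup>+v. ?F (?a u) (?a v) \<partial>Rd s) \<partial>Rd s)"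
  proof (rule nn_integral_cong)
    fix u assume [measurable]: "u \<in> space (Rd s)"
    have [measurable]: "?a u \<in> space (Rd s)" by (simp add: space_Rd)
    show "(\<integral>\<^sup>+z. ?F (?a u) z \<partial>Rd s) = ennreal (r ^ s) * (\<integral>\<^sup>+v. ?F (?a u) (?a v) \<partial>Rd s)"
      using r by (intro nn_integral_Rd_affine[where F="?F (?a u)"]) measurable
  qed
  also have "\<dots> = (\<integral>\<^sup>+u. ennreal (r ^ s) * (\<integral>\<^sup>+v. indicator ?E (u, v) \<partial>Rd s) \<partial>Rd s)"
    using r by (intro nn_integral_cong arg_cong2[where f="(*)"] refl)
      (auto simp: near_def edist_translate_scale indicator_def space_pair_measure)
  also have "\<dots> = ennreal (r ^ s) * (\<integral>\<^sup>+u. (\<integral>\<^sup>+v. indicator ?E (u, v) \<partial>Rd s) \<partial>Rd s)"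
    using E by (intro nn_integral_cmult R.borel_measurable_nn_integral_fst) simp
  also have "(\<integral>\<^sup>+u. (\<integral>\<^sup>+v. indicator ?E (u, v) \<partial>Rd s) \<partial>Rd s) = emeasure (Rd s \<Otimes>\<^sub>M Rd s) ?E"
    by (rule R.emeasure_pair_measure[OF E, symmetric])
  also have "\<dots> = ennreal (w s * (unit_ball_vol s)\<^sup>2)" by (rule emeasure_close_pairs_unit_ball)
  finally show ?thesis
    using r by (simp add: w_nonneg power_mult_distrib power2_eq_square mult_ac flip: ennreal_mult)
qed

lemma w_le_1: "w s \<le> 1"
proof -
  define U where "U = uniform_measure (Rd s) (unit_ball s)"
  interpret U: prob_space U unfolding U_def
    using unit_ball_vol_neq_0[of s] by (intro prob_space_uniform_measure) (auto simp: emeasure_unit_ball)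
  interpret UU: pair_prob_space U U ..
  show ?thesis unfolding w_def Let_def U_def[symmetric] by (rule UU.prob_le_1)
qed

lemma near_range: "0 \<le> near d r x y" "near d r x y \<le> 1"
  by (auto simp: near_def)

lemma integrable_near:
  assumes "r > 0" "x \<in> space (Rd s)"
  shows "integrable (Rd s) (near s r x)" "integral\<^sup>L (Rd s) (near s r x) = unit_ball_vol s * r ^ s"
proof -
  note [measurable] = assms(2)
  have m: "near s r x \<in> borel_measurable (Rd s)" by measurable
  have "0 \<le> unit_ball_vol s * r ^ s" using assms by simp
  then have "has_bochner_integral (Rd s) (near s r x) (unit_ball_vol s * r ^ s)"
    using nn_integral_near[OF assms] m by (intro has_bochner_integral_nn_integral) (auto simp: near_range)
  then show "integrable (Rd s) (near s r x)" "integral\<^sup>L (Rd s) (near s r x) = unit_ball_vol s * r ^ s"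
    by (auto simp: has_bochner_integral_iff)
qed

section \<open>Ball masses compared with those of a constant density a\<close>

context
  fixes s :: nat and r :: real and x :: "nat \<Rightarrow> real" and f :: "(nat \<Rightarrow> real) \<Rightarrow> real" and a :: real
  assumes r: "r > 0" and x[measurable]: "x \<in> space (Rd s)"
    and f: "integrable (Rd s) f" and f0: "\<And>y. f y \<ge> 0" and a: "a \<ge> 0"
begin

private abbreviation "\<kappa> \<equiv> near s r x"
private abbreviation "v \<equiv> unit_ball_vol s * r ^ s"
private abbreviation "osc \<equiv> \<integral>y. \<kappa> y * \<bar>f y - a\<bar> \<partial>Rd s"
private abbreviation "p \<equiv> \<integral>y. \<kappa> y * f y \<partial>Rd s"

private lemma integrable_near_mult: "integrable (Rd s) g \<Longrightarrow> integrable (Rd s) (\<lambda>y. \<kappa> y * g y)"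
  by (rule Bochner_Integration.integrable_bound[where f=g]) (auto simp: abs_mult near_range mult_left_le_one_le)

private lemma integrable_osc: "integrable (Rd s) (\<lambda>y. \<kappa> y * \<bar>f y - a\<bar>)"
proof (rule Bochner_Integration.integrable_bound)
  show "integrable (Rd s) (\<lambda>y. \<kappa> y * f y + a * \<kappa> y)"
    using integrable_near[OF r x] integrable_near_mult[OF f] by simp
  show "(\<lambda>y. \<kappa> y * \<bar>f y - a\<bar>) \<in> borel_measurable (Rd s)"
    using f by (auto dest!: borel_measurable_integrable)
  show "AE y in Rd s. norm (\<kappa> y * \<bar>f y - a\<bar>) \<le> norm (\<kappa> y * f y + a * \<kappa> y)"
  proof (rule AE_I2)
    fix y
    show "norm (\<kappa> y * \<bar>f y - a\<bar>) \<le> norm (\<kappa> y * f y + a * \<kappa> y)"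
      using f0[of y] a by (auto simp: near_def)
  qed
qed

lemma ball_mass_approx: "\<bar>p - a * v\<bar> \<le> osc"
proof -
  have "p - a * v = (\<integral>y. \<kappa> y * f y - a * \<kappa> y \<partial>Rd s)"
    using integrable_near[OF r x] integrable_near_mult[OF f] by simp
  also have "\<bar>\<dots>\<bar> \<le> (\<integral>y. \<bar>\<kappa> y * f y - a * \<kappa> y\<bar> \<partial>Rd s)"
    by (rule integral_abs_bound)
  also have "\<dots> = osc" by (intro Bochner_Integration.integral_cong) (auto simp: near_def)
  finally show ?thesis .
qed

text \<open>The density is replaced by the constant a in one variable at a time. In the inner
  variable the error is at most osc for each y and is weighted with the mass p; in the outer
  variable osc is multiplied by the bound \<open>a * v\<close> for the inner integral under constant
  density.\<close>

lemma ball_pair_mass_approx: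
  "\<bar>(\<integral>y. \<kappa> y * f y * (\<integral>z. \<kappa> z * near s r y z * f z \<partial>Rd s) \<partial>Rd s) - w s * (a * v)\<^sup>2\<bar> \<le> (p + a * v) * osc"
proof -
  interpret R: sigma_finite_measure "Rd s" by (rule sigma_finite_Rd)
  have fm[measurable]: "f \<in> borel_measurable (Rd s)" using f by auto
  define A where "A y = (\<integral>z. \<kappa> z * near s r y z \<partial>Rd s)" for y
  define Q where "Q y = (\<integral>z. \<kappa> z * near s r y z * f z \<partial>Rd s)" for y
  have [measurable]: "A \<in> borel_measurable (Rd s)" "Q \<in> borel_measurable (Rd s)"
    unfolding A_def[abs_def] Q_def[abs_def] by measurable
  have iA: "integrable (Rd s) (\<lambda>z. \<kappa> z * near s r y z)" if [measurable]: "y \<in> space (Rd s)" for y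
    by (rule Bochner_Integration.integrable_bound[OF integrable_near(1)[OF r x]])
      (auto simp: near_def)
  have iQ: "integrable (Rd s) (\<lambda>z. \<kappa> z * near s r y z * f z)" if [measurable]: "y \<in> space (Rd s)" for y
    by (rule Bochner_Integration.integrable_bound[OF f]) (auto simp: near_def)
  have QA: "\<bar>Q y - a * A y\<bar> \<le> osc" if y: "y \<in> space (Rd s)" for y
  proof -
    let ?g = "\<lambda>z. \<kappa> z * near s r y z * f z - a * (\<kappa> z * near s r y z)"
    have ig: "integrable (Rd s) ?g" and eq: "integral\<^sup>L (Rd s) ?g = Q y - a * A y"
      unfolding Q_def A_def using iQ[OF y] integrable_mult_right[OF iA[OF y], of a] by simp_all
    have "\<bar>Q y - a * A y\<bar> \<le> (\<integral>z. \<bar>?g z\<bar> \<partial>Rd s)"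
      unfolding eq[symmetric] by (rule integral_abs_bound)
    also have "\<dots> \<le> osc"
    proof (rule integral_mono)
      fix z
      show "\<bar>\<kappa> z * near s r y z * f z - a * (\<kappa> z * near s r y z)\<bar> \<le> \<kappa> z * \<bar>f z - a\<bar>"
        by (simp add: near_def)
    qed (use ig integrable_osc in simp_all)
    finally show ?thesis .
  qed
  have A0: "0 \<le> A y" for y unfolding A_def by (intro integral_nonneg_AE) (auto simp: near_range)
  have Av: "A y \<le> v" if y: "y \<in> space (Rd s)" for y
    unfolding A_def integrable_near(2)[OF r x, symmetric]
    by (rule integral_mono[OF iA[OF y] integrable_near(1)[OF r x]]) (simp add: near_def)
  have ip: "integrable (Rd s) (\<lambda>y. \<kappa> y * f y)" by (rule integrable_near_mult[OF f])
  have i1: "integrable (Rd s) (\<lambda>y. \<kappa> y * A y)"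
  proof (rule Bochner_Integration.integrable_bound)
    show "integrable (Rd s) (\<lambda>y. v * \<kappa> y)" using integrable_near[OF r x] by simp
    show "AE y in Rd s. norm (\<kappa> y * A y) \<le> norm (v * \<kappa> y)"
    proof (rule AE_I2)
      fix y assume "y \<in> space (Rd s)"
      have "norm (\<kappa> y * A y) = A y * \<kappa> y" by (simp add: abs_mult near_range A0)
      also have "\<dots> \<le> v * \<kappa> y" by (rule mult_right_mono[OF Av near_range(1)]) fact
      finally show "norm (\<kappa> y * A y) \<le> norm (v * \<kappa> y)" by (metis abs_ge_self order_trans real_norm_def)
    qed
  qed measurable
  have i2: "integrable (Rd s) (\<lambda>y. (\<kappa> y * f y) * (Q y - a * A y))"
  proof (rule Bochner_Integration.integrable_bound)
    show "integrable (Rd s) (\<lambda>y. (\<kappa> y * f y) * osc)" using ip by simp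
    show "AE y in Rd s. norm ((\<kappa> y * f y) * (Q y - a * A y)) \<le> norm ((\<kappa> y * f y) * osc)"
    proof (rule AE_I2)
      fix y assume "y \<in> space (Rd s)"
      from QA[OF this] show "norm ((\<kappa> y * f y) * (Q y - a * A y)) \<le> norm ((\<kappa> y * f y) * osc)"
        unfolding norm_mult by (intro mult_left_mono) auto
    qed
  qed measurable
  have i3: "integrable (Rd s) (\<lambda>y. A y * (\<kappa> y * (f y - a)))"
  proof (rule Bochner_Integration.integrable_bound)
    show "integrable (Rd s) (\<lambda>y. v * (\<kappa> y * \<bar>f y - a\<bar>))" using integrable_osc by simp
    show "AE y in Rd s. norm (A y * (\<kappa> y * (f y - a))) \<le> norm (v * (\<kappa> y * \<bar>f y - a\<bar>))"
    proof (rule AE_I2)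
      fix y assume "y \<in> space (Rd s)"
      then have "norm (A y) \<le> norm v" using order_trans[OF Av abs_ge_self] A0[of y] by simp
      then show "norm (A y * (\<kappa> y * (f y - a))) \<le> norm (v * (\<kappa> y * \<bar>f y - a\<bar>))"
        unfolding norm_mult by (intro mult_mono) auto
    qed
  qed measurable
  have wA: "w s * v\<^sup>2 = (\<integral>y. \<kappa> y * A y \<partial>Rd s)"
  proof -
    have "ennreal (\<integral>y. \<kappa> y * A y \<partial>Rd s) = (\<integral>\<^sup>+y. ennreal (\<kappa> y * A y) \<partial>Rd s)"
      by (rule nn_integral_eq_integral[OF i1, symmetric]) (auto simp: near_range A0)
    also have "\<dots> = (\<integral>\<^sup>+y. (\<integral>\<^sup>+z. near s r x y * near s r x z * near s r y z \<partial>Rd s) \<partial>Rd s)"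
    proof (rule nn_integral_cong)
      fix y assume y[measurable]: "y \<in> space (Rd s)"
      have "ennreal (\<kappa> y * A y) = ennreal (\<kappa> y) * (\<integral>\<^sup>+z. ennreal (\<kappa> z * near s r y z) \<partial>Rd s)"
        unfolding A_def using iA[OF y]
        by (subst nn_integral_eq_integral) (auto simp: near_range ennreal_mult' integral_nonneg_AE)
      also have "\<dots> = (\<integral>\<^sup>+z. near s r x y * near s r x z * near s r y z \<partial>Rd s)"
        by (subst nn_integral_cmult[symmetric]) (auto simp: near_range ennreal_mult' mult.assoc intro!: nn_integral_cong)
      finally show "ennreal (\<kappa> y * A y) = \<dots>" .
    qed
    also have "\<dots> = ennreal (w s * v\<^sup>2)" by (rule nn_integral_near_near_near[OF r x])
    finally show ?thesis by (simp add: w_nonneg integral_nonneg_AE near_range A0)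
  qed
  have "w s * (a * v)\<^sup>2 = a\<^sup>2 * (\<integral>y. \<kappa> y * A y \<partial>Rd s)"
    by (simp only: wA[symmetric] power_mult_distrib[of a] mult.left_commute[of "w s"])
  \<comment> \<open>Telescoping from f(y) Q(y) to \<open>a\<^sup>2 * A y\<close> through a f(y)
    A(y).\<close>
  moreover have "(\<integral>y. \<kappa> y * f y * Q y \<partial>Rd s) =
     (\<integral>y. ((\<kappa> y * f y) * (Q y - a * A y) + a * (A y * (\<kappa> y * (f y - a)))) + a\<^sup>2 * (\<kappa> y * A y) \<partial>Rd s)"
    by (intro Bochner_Integration.integral_cong) (auto simp: algebra_simps power2_eq_square)
  moreover have "\<dots> = (\<integral>y. (\<kappa> y * f y) * (Q y - a * A y) \<partial>Rd s) + a * (\<integral>y. A y * (\<kappa> y * (f y - a)) \<partial>Rd s)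
      + a\<^sup>2 * (\<integral>y. \<kappa> y * A y \<partial>Rd s)"
    using i1 i2 i3 by simp
  ultimately have eq: "(\<integral>y. \<kappa> y * f y * Q y \<partial>Rd s) - w s * (a * v)\<^sup>2 =
      (\<integral>y. (\<kappa> y * f y) * (Q y - a * A y) \<partial>Rd s) + a * (\<integral>y. A y * (\<kappa> y * (f y - a)) \<partial>Rd s)" by linarith
  have b1: "\<bar>\<integral>y. (\<kappa> y * f y) * (Q y - a * A y) \<partial>Rd s\<bar> \<le> p * osc"
  proof -
    have "\<bar>\<integral>y. (\<kappa> y * f y) * (Q y - a * A y) \<partial>Rd s\<bar> \<le> (\<integral>y. \<bar>(\<kappa> y * f y) * (Q y - a * A y)\<bar> \<partial>Rd s)"
      by (rule integral_abs_bound)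
    also have "\<dots> \<le> (\<integral>y. (\<kappa> y * f y) * osc \<partial>Rd s)"
    proof (rule integral_mono)
      fix y assume "y \<in> space (Rd s)"
      from QA[OF this] show "\<bar>(\<kappa> y * f y) * (Q y - a * A y)\<bar> \<le> (\<kappa> y * f y) * osc"
        unfolding abs_mult using f0[of y] by (intro mult_mono) (auto simp: near_range)
    qed (use i2 ip in auto)
    finally show ?thesis by simp
  qed
  have b2: "\<bar>\<integral>y. A y * (\<kappa> y * (f y - a)) \<partial>Rd s\<bar> \<le> v * osc"
  proof -
    have "\<bar>\<integral>y. A y * (\<kappa> y * (f y - a)) \<partial>Rd s\<bar> \<le> (\<integral>y. \<bar>A y * (\<kappa> y * (f y - a))\<bar> \<partial>Rd s)"
      by (rule integral_abs_bound)
    also have "\<dots> \<le> (\<integral>y. v * (\<kappa> y * \<bar>f y - a\<bar>) \<partial>Rd s)"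
    proof (rule integral_mono)
      fix y assume "y \<in> space (Rd s)"
      from Av[OF this] A0[of y] show "\<bar>A y * (\<kappa> y * (f y - a))\<bar> \<le> v * (\<kappa> y * \<bar>f y - a\<bar>)"
        unfolding abs_mult by (intro mult_mono) (auto simp: near_range)
    qed (use i3 integrable_osc in auto)
    finally show ?thesis by simp
  qed
  have "\<bar>(\<integral>y. \<kappa> y * f y * Q y \<partial>Rd s) - w s * (a * v)\<^sup>2\<bar> \<le> p * osc + a * (v * osc)"
    unfolding eq using b1 mult_left_mono[OF b2 a] a
    by (intro order_trans[OF abs_triangle_ineq] add_mono) (simp_all add: abs_mult)
  then show ?thesis by (simp add: Q_def algebra_simps)
qed

end

text \<open>From o1 \<le> u/2 follows u \<le> 2p. The error of q and the error from putting p for u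
  add up to at most 2 (p + u) o1, and p + u \<le> 3p together with o1 \<le> 2 \<eta> p makes this
  \<open>12 * \<eta> * p\<^sup>2\<close>.\<close>

lemma ratio_approx:
  fixes p q o1 u \<eta> W :: real
  assumes "u > 0" "o1 \<le> \<eta> * u" "0 < \<eta>" "\<eta> \<le> 1 / 2" "0 \<le> W" "W \<le> 1"
    and p: "\<bar>p - u\<bar> \<le> o1" and q: "\<bar>q - W * u\<^sup>2\<bar> \<le> (p + u) * o1"
  shows "p \<ge> u / 2" "\<bar>q / p\<^sup>2 - W\<bar> \<le> 12 * \<eta>"
proof -
  have "\<eta> * u \<le> 1 / 2 * u" using assms by (intro mult_right_mono) auto
  then have "o1 \<le> u / 2" using assms(2) by linarith
  then show up: "p \<ge> u / 2" using p by (simp add: abs_le_iff)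
  then have p0: "p > 0" using assms by simp
  have o0: "0 \<le> o1" using p by (smt (verit))
  have "\<bar>q - W * p\<^sup>2\<bar> \<le> \<bar>q - W * u\<^sup>2\<bar> + W * (\<bar>u - p\<bar> * (u + p))"
  proof -
    have "q - W * p\<^sup>2 = (q - W * u\<^sup>2) + W * ((u - p) * (u + p))" by (simp add: algebra_simps power2_eq_square)
    also have "\<bar>\<dots>\<bar> \<le> \<bar>q - W * u\<^sup>2\<bar> + \<bar>W * ((u - p) * (u + p))\<bar>" by (rule abs_triangle_ineq)
    also have "\<bar>W * ((u - p) * (u + p))\<bar> = W * (\<bar>u - p\<bar> * (u + p))" using assms p0 by (simp add: abs_mult)
    finally show ?thesis .
  qed
  also have "W * (\<bar>u - p\<bar> * (u + p)) \<le> 1 * (o1 * (u + p))"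
    using assms p0 o0 by (intro mult_mono) (auto simp: abs_minus_commute)
  finally have "\<bar>q - W * p\<^sup>2\<bar> \<le> 2 * ((p + u) * o1)" using q by (simp add: algebra_simps)
  also have "\<dots> \<le> 2 * ((3 * p) * (\<eta> * (2 * p)))"
    using assms up p0 o0 by (intro mult_left_mono mult_mono order_trans[OF assms(2)]) auto
  finally have "\<bar>q - W * p\<^sup>2\<bar> \<le> 12 * \<eta> * p\<^sup>2" by (simp add: power2_eq_square mult_ac)
  moreover have "q / p\<^sup>2 - W = (q - W * p\<^sup>2) / p\<^sup>2" using p0 by (simp add: diff_divide_distrib)
  ultimately show "\<bar>q / p\<^sup>2 - W\<bar> \<le> 12 * \<eta>"
    using p0 by (simp add: abs_divide pos_divide_le_eq)
qed

text \<open>After y = x + z and an exchange of integrals, each z of norm at most r contributes the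
  L1 distance between f and its translate by z; integrating this bound over the ball produces the
  volume.\<close>

lemma nn_integral_oscillation_le:
  assumes f: "integrable (Rd s) (f :: _ \<Rightarrow> real)" and e: "\<epsilon> > 0"
  shows "\<exists>\<delta>>0. \<forall>r. 0 < r \<longrightarrow> r \<le> \<delta> \<longrightarrow>
      (\<integral>\<^sup>+x. (\<integral>\<^sup>+y. near s r x y * \<bar>f y - f x\<bar> \<partial>Rd s) \<partial>Rd s) \<le> ennreal (\<epsilon> * (unit_ball_vol s * r ^ s))"
proof -
  from L1_translation_continuous[OF f e] obtain \<delta> where \<delta>: "\<delta> > 0"
    "\<And>z. (\<And>i. i < s \<Longrightarrow> \<bar>z i\<bar> \<le> \<delta>) \<Longrightarrow> (\<integral>x. \<bar>f (translate s z x) - f x\<bar> \<partial>Rd s) \<le> \<epsilon>" by metis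
  interpret R: sigma_finite_measure "Rd s" by (rule sigma_finite_Rd)
  interpret P: pair_sigma_finite "Rd s" "Rd s" ..
  have fm[measurable]: "f \<in> borel_measurable (Rd s)" using f by auto
  have "(\<integral>\<^sup>+x. (\<integral>\<^sup>+y. near s r x y * \<bar>f y - f x\<bar> \<partial>Rd s) \<partial>Rd s) \<le> ennreal (\<epsilon> * (unit_ball_vol s * r ^ s))"
    if r: "0 < r" "r \<le> \<delta>" for r
  proof -
    let ?N = "\<lambda>z. of_bool (edist s z (\<lambda>_. 0) \<le> r) :: real"
    have "(\<integral>\<^sup>+x. (\<integral>\<^sup>+y. near s r x y * \<bar>f y - f x\<bar> \<partial>Rd s) \<partial>Rd s) =
      (\<integral>\<^sup>+x. (\<integral>\<^sup>+z. ?N z * \<bar>f (translate s x z) - f x\<bar> \<partial>Rd s) \<partial>Rd s)"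
    proof (rule nn_integral_cong)
      fix x assume x[measurable]: "x \<in> space (Rd s)"
      have "(\<integral>\<^sup>+y. near s r x y * \<bar>f y - f x\<bar> \<partial>Rd s) =
        (\<integral>\<^sup>+z. near s r x (translate s x z) * \<bar>f (translate s x z) - f x\<bar> \<partial>Rd s)"
        by (rule nn_integral_translate[symmetric]) measurable
      moreover have "edist s x (translate s x z) = edist s z (\<lambda>_. 0)" for z
        by (simp add: edist_def translate_def)
      ultimately show "(\<integral>\<^sup>+y. near s r x y * \<bar>f y - f x\<bar> \<partial>Rd s) =
        (\<integral>\<^sup>+z. ?N z * \<bar>f (translate s x z) - f x\<bar> \<partial>Rd s)" by (simp add: near_def)
    qed
    also have "\<dots> = (\<integral>\<^sup>+z. (\<integral>\<^sup>+x. ?N z * \<bar>f (translate s x z) - f x\<bar> \<partial>Rd s) \<partial>Rd s)"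
      by (rule P.Fubini'[symmetric]) measurable
    also have "\<dots> \<le> (\<integral>\<^sup>+z. ennreal \<epsilon> * indicator {z \<in> space (Rd s). edist s z (\<lambda>_. 0) \<le> r} z \<partial>Rd s)"
    proof (rule nn_integral_mono)
      fix z assume z: "z \<in> space (Rd s)"
      show "(\<integral>\<^sup>+x. ?N z * \<bar>f (translate s x z) - f x\<bar> \<partial>Rd s) \<le>
        ennreal \<epsilon> * indicator {z \<in> space (Rd s). edist s z (\<lambda>_. 0) \<le> r} z"
      proof (cases "edist s z (\<lambda>_. 0) \<le> r")
        case True
        \<comment> \<open>The sum of x and z arose as z shifted by x and is now read as x shifted by
          z, with z small.\<close>
        have comm: "translate s x z = translate s z x" for x by (auto simp: translate_def add.commute)
        have "\<bar>z i\<bar> \<le> \<delta>" if "i < s" for i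
        proof -
          have "(z i)\<^sup>2 \<le> (\<Sum>i<s. (z i)\<^sup>2)" using that by (intro member_le_sum) auto
          then have "\<bar>z i\<bar> \<le> edist s z (\<lambda>_. 0)" unfolding edist_def
            using real_sqrt_le_mono by fastforce
          then show ?thesis using True r by simp
        qed
        then have "(\<integral>x. \<bar>f (translate s z x) - f x\<bar> \<partial>Rd s) \<le> \<epsilon>" by (rule \<delta>(2))
        moreover have "integrable (Rd s) (\<lambda>x. f (translate s z x))"
          by (rule integrable_measure_preserving(1)[OF translate_measurable_const distr_translate f])
        ultimately have "(\<integral>\<^sup>+x. \<bar>f (translate s z x) - f x\<bar> \<partial>Rd s) \<le> ennreal \<epsilon>"
          using f by (subst nn_integral_eq_integral) (auto intro!: ennreal_leI)
        then show ?thesis using True z by (simp add: comm)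
      qed simp
    qed
    also have "\<dots> = ennreal \<epsilon> * ennreal (unit_ball_vol s * r ^ s)"
      using r by (subst nn_integral_cmult_indicator) (measurable, simp add: emeasure_Rd_ball)
    also have "\<dots> = ennreal (\<epsilon> * (unit_ball_vol s * r ^ s))"
      using r e by (simp add: ennreal_mult)
    finally show ?thesis .
  qed
  with \<delta>(1) show ?thesis by blast
qed

section \<open>Tail bounds for the clustering coefficient\<close>

lemma (in iid_pairs) pair_sum_meas: "(\<lambda>\<omega>. \<Sum>(i, j)\<in>pairs. k (X i \<omega>, X j \<omega>)) \<in> borel_measurable M"
  by (intro borel_measurable_sum) (auto simp: pairs_def intro!: kX_meas)

text \<open>The first vertex is frozen at x. One \<epsilon> pays for the fluctuation of the ratio
  around \<open>q / p\<^sup>2\<close>, the other for the distance of this number to w d, which is at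
  most 12 \<eta>. The mean degree is at least K because p is at least half of f x times the ball
  volume.\<close>

lemma (in prob_space) W4_tail_fixed:
  fixes f :: "(nat \<Rightarrow> real) \<Rightarrow> real" and d :: nat
  defines "\<nu> \<equiv> density (Rd d) (\<lambda>y. ennreal (f y))"
  assumes r: "r > 0" and n: "n \<ge> 2"
    and ind: "indep_vars (\<lambda>_. Rd d) X {2..n}"
    and law: "\<And>i. i \<in> {2..n} \<Longrightarrow> distr M (Rd d) (X i) = \<nu>"
    and f: "integrable (Rd d) f" and f0: "\<And>y. f y \<ge> 0"
    and \<nu>: "prob_space \<nu>"
    and x: "x \<in> space (Rd d)" and fx: "f x > 0"
    and \<epsilon>: "\<epsilon> > 0" and \<eta>: "0 < \<eta>" "\<eta> \<le> 1 / 2" "12 * \<eta> \<le> \<epsilon>"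
    and osc: "(\<integral>y. near d r x y * \<bar>f y - f x\<bar> \<partial>Rd d) \<le> \<eta> * (f x * (unit_ball_vol d * r ^ d))"
    and K: "K \<ge> 4" "K \<le> real (n - 1) * (f x * (unit_ball_vol d * r ^ d) / 2)"
  shows "prob {\<omega> \<in> space M. \<bar>W4 d ((\<lambda>i. X i \<omega>)(1 := x)) r n - w d\<bar> > 2 * \<epsilon>} \<le> (4 + 512 / \<epsilon>\<^sup>2) / K"
proof -
  interpret R: sigma_finite_measure "Rd d" by (rule sigma_finite_Rd)
  interpret nu: prob_space \<nu> by fact
  interpret nunu: pair_prob_space \<nu> \<nu> ..
  note [measurable] = x
  have fm[measurable]: "f \<in> borel_measurable (Rd d)" using f by auto
  let ?h = "near d r x" and ?k = "\<lambda>(y, z). near d r x y * near d r x z * near d r y z"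
  have sets_nu[measurable_cong, simp]: "sets \<nu> = sets (Rd d)" by (simp add: \<nu>_def)
  have hm: "?h \<in> borel_measurable (Rd d)" by measurable
  have km: "?k \<in> borel_measurable (Rd d \<Otimes>\<^sub>M Rd d)" by measurable
  have int_nu: "(\<integral>y. g y \<partial>\<nu>) = (\<integral>y. f y * g y \<partial>Rd d)" if "g \<in> borel_measurable (Rd d)" for g :: "_ \<Rightarrow> real"
    unfolding \<nu>_def using that f0 by (subst integral_density) auto
  define u where "u = f x * (unit_ball_vol d * r ^ d)"
  have u: "u > 0" using fx r by (simp add: u_def)
  define p where "p = integral\<^sup>L \<nu> ?h"
  define q where "q = integral\<^sup>L (\<nu> \<Otimes>\<^sub>M \<nu>) ?k"
  have p: "p = (\<integral>y. near d r x y * f y \<partial>Rd d)"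
    unfolding p_def int_nu[OF hm] by (simp add: mult.commute)
  have q: "q = (\<integral>y. near d r x y * f y * (\<integral>z. near d r x z * near d r y z * f z \<partial>Rd d) \<partial>Rd d)"
  proof -
    have ik: "integrable (\<nu> \<Otimes>\<^sub>M \<nu>) ?k"
      by (rule nunu.integrable_const_bound[where B=1]) (auto simp: near_def)
    have "q = (\<integral>y. (\<integral>z. ?k (y, z) \<partial>\<nu>) \<partial>\<nu>)"
      unfolding q_def by (rule nunu.integral_fst'[OF ik, symmetric])
    also have "\<dots> = (\<integral>y. f y * (\<integral>z. ?k (y, z) \<partial>\<nu>) \<partial>Rd d)"
      by (rule int_nu) measurable
    also have "\<dots> = (\<integral>y. near d r x y * f y * (\<integral>z. near d r x z * near d r y z * f z \<partial>Rd d) \<partial>Rd d)"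
    proof (rule Bochner_Integration.integral_cong)
      fix y assume y[measurable]: "y \<in> space (Rd d)"
      have "(\<integral>z. ?k (y, z) \<partial>\<nu>) = (\<integral>z. f z * ?k (y, z) \<partial>Rd d)" by (rule int_nu) measurable
      also have "\<dots> = near d r x y * (\<integral>z. near d r x z * near d r y z * f z \<partial>Rd d)"
        by (subst integral_mult_right_zero[symmetric]) (simp add: mult_ac)
      finally show "f y * (\<integral>z. ?k (y, z) \<partial>\<nu>) =
        near d r x y * f y * (\<integral>z. near d r x z * near d r y z * f z \<partial>Rd d)" by (simp add: mult_ac)
    qed simp
    finally show ?thesis .
  qed
  have pu: "p \<ge> u / 2" and qp: "\<bar>q / p\<^sup>2 - w d\<bar> \<le> 12 * \<eta>"
  proof -
    have "\<bar>p - u\<bar> \<le> (\<integral>y. near d r x y * \<bar>f y - f x\<bar> \<partial>Rd d)"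
      using ball_mass_approx[OF r x f f0, of "f x"] fx by (simp add: p u_def)
    moreover have "\<bar>q - w d * u\<^sup>2\<bar> \<le> (p + u) * (\<integral>y. near d r x y * \<bar>f y - f x\<bar> \<partial>Rd d)"
      using ball_pair_mass_approx[OF r x f f0, of "f x"] fx by (simp add: p q u_def)
    ultimately show "p \<ge> u / 2" "\<bar>q / p\<^sup>2 - w d\<bar> \<le> 12 * \<eta>"
      using ratio_approx[OF u, of _ \<eta> "w d" p q] osc \<eta> w_nonneg w_le_1 by (auto simp: u_def)
  qed
  interpret I: iid_pairs M X "Rd d" \<nu> "{2..n}" ?h ?k
  proof
    show "0 < integral\<^sup>L \<nu> ?h" using pu u by (simp add: p_def)
  qed (use ind law hm km in \<open>auto simp: near_def\<close>)
  have Ip: "I.p = p" and Ic: "I.c = q / p\<^sup>2" by (simp_all add: I.p_def p_def I.c_def I.q_def q_def)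
  have card: "card {2..n} = n - 1" by simp
  have mp: "real (card {2..n}) * I.p \<ge> K"
  proof -
    have "K \<le> real (n - 1) * (u / 2)" using K(2) by (simp only: u_def)
    also have "\<dots> \<le> real (n - 1) * p" using pu by (intro mult_left_mono) auto
    finally show ?thesis by (simp add: Ip)
  qed
  let ?R = "\<lambda>\<omega>. (\<Sum>(i, j)\<in>I.pairs. ?k (X i \<omega>, X j \<omega>)) / (I.D \<omega> * (I.D \<omega> - 1))"
  have sub: "{\<omega> \<in> space M. \<bar>W4 d ((\<lambda>i. X i \<omega>)(1 := x)) r n - w d\<bar> > 2 * \<epsilon>} \<subseteq>
    {\<omega> \<in> space M. \<not> (2 \<le> I.D \<omega> \<and> \<bar>?R \<omega> - I.c\<bar> \<le> \<epsilon>)}"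
  proof (rule subsetI, rule ccontr)
    fix \<omega> assume 1: "\<omega> \<in> {\<omega> \<in> space M. \<bar>W4 d ((\<lambda>i. X i \<omega>)(1 := x)) r n - w d\<bar> > 2 * \<epsilon>}"
      and 2: "\<omega> \<notin> {\<omega> \<in> space M. \<not> (2 \<le> I.D \<omega> \<and> \<bar>?R \<omega> - I.c\<bar> \<le> \<epsilon>)}"
    from 1 2 have D: "2 \<le> I.D \<omega>" and R: "\<bar>?R \<omega> - I.c\<bar> \<le> \<epsilon>" by auto
    let ?p = "(\<lambda>i. X i \<omega>)(1 := x)"
    have deg: "real (deg1 d ?p r n) = I.D \<omega>"
      unfolding deg1_eq I.D_def by (intro sum.cong) auto
    have tri: "2 * real (tri1 d ?p r n) = (\<Sum>(i, j)\<in>I.pairs. ?k (X i \<omega>, X j \<omega>))"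
      unfolding tri1_eq I.pairs_def by (intro sum.cong) auto
    have "W4 d ?p r n = ?R \<omega>" unfolding W4_eq deg tri using D deg by auto
    then have "\<bar>W4 d ?p r n - w d\<bar> \<le> 2 * \<epsilon>" using R qp \<eta> unfolding Ic by linarith
    then show False using 1 by simp
  qed
  have "prob {\<omega> \<in> space M. \<bar>W4 d ((\<lambda>i. X i \<omega>)(1 := x)) r n - w d\<bar> > 2 * \<epsilon>} \<le>
    prob {\<omega> \<in> space M. \<not> (2 \<le> I.D \<omega> \<and> \<bar>?R \<omega> - I.c\<bar> \<le> \<epsilon>)}"
  proof (rule finite_measure_mono[OF sub])
    note [measurable] = I.D_meas I.pair_sum_meas
    show "{\<omega> \<in> space M. \<not> (2 \<le> I.D \<omega> \<and> \<bar>?R \<omega> - I.c\<bar> \<le> \<epsilon>)} \<in> events" by measurable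
  qed
  also have "\<dots> \<le> (4 + 512 / \<epsilon>\<^sup>2) / (real (card {2..n}) * I.p)"
    using mp K \<epsilon> by (intro I.pair_ratio_concentration) auto
  also have "\<dots> \<le> (4 + 512 / \<epsilon>\<^sup>2) / K"
  proof (rule divide_left_mono[OF mp])
    show "0 < real (card {2..n}) * I.p * K" by (rule mult_pos_pos) (use mp K in linarith)+
  qed simp
  finally show ?thesis .
qed

text \<open>By independence the joint law of X 1 and the remaining points is a product, so the
  probability is an integral over frozen first vertices. Centres with large oscillation or small
  mean degree are charged with the trivial bound 1, whence the two measures in the sum.\<close>

lemma (in prob_space) W4_tail:
  fixes f :: "(nat \<Rightarrow> real) \<Rightarrow> real" and d :: nat
  defines "\<nu> \<equiv> density (Rd d) (\<lambda>y. ennreal (f y))"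
  assumes r: "r > 0" and n: "n \<ge> 2"
    and ind: "indep_vars (\<lambda>_. Rd d) X {1..n}"
    and law: "\<And>i. i \<in> {1..n} \<Longrightarrow> distr M (Rd d) (X i) = \<nu>"
    and f: "integrable (Rd d) f" and f0: "\<And>y. f y \<ge> 0"
    and \<epsilon>: "\<epsilon> > 0" and \<eta>: "0 < \<eta>" "\<eta> \<le> 1 / 2" "12 * \<eta> \<le> \<epsilon>" and K: "K \<ge> 4"
  shows "prob {\<omega> \<in> space M. \<bar>W4 d (\<lambda>i. X i \<omega>) r n - w d\<bar> > 2 * \<epsilon>} \<le>
    measure \<nu> {x \<in> space (Rd d). (\<integral>y. near d r x y * \<bar>f y - f x\<bar> \<partial>Rd d) > \<eta> * (f x * (unit_ball_vol d * r ^ d))} +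
    measure \<nu> {x \<in> space (Rd d). real (n - 1) * (f x * (unit_ball_vol d * r ^ d) / 2) < K} +
    (4 + 512 / \<epsilon>\<^sup>2) / K"
proof -
  interpret R: sigma_finite_measure "Rd d" by (rule sigma_finite_Rd)
  have fm[measurable]: "f \<in> borel_measurable (Rd d)" using f by auto
  have X: "X i \<in> M \<rightarrow>\<^sub>M Rd d" if "i \<in> {1..n}" for i using ind that by (auto simp: indep_vars_def)
  have nu: "prob_space \<nu>" using prob_space_distr[OF X, of 1] law[of 1] n by simp
  interpret nu: prob_space \<nu> by fact
  have sets_nu[measurable_cong, simp]: "sets \<nu> = sets (Rd d)" by (simp add: \<nu>_def)
  have space_nu[simp]: "space \<nu> = space (Rd d)" by (simp add: \<nu>_def)
  define A where "A = {x \<in> space (Rd d). (\<integral>y. near d r x y * \<bar>f y - f x\<bar> \<partial>Rd d) > \<eta> * (f x * (unit_ball_vol d * r ^ d))}"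
  define B where "B = {x \<in> space (Rd d). real (n - 1) * (f x * (unit_ball_vol d * r ^ d) / 2) < K}"
  define C where "C = (4 + 512 / \<epsilon>\<^sup>2) / K"
  have C0: "C \<ge> 0" using K by (simp add: C_def)
  have [measurable]: "A \<in> sets (Rd d)" "B \<in> sets (Rd d)" unfolding A_def B_def by measurable
  have AB: "A \<in> sets \<nu>" "B \<in> sets \<nu>" by simp_all
  let ?J = "{2..n}"
  define P where "P = PiM ?J (\<lambda>_. Rd d)"
  define Y where "Y \<omega> = restrict (\<lambda>i. X i \<omega>) ?J" for \<omega>
  have Ym[measurable]: "Y \<in> M \<rightarrow>\<^sub>M P"
    unfolding Y_def P_def by (intro measurable_restrict X) auto
  have X1[measurable]: "X 1 \<in> M \<rightarrow>\<^sub>M Rd d" using X n by simp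
  \<comment> \<open>Wrapping X 1 as a product over {1} makes it, like the block {2..n}, a
    restriction of the independent family.\<close>
  define P1 where "P1 = PiM {1 :: nat} (\<lambda>_. Rd d)"
  define Y1 where "Y1 \<omega> = restrict (\<lambda>i. X i \<omega>) {1 :: nat}" for \<omega>
  have Y1m[measurable]: "Y1 \<in> M \<rightarrow>\<^sub>M P1"
    unfolding Y1_def P1_def using n by (intro measurable_restrict X) auto
  have Y1_1: "Y1 \<omega> 1 = X 1 \<omega>" for \<omega> by (simp add: Y1_def)
  have c1[measurable]: "(\<lambda>y. y 1) \<in> P1 \<rightarrow>\<^sub>M Rd d"
    unfolding P1_def by (rule measurable_component_singleton) simp
  note c1[unfolded One_nat_def, measurable]
  have "indep_var P1 Y1 P Y"
    unfolding P_def Y_def P1_def Y1_def using n by (intro indep_var_restrict[OF ind]) auto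
  then have joint: "distr M P1 Y1 \<Otimes>\<^sub>M distr M P Y = distr M (P1 \<Otimes>\<^sub>M P) (\<lambda>\<omega>. (Y1 \<omega>, Y \<omega>))"
    by (simp add: indep_var_distribution_eq)
  have nu1: "distr (distr M P1 Y1) (Rd d) (\<lambda>y. y 1) = \<nu>"
    using law[of 1] n by (subst distr_distr[OF c1 Y1m]) (simp add: comp_def Y1_1 del: One_nat_def)
  interpret DY: prob_space "distr M P Y" by (rule prob_space_distr) measurable
  let ?S = "{z \<in> space (P1 \<Otimes>\<^sub>M P). \<bar>W4 d ((snd z)(1 := fst z 1)) r n - w d\<bar> > 2 * \<epsilon>}"
  have comp: "(\<lambda>z. ((snd z)(1 := fst z 1)) i) \<in> P1 \<Otimes>\<^sub>M P \<rightarrow>\<^sub>M Rd d" if "i \<in> {1..n}" for i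
  proof (cases "i = 1")
    case True
    have "(\<lambda>z. fst z 1) \<in> P1 \<Otimes>\<^sub>M P \<rightarrow>\<^sub>M Rd d" by (rule measurable_compose[OF measurable_fst c1])
    then show ?thesis using True by simp
  next
    case False
    then have "i \<in> ?J" using that by auto
    then have "(\<lambda>y. y i) \<in> P \<rightarrow>\<^sub>M Rd d" unfolding P_def by (rule measurable_component_singleton)
    then have "(\<lambda>z. snd z i) \<in> P1 \<Otimes>\<^sub>M P \<rightarrow>\<^sub>M Rd d" by (rule measurable_compose[OF measurable_snd])
    then show ?thesis using False by simp
  qed
  have W[measurable]: "(\<lambda>z. W4 d ((snd z)(1 := fst z 1)) r n) \<in> borel_measurable (P1 \<Otimes>\<^sub>M P)"
    by (rule W4_measurable) (rule comp)
  have S: "?S \<in> sets (P1 \<Otimes>\<^sub>M P)" by measurable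
  have S': "?S \<in> sets (distr M P1 Y1 \<Otimes>\<^sub>M distr M P Y)"
    using S by (simp cong: sets_pair_measure_cong)
  have ev: "{\<omega> \<in> space M. \<bar>W4 d (\<lambda>i. X i \<omega>) r n - w d\<bar> > 2 * \<epsilon>} = (\<lambda>\<omega>. (Y1 \<omega>, Y \<omega>)) -` ?S \<inter> space M"
  proof -
    have "W4 d (\<lambda>i. X i \<omega>) r n = W4 d ((Y \<omega>)(1 := X 1 \<omega>)) r n" for \<omega>
      by (rule W4_cong) (auto simp: Y_def)
    then show ?thesis using measurable_space[OF Y1m] measurable_space[OF Ym]
      by (auto simp: space_pair_measure Y1_1 simp del: One_nat_def)
  qed
  have "ennreal (prob {\<omega> \<in> space M. \<bar>W4 d (\<lambda>i. X i \<omega>) r n - w d\<bar> > 2 * \<epsilon>}) =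
      emeasure (distr M P1 Y1 \<Otimes>\<^sub>M distr M P Y) ?S"
    unfolding joint ev emeasure_eq_measure[symmetric] by (rule emeasure_distr[OF _ S, symmetric]) measurable
  also have "\<dots> = (\<integral>\<^sup>+y. emeasure (distr M P Y) (Pair y -` ?S) \<partial>distr M P1 Y1)"
    by (rule DY.emeasure_pair_measure_alt[OF S'])
  also have "\<dots> \<le> (\<integral>\<^sup>+y. indicator A (y 1) + indicator B (y 1) + ennreal C \<partial>distr M P1 Y1)"
  proof (rule nn_integral_mono_AE)
    \<comment> \<open>A law gives no mass to the zeros of its density, so the bound for frozen
      centres is available almost everywhere.\<close>
    have "AE x in \<nu>. f x > 0" unfolding \<nu>_def by (subst AE_density) auto
    then have "AE x in \<nu>. x \<in> space (Rd d) \<and> f x > 0" using AE_space[of \<nu>] by eventually_elim simp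
    then have "AE y in distr M P1 Y1. y 1 \<in> space (Rd d) \<and> f (y 1) > 0"
      unfolding nu1[symmetric] by (subst (asm) AE_distr_iff) auto
    then show "AE y in distr M P1 Y1. emeasure (distr M P Y) (Pair y -` ?S) \<le>
        indicator A (y 1) + indicator B (y 1) + ennreal C"
      using AE_space
    proof eventually_elim
      case (elim y)
      define x where "x = y 1"
      have x: "x \<in> space (Rd d)" "f x > 0" using elim by (auto simp: x_def)
      have "emeasure (distr M P Y) (Pair y -` ?S) \<le> indicator A x + indicator B x + ennreal C"
      proof (cases "x \<in> A \<or> x \<in> B")
        case True
        have "emeasure (distr M P Y) (Pair y -` ?S) \<le> 1" by (rule DY.emeasure_le_1)
        also have "1 \<le> indicator A x + indicator B x + ennreal C" using True by (auto simp: add_increasing2)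
        finally show ?thesis .
      next
        case False
        have "emeasure (distr M P Y) (Pair y -` ?S) = emeasure M (Y -` (Pair y -` ?S) \<inter> space M)"
          by (rule emeasure_distr[OF Ym]) (rule sets_Pair1[OF S])
        also have "Y -` (Pair y -` ?S) \<inter> space M = {\<omega> \<in> space M. \<bar>W4 d ((\<lambda>i. X i \<omega>)(1 := x)) r n - w d\<bar> > 2 * \<epsilon>}"
        proof -
          have "W4 d ((\<lambda>i. X i \<omega>)(1 := x)) r n = W4 d ((Y \<omega>)(1 := x)) r n" for \<omega>
            by (rule W4_cong) (auto simp: Y_def)
          then show ?thesis using elim measurable_space[OF Ym] by (auto simp: space_pair_measure x_def)
        qed
        also have "emeasure M \<dots> \<le> ennreal C"
        proof -
          have "prob {\<omega> \<in> space M. \<bar>W4 d ((\<lambda>i. X i \<omega>)(1 := x)) r n - w d\<bar> > 2 * \<epsilon>} \<le> C"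
            unfolding C_def
          proof (rule W4_tail_fixed[OF r n _ _ f f0 _ x \<epsilon> \<eta> _ K])
            show "indep_vars (\<lambda>_. Rd d) X {2..n}" by (rule indep_vars_subset[OF ind]) auto
          qed (use False x law nu in \<open>auto simp: A_def B_def \<nu>_def\<close>)
          then show ?thesis by (simp add: emeasure_eq_measure ennreal_leI)
        qed
        also have "\<dots> \<le> indicator A x + indicator B x + ennreal C" by (simp add: add_increasing)
        finally show ?thesis .
      qed
      then show ?case by (simp add: x_def)
    qed
  qed
  also have "\<dots> = (\<integral>\<^sup>+x. indicator A x + indicator B x + ennreal C \<partial>\<nu>)"
    unfolding nu1[symmetric] by (subst nn_integral_distr) auto
  also have "\<dots> = (\<integral>\<^sup>+x. indicator A x + indicator B x \<partial>\<nu>) + (\<integral>\<^sup>+x. ennreal C \<partial>\<nu>)"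
    by (rule nn_integral_add) (intro borel_measurable_add borel_measurable_indicator borel_measurable_const AB)+
  also have "(\<integral>\<^sup>+x. indicator A x + indicator B x \<partial>\<nu>) = (\<integral>\<^sup>+x. indicator A x \<partial>\<nu>) + (\<integral>\<^sup>+x. indicator B x \<partial>\<nu>)"
    by (rule nn_integral_add) (intro borel_measurable_add borel_measurable_indicator borel_measurable_const AB)+
  also have "\<dots> + (\<integral>\<^sup>+x. ennreal C \<partial>\<nu>) = ennreal (measure \<nu> A + measure \<nu> B + C)"
    using C0 by (simp add: nu.emeasure_eq_measure nu.prob_space[unfolded space_nu])
  finally have "prob {\<omega> \<in> space M. \<bar>W4 d (\<lambda>i. X i \<omega>) r n - w d\<bar> > 2 * \<epsilon>} \<le> measure \<nu> A + measure \<nu> B + C"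
    using C0 by (subst (asm) ennreal_le_iff) auto
  then show ?thesis by (simp only: A_def B_def C_def)
qed

section \<open>Convergence in probability\<close>

text \<open>Markov's inequality: on the exceptional set f x is at most 1 / (\<eta> v) times the
  oscillation. The weight f x of the law thus absorbs the f x in the threshold, and an integral
  against Lebesgue measure remains.\<close>

lemma measure_density_oscillation_le:
  fixes f :: "(nat \<Rightarrow> real) \<Rightarrow> real"
  assumes r: "r > 0" and f: "integrable (Rd d) f" and f0: "\<And>y. f y \<ge> 0" and \<eta>: "\<eta> > 0" and e: "e \<ge> 0"
    and osc: "(\<integral>\<^sup>+x. (\<integral>\<^sup>+y. near d r x y * \<bar>f y - f x\<bar> \<partial>Rd d) \<partial>Rd d) \<le> ennreal (\<eta> * e * (unit_ball_vol d * r ^ d))"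
  shows "measure (density (Rd d) (\<lambda>y. ennreal (f y)))
    {x \<in> space (Rd d). (\<integral>y. near d r x y * \<bar>f y - f x\<bar> \<partial>Rd d) > \<eta> * (f x * (unit_ball_vol d * r ^ d))} \<le> e"
proof -
  interpret R: sigma_finite_measure "Rd d" by (rule sigma_finite_Rd)
  have fm[measurable]: "f \<in> borel_measurable (Rd d)" using f by auto
  define v where "v = unit_ball_vol d * r ^ d"
  have v: "v > 0" using r by (simp add: v_def)
  let ?o = "\<lambda>x. \<integral>y. near d r x y * \<bar>f y - f x\<bar> \<partial>Rd d"
  let ?A = "{x \<in> space (Rd d). ?o x > \<eta> * (f x * v)}"
  have "emeasure (density (Rd d) (\<lambda>y. ennreal (f y))) ?A = (\<integral>\<^sup>+x. ennreal (f x) * indicator ?A x \<partial>Rd d)"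
    by (rule emeasure_density) measurable
  also have "\<dots> \<le> (\<integral>\<^sup>+x. ennreal (1 / (\<eta> * v)) * (\<integral>\<^sup>+y. near d r x y * \<bar>f y - f x\<bar> \<partial>Rd d) \<partial>Rd d)"
  proof (rule nn_integral_mono)
    fix x
    \<comment> \<open>If the function is not integrable, the left side is 0 by convention.\<close>
    have "ennreal (?o x) \<le> (\<integral>\<^sup>+y. near d r x y * \<bar>f y - f x\<bar> \<partial>Rd d)"
    proof (cases "integrable (Rd d) (\<lambda>y. near d r x y * \<bar>f y - f x\<bar>)")
      case True
      then show ?thesis by (subst nn_integral_eq_integral) (auto simp: near_range)
    qed (simp add: not_integrable_integral_eq)
    moreover have "ennreal (f x) * indicator ?A x \<le> ennreal (1 / (\<eta> * v)) * ennreal (?o x)"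
    proof (cases "x \<in> ?A")
      case True
      then have "f x * (\<eta> * v) \<le> ?o x" by (simp add: mult_ac)
      then have "f x \<le> 1 / (\<eta> * v) * ?o x" using \<eta> v by (simp add: pos_le_divide_eq)
      then have "ennreal (f x) \<le> ennreal (1 / (\<eta> * v) * ?o x)" by (rule ennreal_leI)
      also have "\<dots> = ennreal (1 / (\<eta> * v)) * ennreal (?o x)" using \<eta> v by (intro ennreal_mult') simp
      finally show ?thesis using True by (simp only: indicator_simps mult_1_right)
    qed simp
    ultimately show "ennreal (f x) * indicator ?A x \<le>
      ennreal (1 / (\<eta> * v)) * (\<integral>\<^sup>+y. near d r x y * \<bar>f y - f x\<bar> \<partial>Rd d)"
      by (meson mult_left_mono order_trans zero_le)
  qed
  also have "\<dots> = ennreal (1 / (\<eta> * v)) * (\<integral>\<^sup>+x. (\<integral>\<^sup>+y. near d r x y * \<bar>f y - f x\<bar> \<partial>Rd d) \<partial>Rd d)"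
    by (rule nn_integral_cmult) measurable
  also have "\<dots> \<le> ennreal (1 / (\<eta> * v)) * ennreal (\<eta> * e * v)"
    using osc by (intro mult_left_mono) (auto simp: v_def)
  also have "\<dots> = ennreal e" using \<eta> v e by (simp flip: ennreal_mult)
  finally show ?thesis
    using e unfolding v_def measure_def by (simp add: enn2real_leI)
qed

text \<open>For almost every x the product \<open>s n * f x\<close> tends to infinity, so the
  indicators vanish eventually and dominated convergence applies. Meant for the centres whose mean
  degree stays below K.\<close>

lemma (in prob_space) measure_low_density_tendsto_0:
  fixes f :: "'a \<Rightarrow> real"
  assumes [measurable]: "f \<in> borel_measurable M" and pos: "AE x in M. f x > 0"
    and s: "filterlim s at_top sequentially"
  shows "(\<lambda>n. prob {x \<in> space M. s n * f x < K}) \<longlonglongrightarrow> 0"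
proof -
  have "(\<lambda>n. \<integral>x. indicator {x \<in> space M. s n * f x < K} x \<partial>M) \<longlonglongrightarrow> (\<integral>x. 0 \<partial>M :: real)"
  proof (rule integral_dominated_convergence[where w="\<lambda>_. 1"])
    show "AE x in M. (\<lambda>n. indicator {x \<in> space M. s n * f x < K} x) \<longlonglongrightarrow> (0 :: real)"
      using pos
    proof eventually_elim
      case (elim x)
      have "\<forall>\<^sub>F n in sequentially. s n \<ge> K / f x" using s by (simp add: filterlim_at_top)
      then have "\<forall>\<^sub>F n in sequentially. indicator {x \<in> space M. s n * f x < K} x = (0 :: real)"
        by eventually_elim (use elim in \<open>auto simp: pos_divide_le_eq indicator_def\<close>)
      then show ?case by (rule tendsto_eventually)
    qed
  qed (auto simp: indicator_def)
  then show ?thesis by simp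
qed

text \<open>A point within half the gap of w d is, by the triangle inequality, more than half the
  gap away from every other value.\<close>

lemma argmin_dim_eq_singleton:
  assumes d: "d \<ge> 1" and gap: "\<And>t. t \<ge> 1 \<Longrightarrow> t \<noteq> d \<Longrightarrow> \<bar>w t - w d\<bar> \<ge> \<delta>" and x: "\<bar>x - w d\<bar> < \<delta> / 2"
  shows "argmin_dim x = {d}"
proof -
  have *: "\<bar>x - w d\<bar> < \<bar>x - w t\<bar>" if "t \<ge> 1" "t \<noteq> d" for t
    using gap[OF that] x by linarith
  have "d \<in> argmin_dim x" using d * by (force simp: argmin_dim_def)
  moreover have "s = d" if "s \<in> argmin_dim x" for s
    using that d *[of s] by (force simp: argmin_dim_def)
  ultimately show ?thesis by blast
qed

lemma argmin_dim_measurable: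
  assumes [measurable]: "W \<in> borel_measurable M"
  shows "{\<omega> \<in> space M. argmin_dim (W \<omega>) = {d}} \<in> sets M"
proof -
  have "{\<omega> \<in> space M. argmin_dim (W \<omega>) = {d}} = {\<omega> \<in> space M. \<forall>s. (1 \<le> s \<and> (\<forall>t. 1 \<le> t \<longrightarrow> \<bar>W \<omega> - w s\<bar> \<le> \<bar>W \<omega> - w t\<bar>)) \<longleftrightarrow> s = d}"
    by (auto simp: argmin_dim_def set_eq_iff)
  also have "\<dots> \<in> sets M" by measurable
  finally show ?thesis .
qed

lemma (in prob_space) W4_conv_in_prob:
  fixes f :: "(nat \<Rightarrow> real) \<Rightarrow> real" and d :: nat
  defines "\<nu> \<equiv> density (Rd d) (\<lambda>y. ennreal (f y))"
  assumes r: "\<And>n. r n > 0" "r \<longlonglongrightarrow> 0" and nr: "filterlim (\<lambda>n. real n * r n ^ d) at_top sequentially"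
    and ind: "indep_vars (\<lambda>_. Rd d) X {1..}"
    and law: "\<And>i. i \<ge> 1 \<Longrightarrow> distr M (Rd d) (X i) = \<nu>"
    and f: "integrable (Rd d) f" and f0: "\<And>y. f y \<ge> 0"
  shows "conv_in_prob M (\<lambda>n \<omega>. W4 d (\<lambda>i. X i \<omega>) (r n) n) (w d)"
  unfolding conv_in_prob_def
proof (intro allI impI LIMSEQ_I)
  fix \<epsilon> e :: real assume \<epsilon>: "\<epsilon> > 0" and e: "e > 0"
  have fm[measurable]: "f \<in> borel_measurable (Rd d)" using f by auto
  have "X 1 \<in> M \<rightarrow>\<^sub>M Rd d" using ind by (auto simp: indep_vars_def)
  then have nu: "prob_space \<nu>" using prob_space_distr[of "X 1" "Rd d"] law[of 1] by simp
  interpret nu: prob_space \<nu> by fact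
  have sets_nu[measurable_cong, simp]: "sets \<nu> = sets (Rd d)" by (simp add: \<nu>_def)
  have space_nu: "space \<nu> = space (Rd d)" by (simp add: \<nu>_def)
  \<comment> \<open>The tail bound is stated for twice its tolerance and asks for \<eta> \<le> 1/2
    and 12 \<eta> \<le> \<epsilon>'.\<close>
  define \<epsilon>' \<eta> where "\<epsilon>' = \<epsilon> / 2" and "\<eta> = min (1 / 2) (\<epsilon>' / 12)"
  have \<epsilon>': "\<epsilon>' > 0" and \<eta>: "0 < \<eta>" "\<eta> \<le> 1 / 2" "12 * \<eta> \<le> \<epsilon>'" using \<epsilon> by (auto simp: \<epsilon>'_def \<eta>_def)
  define C where "C = 4 + 512 / \<epsilon>'\<^sup>2"
  have C: "C > 0" by (simp add: C_def add_pos_nonneg)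
  \<comment> \<open>This term and the two exceptional sets receive e/4 each, so the total stays
    below e.\<close>
  define K where "K = max 4 (4 * C / e)"
  have K: "K \<ge> 4" and CK: "C / K \<le> e / 4"
  proof -
    show "K \<ge> 4" by (simp add: K_def)
    moreover have "4 * C / e \<le> K" by (simp add: K_def)
    ultimately show "C / K \<le> e / 4" using e by (simp add: field_simps)
  qed
  define v where "v n = unit_ball_vol d * r n ^ d" for n
  let ?A = "\<lambda>n. {x \<in> space (Rd d). (\<integral>y. near d (r n) x y * \<bar>f y - f x\<bar> \<partial>Rd d) > \<eta> * (f x * v n)}"
  let ?B = "\<lambda>n. {x \<in> space (Rd d). real (n - 1) * (f x * v n / 2) < K}"
  \<comment> \<open>The factor \<eta> offsets the division by \<eta> in Markov's inequality.\<close>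
  have "\<eta> * (e / 4) > 0" using \<eta> e by simp
  from nn_integral_oscillation_le[OF f this] obtain \<delta> where \<delta>: "\<delta> > 0"
    "\<And>r. 0 < r \<Longrightarrow> r \<le> \<delta> \<Longrightarrow>
      (\<integral>\<^sup>+x. (\<integral>\<^sup>+y. near d r x y * \<bar>f y - f x\<bar> \<partial>Rd d) \<partial>Rd d) \<le> ennreal (\<eta> * (e / 4) * (unit_ball_vol d * r ^ d))"
    by blast
  have A: "\<forall>\<^sub>F n in sequentially. measure \<nu> (?A n) \<le> e / 4"
  proof -
    have "\<forall>\<^sub>F n in sequentially. r n < \<delta>" using r(2) \<delta>(1) by (rule order_tendstoD)
    then show ?thesis
    proof eventually_elim
      case (elim n)
      show ?case unfolding \<nu>_def v_def
        by (rule measure_density_oscillation_le[OF r(1) f f0 \<eta>(1) _ \<delta>(2)[OF r(1)]]) (use elim e in auto)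
    qed
  qed
  have B: "\<forall>\<^sub>F n in sequentially. measure \<nu> (?B n) < e / 4"
  proof -
    \<comment> \<open>The 1/4 combines the half in the lower bound for the mean degree with n - 1
      \<ge> n/2 for n \<ge> 2.\<close>
    have lim: "filterlim (\<lambda>n. unit_ball_vol d / 4 * (real n * r n ^ d)) at_top sequentially"
      using unit_ball_vol_pos[of d] by (intro filterlim_tendsto_pos_mult_at_top[OF tendsto_const _ nr]) auto
    have s: "filterlim (\<lambda>n. real (n - 1) * v n / 2) at_top sequentially"
    proof (rule filterlim_at_top_mono[OF lim])
      show "\<forall>\<^sub>F n in sequentially. unit_ball_vol d / 4 * (real n * r n ^ d) \<le> real (n - 1) * v n / 2"
        using eventually_ge_at_top[of 2]
      proof eventually_elim
        case (elim n)
        have "v n \<ge> 0" using r(1)[of n] by (simp add: v_def)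
        moreover have "real n / 2 \<le> real (n - 1)" using elim by (simp add: of_nat_diff)
        ultimately have "real n / 2 * v n \<le> real (n - 1) * v n" by (rule mult_right_mono[rotated])
        then show ?case by (simp add: v_def mult_ac)
      qed
    qed
    have "AE x in \<nu>. f x > 0" unfolding \<nu>_def by (subst AE_density) auto
    from nu.measure_low_density_tendsto_0[OF _ this s, of K]
    have "(\<lambda>n. measure \<nu> {x \<in> space \<nu>. real (n - 1) * v n / 2 * f x < K}) \<longlonglongrightarrow> 0" by simp
    from order_tendstoD(2)[OF this, of "e / 4"] e show ?thesis by (simp add: space_nu mult_ac)
  qed
  have "\<forall>\<^sub>F n in sequentially. prob {\<omega> \<in> space M. \<bar>W4 d (\<lambda>i. X i \<omega>) (r n) n - w d\<bar> > \<epsilon>} < e"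
    using A B eventually_ge_at_top[of 2]
  proof eventually_elim
    case (elim n)
    have "prob {\<omega> \<in> space M. \<bar>W4 d (\<lambda>i. X i \<omega>) (r n) n - w d\<bar> > 2 * \<epsilon>'} \<le>
      measure \<nu> (?A n) + measure \<nu> (?B n) + C / K"
      unfolding \<nu>_def v_def C_def
    proof (rule W4_tail[OF r(1) elim(3) _ _ f f0 \<epsilon>' \<eta> K])
      show "indep_vars (\<lambda>_. Rd d) X {1..n}" by (rule indep_vars_subset[OF ind]) auto
    qed (use law in \<open>auto simp: \<nu>_def\<close>)
    moreover have e2: "2 * \<epsilon>' = \<epsilon>" by (simp add: \<epsilon>'_def)
    ultimately show ?case using elim(1,2) CK e unfolding e2 by linarith
  qed
  then show "\<exists>n0. \<forall>n\<ge>n0. norm (prob {\<omega> \<in> space M. \<bar>W4 d (\<lambda>i. X i \<omega>) (r n) n - w d\<bar> > \<epsilon>} - 0) < e"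
    by (simp add: eventually_sequentially)
qed

theorem theorem4:
  fixes M :: "'a measure" and d :: nat and f :: "(nat \<Rightarrow> real) \<Rightarrow> ennreal"
    and r :: "nat \<Rightarrow> real" and X :: "nat \<Rightarrow> 'a \<Rightarrow> (nat \<Rightarrow> real)"
  assumes "prob_space M"
    and "d \<ge> 1"
    and "\<And>n. r n > 0"
    and "r \<longlonglongrightarrow> 0"
    and "filterlim (\<lambda>n. real n * r n ^ d) at_top sequentially"
    and "prob_space.indep_vars M (\<lambda>_. Rd d) X {1..}"
    and "\<And>i. i \<ge> 1 \<Longrightarrow> distributed M (Rd d) (X i) f"
  shows "conv_in_prob M (\<lambda>n \<omega>. W4 d (\<lambda>i. X i \<omega>) (r n) n) (w d)
     \<and> (\<lambda>n. measure M {\<omega> \<in> space M. argmin_dim (W4 d (\<lambda>i. X i \<omega>) (r n) n) = {d}})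
         \<longlonglongrightarrow> 1"
proof -
  interpret prob_space M by fact
  have fm[measurable]: "f \<in> borel_measurable (Rd d)" using assms(7)[of 1] by (auto simp: distributed_def)
  have law: "distr M (Rd d) (X i) = density (Rd d) f" if "i \<ge> 1" for i
    using assms(7)[OF that] by (simp add: distributed_def)
  have X: "X i \<in> M \<rightarrow>\<^sub>M Rd d" if "i \<ge> 1" for i
    using assms(7)[OF that] by (simp add: distributed_def)
  have int: "(\<integral>\<^sup>+x. f x \<partial>Rd d) = 1"
  proof -
    interpret nu: prob_space "density (Rd d) f" using prob_space_distr[OF X, of 1] law[of 1] by simp
    have "(\<integral>\<^sup>+x. f x \<partial>Rd d) = emeasure (density (Rd d) f) (space (Rd d))"
      by (subst emeasure_density) (auto intro!: nn_integral_cong)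
    then show ?thesis using nu.emeasure_space_1 by simp
  qed
  \<comment> \<open>The given density may be infinite on a null set; this version is real and
    nonnegative everywhere and defines the same law.\<close>
  define g where "g x = enn2real (f x)" for x
  have [measurable]: "g \<in> borel_measurable (Rd d)" unfolding g_def by measurable
  have "AE x in Rd d. f x \<noteq> \<infinity>"
    by (rule nn_integral_PInf_AE) (auto simp: int)
  then have fg: "AE x in Rd d. f x = ennreal (g x)"
    by eventually_elim (simp add: g_def less_top)
  have g: "integrable (Rd d) g"
  proof (rule integrableI_nonneg)
    have "(\<integral>\<^sup>+x. ennreal (g x) \<partial>Rd d) = (\<integral>\<^sup>+x. f x \<partial>Rd d)"
      using fg by (intro nn_integral_cong_AE) auto
    then show "(\<integral>\<^sup>+x. ennreal (g x) \<partial>Rd d) < \<infinity>" by (simp add: int)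
  qed (auto simp: g_def)
  have "density (Rd d) f = density (Rd d) (\<lambda>x. ennreal (g x))"
    using fg by (intro density_cong) auto
  then have conv: "conv_in_prob M (\<lambda>n \<omega>. W4 d (\<lambda>i. X i \<omega>) (r n) n) (w d)"
    using assms(3-6) g by (intro W4_conv_in_prob[where f=g]) (auto simp: law g_def)
  let ?W = "\<lambda>n \<omega>. W4 d (\<lambda>i. X i \<omega>) (r n) n"
  have Wm[measurable]: "?W n \<in> borel_measurable M" for n by (rule W4_measurable) (auto intro: X)
  from w_gap[OF \<open>d \<ge> 1\<close>] obtain \<delta> where \<delta>: "\<delta> > 0"
    "\<And>t. t \<ge> 1 \<Longrightarrow> t \<noteq> d \<Longrightarrow> \<bar>w t - w d\<bar> \<ge> \<delta>" by blast
  \<comment> \<open>Off the event only a weak inequality is known, while the uniqueness of the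
    minimiser asks for a strict one with \<delta>/2; hence the smaller \<delta>/3.\<close>
  have lower: "1 - prob {\<omega> \<in> space M. \<bar>?W n \<omega> - w d\<bar> > \<delta> / 3} \<le> prob {\<omega> \<in> space M. argmin_dim (?W n \<omega>) = {d}}" for n
  proof -
    have "1 - prob {\<omega> \<in> space M. \<bar>?W n \<omega> - w d\<bar> > \<delta> / 3} =
        prob (space M - {\<omega> \<in> space M. \<bar>?W n \<omega> - w d\<bar> > \<delta> / 3})"
      by (rule prob_compl[symmetric]) measurable
    also have "\<dots> \<le> prob {\<omega> \<in> space M. argmin_dim (?W n \<omega>) = {d}}"
    proof (rule finite_measure_mono)
      show "space M - {\<omega> \<in> space M. \<bar>?W n \<omega> - w d\<bar> > \<delta> / 3} \<subseteq> {\<omega> \<in> space M. argmin_dim (?W n \<omega>) = {d}}"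
      proof
        fix \<omega> assume "\<omega> \<in> space M - {\<omega> \<in> space M. \<bar>?W n \<omega> - w d\<bar> > \<delta> / 3}"
        then have "\<omega> \<in> space M" "\<bar>?W n \<omega> - w d\<bar> < \<delta> / 2" using \<delta>(1) by auto
        then show "\<omega> \<in> {\<omega> \<in> space M. argmin_dim (?W n \<omega>) = {d}}"
          using argmin_dim_eq_singleton[OF \<open>d \<ge> 1\<close> \<delta>(2)] by blast
      qed
    qed (rule argmin_dim_measurable[OF Wm])
    finally show ?thesis .
  qed
  have "(\<lambda>n. prob {\<omega> \<in> space M. \<bar>?W n \<omega> - w d\<bar> > \<delta> / 3}) \<longlonglongrightarrow> 0"
    by (rule conv[unfolded conv_in_prob_def, rule_format]) (use \<delta>(1) in simp)
  from tendsto_diff[OF tendsto_const[of 1] this]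
  have "(\<lambda>n. 1 - prob {\<omega> \<in> space M. \<bar>?W n \<omega> - w d\<bar> > \<delta> / 3}) \<longlonglongrightarrow> 1" by simp
  then have "(\<lambda>n. prob {\<omega> \<in> space M. argmin_dim (?W n \<omega>) = {d}}) \<longlonglongrightarrow> 1"
    by (rule tendsto_sandwich[OF always_eventually always_eventually _ tendsto_const, rotated 2])
      (rule allI, rule lower, simp)
  with conv show ?thesis by blast
qed

end
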